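(* Let $\mathcal{C}$ be a class of (undirected) graphs that is closed under taking minors and has locally bounded tree-width. Let $\mathcal{K}$ be the class of all finite $\tau$-structures (for a fixed finite relational signature $\tau$) whose Gaifman graphs belong to $\mathcal{C}$. Let $\psi(\overline{x}, y)$ be a first-order formula over $\tau$, where $\overline{x}=\langle x_1,\ldots,x_r\rangle$ and $y$ is a single variable (a unary first-order query with $r$ parameters). Then there exists a scalable watermarking scheme preserving $\psi(\overline{x},y)$ on (weighted) structures whose underlying structure is in $\mathcal{K}$.
   Context: A $\tau$-structure $G$ has universe $V$ and interpretations $R^G\subseteq V^{r_R}$ of each relation symbol. Its Gaifman graph has vertex set $V$ and an edge between $v_1\neq v_2$ iff they occur together in some tuple of some relation of $G$. A class of graphs has locally bounded tree-width if there is a function $f:\mathbb{N}\to\mathbb{N}$ such that for every graph $G$ in the class, every vertex $v$ and every $\rho\in\mathbb{N}$, the subgraph induced by the vertices at distance at most $\rho$ from $v$ has tree-width at most $f(\rho)$. A class is closed under minors if every minor (graph obtained by edge contractions, edge deletions and deletions of isolated vertices) of a member is a member. A weighted structure $(G,W)$ is a structure $G$ together with a partial function $W:V\to\mathbb{N}$ (weights of elements; here the output length is $1$). For $\overline{a}\in V^r$, the output of the query is $\psi(\overline{a},G)=\{b\in V\mid G\models\psi(\overline{a},b)\}$, and $W(\psi(\overline{a},G))=\sum_{b\in\psi(\overline{a},G)}W(b)$. The set of active elements is $U=\bigcup_{\overline{a}\in V^r}\psi(\overline{a},G)$. For $c,d\in\mathbb{N}$, $(G,W')$ is a $c$-local distortion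 of $(G,W)$ if $|W'(b)-W(b)|\le c$ for all $b$, and a $d$-global distortion with respect to $\psi$ if $|W'(\psi(\overline{a},G))-W(\psi(\overline{a},G))|\le d$ for all $\overline{a}\in V^r$. A watermarking scheme preserving $\psi(\overline{x},y)$ on a class of weighted structures consists of two algorithms, a marker $\mathcal{M}$ and a detector $\mathcal{D}$, a function $f:\mathbb{N}\to\mathbb{N}$ and a constant $d\in\mathbb{N}$ such that: $\mathcal{M}$ takes a weighted structure $(G,W)$ in the class and a mark $\mu$ (a bit string of length $f(|U|)$, $U$ the set of active elements) and outputs a weighted structure $(G,W_\mu)$ in the class that is a $1$-local and $d$-global distortion of $(G,W)$ with respect to $\psi$; $\mathcal{D}$ is given the original $(G,W)$ and oracle access to answers of queries $\psi(\overline{a},y)$ (with the weights) on $(G,W_\mu)$, and outputs $\mu$. The scheme is scalable if $f$ grows asymptotically at least as fast as some fractional power $n^{\epsilon}$, $\epsilon>0$ (e.g. $f(n)=\sqrt{n}$ is scalable, $f(n)=\log n$ is not).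
   Formalization: The scheme is only required to work on inputs whose weight function is defined and at least 1 on every active element; with zero weights the claim fails (e.g. the query y = y on edgeless structures with all weights 0). *)

theory Defs
  imports Complex_Main "HOL-Library.Landau_Symbols" "HOL-Library.Nat_Bijection"
begin

section \<open>Undirected graphs, minors and tree-width\<close>

type_synonym 'a ugraph = "'a set \<times> 'a set set"

abbreviation verts :: "'a ugraph \<Rightarrow> 'a set" where "verts G \<equiv> fst G"
abbreviation edges :: "'a ugraph \<Rightarrow> 'a set set" where "edges G \<equiv> snd G"

definition simple_graph :: "'a ugraph \<Rightarrow> bool" where
  "simple_graph G \<longleftrightarrow> (\<forall>e \<in> edges G. e \<subseteq> verts G \<and> card e = 2)"

definition induced :: "'a ugraph \<Rightarrow> 'a set \<Rightarrow> 'a ugraph" where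
  "induced G S = (verts G \<inter> S, {e \<in> edges G. e \<subseteq> S})"

definition walk :: "'a ugraph \<Rightarrow> 'a list \<Rightarrow> bool" where
  "walk G p \<longleftrightarrow> p \<noteq> [] \<and> set p \<subseteq> verts G \<and>
     (\<forall>i. Suc i < length p \<longrightarrow> {p ! i, p ! Suc i} \<in> edges G)"

text \<open>A walk listing \<open>k + 1\<close> vertices has \<open>k\<close> edges.\<close>

definition neighbourhood :: "'a ugraph \<Rightarrow> nat \<Rightarrow> 'a \<Rightarrow> 'a set" where
  "neighbourhood G \<rho> v = {u. \<exists>p. walk G p \<and> hd p = v \<and> last p = u \<and> length p \<le> \<rho> + 1}"

definition connected_graph :: "'a ugraph \<Rightarrow> bool" where
  "connected_graph G \<longleftrightarrow> verts G \<noteq> {} \<and>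
     (\<forall>u \<in> verts G. \<forall>v \<in> verts G. \<exists>p. walk G p \<and> hd p = u \<and> last p = v)"

definition cycle :: "'a ugraph \<Rightarrow> 'a list \<Rightarrow> bool" where
  "cycle G p \<longleftrightarrow> walk G p \<and> distinct p \<and> 3 \<le> length p \<and> {last p, hd p} \<in> edges G"

definition tree :: "'a ugraph \<Rightarrow> bool" where
  "tree T \<longleftrightarrow> simple_graph T \<and> connected_graph T \<and> (\<nexists>p. cycle T p)"

definition tree_decomposition :: "'a ugraph \<Rightarrow> nat ugraph \<Rightarrow> (nat \<Rightarrow> 'a set) \<Rightarrow> bool" where
  "tree_decomposition G T B \<longleftrightarrow> tree T \<and>
     (\<Union>t \<in> verts T. B t) = verts G \<and>
     (\<forall>e \<in> edges G. \<exists>t \<in> verts T. e \<subseteq> B t) \<and>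
     (\<forall>v \<in> verts G. connected_graph (induced T {t. v \<in> B t}))"

definition tree_width_at_most :: "'a ugraph \<Rightarrow> nat \<Rightarrow> bool" where
  "tree_width_at_most G k \<longleftrightarrow>
     (\<exists>T B. tree_decomposition G T B \<and> (\<forall>t \<in> verts T. finite (B t) \<and> card (B t) \<le> k + 1))"

definition locally_bounded_tree_width :: "'a ugraph set \<Rightarrow> bool" where
  "locally_bounded_tree_width C \<longleftrightarrow>
     (\<exists>f :: nat \<Rightarrow> nat. \<forall>G \<in> C. \<forall>v \<in> verts G. \<forall>\<rho>.
        tree_width_at_most (induced G (neighbourhood G \<rho> v)) (f \<rho>))"

text \<open>Contracting \<open>{u, v}\<close> names the merged vertex \<open>u\<close>; as \<open>{u, v} = {v, u}\<close>, either endpoint may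
  be kept. Loops vanish and parallel edges are identified.\<close>

definition contract :: "'a ugraph \<Rightarrow> 'a \<Rightarrow> 'a \<Rightarrow> 'a ugraph" where
  "contract G u v =
     (verts G - {v}, {e \<in> (\<lambda>e. (\<lambda>x. if x = v then u else x) ` e) ` edges G. card e = 2})"

inductive minor_step :: "'a ugraph \<Rightarrow> 'a ugraph \<Rightarrow> bool" where
  delete_edge: "e \<in> edges G \<Longrightarrow> minor_step G (verts G, edges G - {e})"
| delete_isolated_vertex:
    "v \<in> verts G \<Longrightarrow> v \<notin> \<Union> (edges G) \<Longrightarrow> minor_step G (verts G - {v}, edges G)"
| contract_edge: "{u, v} \<in> edges G \<Longrightarrow> u \<noteq> v \<Longrightarrow> minor_step G (contract G u v)"

text \<open>Closure under isomorphism is deliberately not part of this condition: it is not needed, and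
  leaving it out admits more classes.\<close>

definition minor_closed :: "'a ugraph set \<Rightarrow> bool" where
  "minor_closed C \<longleftrightarrow> (\<forall>G \<in> C. \<forall>H. minor_step\<^sup>*\<^sup>* G H \<longrightarrow> H \<in> C)"


section \<open>Finite relational structures and first-order logic\<close>

text \<open>A finite relational signature is the list of the arities of its symbols. Since structures are
  inputs of algorithms, their elements are natural numbers, the universe being any finite set of
  them.\<close>

type_synonym signature = "nat list"

record struct =
  univ :: "nat set"
  rels :: "nat list set list"

definition tuples :: "nat set \<Rightarrow> nat \<Rightarrow> nat list set" where
  "tuples V n = {t. length t = n \<and> set t \<subseteq> V}"

definition finite_structure :: "signature \<Rightarrow> struct \<Rightarrow> bool" where
  "finite_structure \<tau> G \<longleftrightarrow> finite (univ G) \<and> length (rels G) = length \<tau> \<and>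
     (\<forall>i < length \<tau>. rels G ! i \<subseteq> tuples (univ G) (\<tau> ! i))"

definition Gaifman_graph :: "struct \<Rightarrow> nat ugraph" where
  "Gaifman_graph G =
     (univ G, {{u, v} |u v. u \<noteq> v \<and> (\<exists>R \<in> set (rels G). \<exists>t \<in> R. u \<in> set t \<and> v \<in> set t)})"

definition structures_over :: "signature \<Rightarrow> nat ugraph set \<Rightarrow> struct set" where
  "structures_over \<tau> C = {G. finite_structure \<tau> G \<and> Gaifman_graph G \<in> C}"

datatype formula =
    Rel nat "nat list"
  | Eq nat nat
  | Neg formula
  | Conj formula formula
  | Ex nat formula

primrec well_formed :: "signature \<Rightarrow> formula \<Rightarrow> bool" where
  "well_formed \<tau> (Rel i xs) \<longleftrightarrow> i < length \<tau> \<and> length xs = \<tau> ! i"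
| "well_formed \<tau> (Eq x y) \<longleftrightarrow> True"
| "well_formed \<tau> (Neg \<phi>) \<longleftrightarrow> well_formed \<tau> \<phi>"
| "well_formed \<tau> (Conj \<phi> \<chi>) \<longleftrightarrow> well_formed \<tau> \<phi> \<and> well_formed \<tau> \<chi>"
| "well_formed \<tau> (Ex x \<phi>) \<longleftrightarrow> well_formed \<tau> \<phi>"

primrec free_vars :: "formula \<Rightarrow> nat set" where
  "free_vars (Rel i xs) = set xs"
| "free_vars (Eq x y) = {x, y}"
| "free_vars (Neg \<phi>) = free_vars \<phi>"
| "free_vars (Conj \<phi> \<chi>) = free_vars \<phi> \<union> free_vars \<chi>"
| "free_vars (Ex x \<phi>) = free_vars \<phi> - {x}"

primrec sat :: "struct \<Rightarrow> (nat \<Rightarrow> nat) \<Rightarrow> formula \<Rightarrow> bool" where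
  "sat G \<sigma> (Rel i xs) \<longleftrightarrow> map \<sigma> xs \<in> rels G ! i"
| "sat G \<sigma> (Eq x y) \<longleftrightarrow> \<sigma> x = \<sigma> y"
| "sat G \<sigma> (Neg \<phi>) \<longleftrightarrow> \<not> sat G \<sigma> \<phi>"
| "sat G \<sigma> (Conj \<phi> \<chi>) \<longleftrightarrow> sat G \<sigma> \<phi> \<and> sat G \<sigma> \<chi>"
| "sat G \<sigma> (Ex x \<phi>) \<longleftrightarrow> (\<exists>v \<in> univ G. sat G (\<sigma>(x := v)) \<phi>)"

text \<open>In \<open>\<psi>(x\<^sub>1, \<dots>, x\<^sub>r, y)\<close> the parameters are the variables \<open>0, \<dots>, r - 1\<close> and \<open>y\<close> is the
  variable \<open>r\<close>.\<close>

definition unary_query :: "signature \<Rightarrow> nat \<Rightarrow> formula \<Rightarrow> bool" where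
  "unary_query \<tau> r \<psi> \<longleftrightarrow> well_formed \<tau> \<psi> \<and> free_vars \<psi> \<subseteq> {..r}"

definition query_output :: "nat \<Rightarrow> formula \<Rightarrow> struct \<Rightarrow> nat list \<Rightarrow> nat set" where
  "query_output r \<psi> G a = {b \<in> univ G. sat G (\<lambda>i. if i < r then a ! i else b) \<psi>}"

definition active :: "nat \<Rightarrow> formula \<Rightarrow> struct \<Rightarrow> nat set" where
  "active r \<psi> G = (\<Union>a \<in> tuples (univ G) r. query_output r \<psi> G a)"


section \<open>Weights and distortions\<close>

type_synonym weights = "nat \<Rightarrow> nat option"

text \<open>A weight function is partial, but it must be defined on the active elements, as otherwise the
  weight of a query output is not defined.\<close>

definition weighted_over :: "struct set \<Rightarrow> nat \<Rightarrow> formula \<Rightarrow> (struct \<times> weights) set" where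
  "weighted_over K r \<psi> = {(G, W). G \<in> K \<and> dom W \<subseteq> univ G \<and> active r \<psi> G \<subseteq> dom W}"

definition output_weight :: "nat \<Rightarrow> formula \<Rightarrow> struct \<Rightarrow> weights \<Rightarrow> nat list \<Rightarrow> nat" where
  "output_weight r \<psi> G W a = (\<Sum>b \<in> query_output r \<psi> G a. the (W b))"

definition local_distortion :: "nat \<Rightarrow> weights \<Rightarrow> weights \<Rightarrow> bool" where
  "local_distortion c W W' \<longleftrightarrow> dom W' = dom W \<and>
     (\<forall>b \<in> dom W. \<bar>int (the (W' b)) - int (the (W b))\<bar> \<le> int c)"

definition global_distortion ::
    "nat \<Rightarrow> nat \<Rightarrow> formula \<Rightarrow> struct \<Rightarrow> weights \<Rightarrow> weights \<Rightarrow> bool" where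
  "global_distortion d r \<psi> G W W' \<longleftrightarrow>
     (\<forall>a \<in> tuples (univ G) r.
        \<bar>int (output_weight r \<psi> G W' a) - int (output_weight r \<psi> G W a)\<bar> \<le> int d)"


section \<open>Algorithms\<close>

text \<open>Programs for the partial recursive functions, extended by \<open>Ask\<close>, which queries an external
  function \<open>Q\<close>. \<open>computes Q p xs y\<close> says that \<open>p\<close> halts on input \<open>xs\<close> with output \<open>y\<close>.\<close>

datatype program =
    Zero
  | Succ
  | Proj nat
  | Ask
  | Comp program "program list"
  | PrimRec program program
  | Mu program

inductive computes :: "(nat \<Rightarrow> nat) \<Rightarrow> program \<Rightarrow> nat list \<Rightarrow> nat \<Rightarrow> bool" for Q where
  Zero: "computes Q Zero xs 0"
| Succ: "computes Q Succ [x] (Suc x)"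
| Proj: "i < length xs \<Longrightarrow> computes Q (Proj i) xs (xs ! i)"
| Ask: "computes Q Ask [x] (Q x)"
| Comp: "list_all2 (\<lambda>q y. computes Q q xs y) qs ys \<Longrightarrow> computes Q p ys z \<Longrightarrow>
    computes Q (Comp p qs) xs z"
| PrimRec_0: "computes Q p xs y \<Longrightarrow> computes Q (PrimRec p q) (0 # xs) y"
| PrimRec_Suc: "computes Q (PrimRec p q) (n # xs) y \<Longrightarrow> computes Q q (n # y # xs) z \<Longrightarrow>
    computes Q (PrimRec p q) (Suc n # xs) z"
| Mu: "computes Q p (n # xs) 0 \<Longrightarrow> (\<forall>m < n. \<exists>y. computes Q p (m # xs) (Suc y)) \<Longrightarrow>
    computes Q (Mu p) xs n"

inductive_cases Zero_computesE: "computes Q Zero xs z"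
inductive_cases Succ_computesE: "computes Q Succ xs z"
inductive_cases Proj_computesE: "computes Q (Proj i) xs z"
inductive_cases Ask_computesE: "computes Q Ask xs z"
inductive_cases Comp_computesE: "computes Q (Comp p qs) xs z"
inductive_cases PrimRec_0_computesE: "computes Q (PrimRec p q) (0 # xs) z"
inductive_cases PrimRec_Suc_computesE: "computes Q (PrimRec p q) (Suc n # xs) z"
inductive_cases Mu_computesE: "computes Q (Mu p) xs z"

lemma computes_unique:
  assumes "computes Q p xs y" and "computes Q p xs z"
  shows "y = z"
  using assms
proof (induction arbitrary: z rule: computes.induct)
  case (Comp xs qs ys p z' z)
  from Comp.prems obtain ys' where
    all: "list_all2 (\<lambda>q y. computes Q q xs y) qs ys'" and last: "computes Q p ys' z"
    by (rule Comp_computesE)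
  have "ys = ys'"
    using Comp.IH(1) all by (auto simp: list_all2_conv_all_nth intro!: nth_equalityI)
  then show ?case
    using Comp.IH(2) last by simp
next
  case (PrimRec_Suc p q n xs y z' z)
  from PrimRec_Suc.prems obtain y' where
    y': "computes Q (PrimRec p q) (n # xs) y'" and z: "computes Q q (n # y' # xs) z"
    by (rule PrimRec_Suc_computesE)
  have "y = y'"
    using y' by (rule PrimRec_Suc.IH(1))
  with z show ?case
    by (intro PrimRec_Suc.IH(2)) simp
next
  case (Mu p n xs z)
  from Mu.prems have z: "computes Q p (z # xs) 0"
    and below: "\<forall>m < z. \<exists>y. computes Q p (m # xs) (Suc y)"
    by (blast elim: Mu_computesE)+
  have "\<not> n < z"
    proof
    assume "n < z"
    then obtain y where "computes Q p (n # xs) (Suc y)"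
      using below by blast
    from Mu.IH(1)[OF this] show False
      by simp
  qed
  moreover have "\<not> z < n"
    proof
    assume "z < n"
    then obtain y where "\<forall>w. computes Q p (z # xs) w \<longrightarrow> Suc y = w"
      using Mu.IH(2) by blast
    with z show False
      by auto
  qed
  ultimately show ?case
    by simp
next
  case (PrimRec_0 p xs y q z)
  from PrimRec_0.prems have "computes Q p xs z"
    by (rule PrimRec_0_computesE)
  then show ?case
    by (rule PrimRec_0.IH)
qed (erule Zero_computesE Succ_computesE Proj_computesE Ask_computesE; simp)+

definition weights_code :: "weights \<Rightarrow> nat" where
  "weights_code W = set_encode {prod_encode (b, w) |b w. W b = Some w}"

definition struct_code :: "struct \<Rightarrow> nat" where
  "struct_code G =
     prod_encode (set_encode (univ G), list_encode (map (\<lambda>R. set_encode (list_encode ` R)) (rels G)))"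

definition weighted_code :: "struct \<Rightarrow> weights \<Rightarrow> nat" where
  "weighted_code G W = prod_encode (struct_code G, weights_code W)"

definition mark_code :: "bool list \<Rightarrow> nat" where
  "mark_code \<mu> = list_encode (map of_bool \<mu>)"

text \<open>The (code of the) answer to the query with parameters \<open>a\<close> consists of the elements of the
  output together with their weights. Arguments that do not encode a tuple of parameters are
  answered by \<open>0\<close>.\<close>

definition answer_code :: "nat \<Rightarrow> formula \<Rightarrow> struct \<Rightarrow> weights \<Rightarrow> nat \<Rightarrow> nat" where
  "answer_code r \<psi> G W n =
     (let a = list_decode n in
      if a \<in> tuples (univ G) r then weights_code (W |` query_output r \<psi> G a) else 0)"


section \<open>Watermarking schemes\<close>

text \<open>The marker runs without external queries, that is, with the constant function \<open>0\<close> for \<open>Q\<close>;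
  the detector may query the answers on the marked structure only. The condition \<open>W b \<noteq> Some 0\<close>
  makes it possible to lower the weight of an active element. Without it no scalable scheme exists
  for the query \<open>y = y\<close> if there are arbitrarily large structures: when all weights are \<open>0\<close>, at most
  \<open>d\<close> of them can be raised, which leaves only polynomially many marked weight functions.\<close>

definition watermarking_scheme ::
    "struct set \<Rightarrow> nat \<Rightarrow> formula \<Rightarrow> program \<Rightarrow> program \<Rightarrow> (nat \<Rightarrow> nat) \<Rightarrow> nat \<Rightarrow> bool" where
  "watermarking_scheme K r \<psi> M D f d \<longleftrightarrow>
     (\<forall>(G, W) \<in> weighted_over K r \<psi>. (\<forall>b \<in> active r \<psi> G. W b \<noteq> Some 0) \<longrightarrow>
        (\<forall>\<mu> :: bool list. length \<mu> = f (card (active r \<psi> G)) \<longrightarrow>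
           (\<exists>W'. (G, W') \<in> weighted_over K r \<psi> \<and>
              computes (\<lambda>_. 0) M [weighted_code G W, mark_code \<mu>] (weighted_code G W') \<and>
              local_distortion 1 W W' \<and> global_distortion d r \<psi> G W W' \<and>
              computes (answer_code r \<psi> G W') D [weighted_code G W] (mark_code \<mu>))))"

definition scalable :: "(nat \<Rightarrow> nat) \<Rightarrow> bool" where
  "scalable f \<longleftrightarrow> (\<exists>\<epsilon> > 0. (\<lambda>n. real (f n)) \<in> \<Omega>(\<lambda>n. real n powr \<epsilon>))"

end

theory Submission
  imports Defs "HOL-Library.Transitive_Closure_Table"
begin

text \<open>
  Complete graphs in the class have bounded size, since their tree-width is large and their radius
  is 1. Hence the members of the class exclude a complete minor, and all their minors are sparse.
  This implies a polynomial form of uniform quasi-wideness: every set of \<open>g m\<close> vertices, where \<open>g\<close> is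
  a polynomial, contains \<open>m\<close> vertices that are far from each other after the deletion of boundedly
  many vertices. By the locality of first-order logic, these \<open>m\<close> vertices fall into boundedly many
  types such that two vertices of the same type can only be told apart by parameters near one of
  them. As a parameter is near at most one of the scattered vertices, pairing active elements
  of equal type yields many disjoint pairs of which every query separates at most \<open>r\<close>. A mark raises
  the weight of one element of a pair and lowers that of the other if the corresponding bit is set.
  The marker and the detector find the same pairs by exhaustive search.
\<close>


section \<open>Excluded cliques in minors\<close>

text \<open>The number of bits must grow like a power of the number of active elements, so each
  selection may shrink a set only polynomially. Ramsey arguments, a common source of scattered sets,
  lose too much. Every selection here is either an independent set in a sparse graph, with linear
  loss, or a passage to the neighbours of one vertex, made boundedly often.

  A second obstacle is the order of choices. The number of deleted vertices depends on the radius,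
  so the formula must fix the radius before that number is known. Locality is therefore proved by
  induction on the formula itself, with the deleted vertices as exceptions to all distance
  conditions.

  The algorithms carry out nothing of the combinatorial argument. Whether a number describes good
  pairs is decidable from the unmarked structure, and the existence proof only guarantees that the
  search ends. The length of the marks is a computable inverse of the polynomial. A separated pair
  changes an answer by at most one, which makes \<open>r\<close> the bound on the global
  distortion.\<close>

lemma contract_edgeI:
  assumes "{p, q} \<in> edges G" "(if p = v then u else p) \<noteq> (if q = v then u else q)"
  shows "{if p = v then u else p, if q = v then u else q} \<in> edges (contract G u v)"
proof -
  let ?f = "\<lambda>x. if x = v then u else x"
  have "card {?f p, ?f q} = 2" using assms(2) by simp
  moreover have "{?f p, ?f q} = ?f ` {p, q}" by simp
  then have "{?f p, ?f q} \<in> (\<lambda>e. ?f ` e) ` edges G" using assms(1) by (rule image_eqI)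
  ultimately show ?thesis unfolding contract_def by simp
qed

lemma simple_graph_edgeE:
  assumes "simple_graph G" "e \<in> edges G"
  obtains u v where "e = {u, v}" "u \<noteq> v" "u \<in> verts G" "v \<in> verts G"
proof -
  have "card e = 2" "e \<subseteq> verts G" using assms unfolding simple_graph_def by auto
  then show thesis using that by (auto simp: card_2_iff)
qed

lemma simple_graph_edge_verts:
  assumes "simple_graph G" "{u, v} \<in> edges G"
  shows "u \<in> verts G \<and> v \<in> verts G \<and> u \<noteq> v"
proof -
  have "card {u, v} = 2" "{u, v} \<subseteq> verts G" using assms unfolding simple_graph_def by auto
  then show ?thesis by (cases "u = v") auto
qed

lemma simple_graph_contract:
  assumes "simple_graph G" "{u, v} \<in> edges G" "u \<noteq> v"
  shows "simple_graph (contract G u v)"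
proof -
  have u: "u \<in> verts G" using simple_graph_edge_verts[OF assms(1,2)] by blast
  have "(\<lambda>x. if x = v then u else x) ` e \<subseteq> verts G - {v}" if "e \<in> edges G" for e
    using that assms(1,3) u unfolding simple_graph_def by (auto split: if_splits)
  then show ?thesis unfolding simple_graph_def contract_def by auto
qed

lemma finite_edges: "simple_graph G \<Longrightarrow> finite (verts G) \<Longrightarrow> finite (edges G)"
  unfolding simple_graph_def by (meson PowI finite_Pow_iff finite_subset subsetI)

lemma simple_graph_minor_step:
  assumes "minor_step G H" "simple_graph G"
  shows "simple_graph H"
  using assms
proof cases
  case (contract_edge u v)
  then show ?thesis using simple_graph_contract[OF assms(2)] by simp
qed (use assms(2) in \<open>auto simp: simple_graph_def\<close>)

lemma edges_contract_mono:
  "edges H \<subseteq> edges G \<Longrightarrow> edges (contract H u v) \<subseteq> edges (contract G u v)"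
  unfolding contract_def by auto

definition subgraph :: "'a ugraph \<Rightarrow> 'a ugraph \<Rightarrow> bool" where
  "subgraph H G \<longleftrightarrow> verts H \<subseteq> verts G \<and> edges H \<subseteq> edges G"

text \<open>Below, \<open>X\<close> is empty or consists of one vertex, and the subgraph is then induced by its
  neighbours.\<close>

definition dominated_subgraph :: "'a ugraph \<Rightarrow> 'a set \<Rightarrow> 'a ugraph \<Rightarrow> bool" where
  "dominated_subgraph G X H \<longleftrightarrow> subgraph H G \<and> X \<subseteq> verts G \<and> X \<inter> verts H = {} \<and>
     (\<forall>x\<in>X. \<forall>u\<in>verts H. {x, u} \<in> edges G)"

text \<open>Deletions need not be imitated, as the larger graph may keep what \<open>H\<close>
  loses. Only contractions are performed in \<open>G\<close> as well; their two ends lie in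
  \<open>H\<close>, hence outside \<open>X\<close>, so the vertices of \<open>X\<close> survive and
  stay adjacent to all of \<open>H'\<close>.\<close>

lemma minor_step_supergraph:
  assumes "minor_step H H'" "simple_graph H" and G: "dominated_subgraph G X H"
  shows "\<exists>G'. minor_step\<^sup>*\<^sup>* G G' \<and> dominated_subgraph G' X H'"
  using assms(1)
proof cases
  case (delete_edge e)
  then show ?thesis using G
    by (intro exI[of _ G]) (auto simp: dominated_subgraph_def subgraph_def)
next
  case (delete_isolated_vertex v)
  then show ?thesis using G
    by (intro exI[of _ G]) (auto simp: dominated_subgraph_def subgraph_def)
next
  case (contract_edge u v)
  note uv = simple_graph_edge_verts[OF assms(2) contract_edge(2)]
  have sub: "edges H \<subseteq> edges G" using G by (simp add: dominated_subgraph_def subgraph_def)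
  then have "minor_step G (contract G u v)"
    using contract_edge by (auto intro: minor_step.contract_edge)
  moreover have "{x, w} \<in> edges (contract G u v)" if "x \<in> X" "w \<in> verts H'" for x w
  proof -
    have w: "w \<in> verts H" "w \<noteq> v" using that contract_edge by (auto simp: contract_def)
    have x: "x \<noteq> v" "x \<noteq> w" using that w uv G by (auto simp: dominated_subgraph_def)
    have "{x, w} \<in> edges G" using that w G by (simp add: dominated_subgraph_def)
    from contract_edgeI[OF this, of v u] w x show ?thesis by simp
  qed
  moreover have "X \<subseteq> verts G - {v}" "verts H - {v} \<subseteq> verts G - {v}" "X \<inter> (verts H - {v}) = {}"
    using G uv by (auto simp: dominated_subgraph_def subgraph_def)
  ultimately show ?thesis
    using contract_edge(1) edges_contract_mono[OF sub, of u v]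
    by (intro exI[of _ "contract G u v"]) (simp add: dominated_subgraph_def subgraph_def contract_def)
qed

lemma minor_steps_supergraph:
  assumes "minor_step\<^sup>*\<^sup>* H H'" "simple_graph H" "dominated_subgraph G X H"
  shows "\<exists>G'. minor_step\<^sup>*\<^sup>* G G' \<and> dominated_subgraph G' X H'"
  using assms
proof (induction arbitrary: G rule: converse_rtranclp_induct)
  case base
  then show ?case by blast
next
  case (step H H1)
  from minor_step_supergraph[OF step.hyps(1) step.prems] obtain G1 where
    G1: "minor_step\<^sup>*\<^sup>* G G1" "dominated_subgraph G1 X H1" by blast
  from step.IH[OF simple_graph_minor_step[OF step.hyps(1) step.prems(1)] G1(2)] G1(1)
  show ?case by (meson rtranclp_trans)
qed

definition clique :: "'a ugraph \<Rightarrow> 'a set \<Rightarrow> bool" where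
  "clique G K \<longleftrightarrow> K \<subseteq> verts G \<and> finite K \<and> (\<forall>x\<in>K. \<forall>y\<in>K. x \<noteq> y \<longrightarrow> {x, y} \<in> edges G)"

lemma sum_degree_le:
  assumes "simple_graph G" "finite (verts G)"
  shows "(\<Sum>x\<in>verts G. card {y. {x, y} \<in> edges G}) \<le> 2 * card (edges G)"
proof -
  have fe: "finite (edges G)" using assms by (rule finite_edges)
  have fy: "finite {y. {x, y} \<in> edges G}" for x
    by (rule finite_subset[OF _ assms(2)]) (use simple_graph_edge_verts[OF assms(1)] in blast)
  have "(\<Sum>x\<in>verts G. card {y. {x, y} \<in> edges G}) = card (SIGMA x:verts G. {y. {x, y} \<in> edges G})"
    using assms(2) fy by simp
  also have "\<dots> \<le> card (\<Union>e\<in>edges G. {(x, y). {x, y} = e})"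
  proof (rule card_mono)
    have "finite {(x, y). {x, y} = e}" if "e \<in> edges G" for e
    proof (rule finite_subset[of _ "verts G \<times> verts G"])
      show "{(x, y). {x, y} = e} \<subseteq> verts G \<times> verts G"
        using that simple_graph_edge_verts[OF assms(1)] by blast
    qed (use assms in auto)
    then show "finite (\<Union>e\<in>edges G. {(x, y). {x, y} = e})" using fe by auto
  qed auto
  also have "\<dots> \<le> (\<Sum>e\<in>edges G. card {(x, y). {x, y} = e})"
    using fe by (rule card_UN_le)
  also have "\<dots> \<le> (\<Sum>e\<in>edges G. 2)"
  proof (rule sum_mono)
    fix e assume "e \<in> edges G"
    then obtain u v where e: "e = {u, v}" by (rule simple_graph_edgeE[OF assms(1)])
    have "{(x, y). {x, y} = e} \<subseteq> {(u, v), (v, u)}" by (auto simp: e doubleton_eq_iff)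
    then have "card {(x, y). {x, y} = e} \<le> card {(u, v), (v, u)}" by (intro card_mono) auto
    also have "\<dots> \<le> 2" by (cases "u = v") auto
    finally show "card {(x, y). {x, y} = e} \<le> 2" .
  qed
  finally show ?thesis by simp
qed

text \<open>The renaming of \<open>v\<close> to \<open>u\<close> is injective on the edges other
  than \<open>{u, v}\<close> and the edges from \<open>v\<close> to common neighbours: a renamed
  edge \<open>{u, x}\<close> was not an edge before. So the contraction costs one edge and one more
  per triangle on \<open>{u, v}\<close>.\<close>

lemma card_edges_contract:
  assumes "simple_graph G" "finite (verts G)" "{u, v} \<in> edges G"
  shows "card (edges G) \<le> card (edges (contract G u v)) + 1 + card {x. {u, x} \<in> edges G \<and> {v, x} \<in> edges G}"
proof -
  let ?f = "\<lambda>x. if x = v then u else x"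
  let ?N = "{x. {u, x} \<in> edges G \<and> {v, x} \<in> edges G}"
  let ?E = "edges G - {{u, v}} - (\<lambda>x. {v, x}) ` ?N"
  have fe: "finite (edges G)" using assms by (intro finite_edges)
  have fN: "finite ?N"
    by (rule finite_subset[OF _ assms(2)]) (use simple_graph_edge_verts[OF assms(1)] in blast)
  have shape: "(e = ?f ` e \<and> v \<notin> e) \<or> (\<exists>x. e = {v, x} \<and> ?f ` e = {u, x} \<and> x \<noteq> u \<and> x \<noteq> v \<and> {u, x} \<notin> edges G)"
    if e: "e \<in> ?E" for e
  proof (cases "v \<in> e")
    case True
    then obtain x where x: "e = {v, x}" "x \<noteq> v"
    proof -
      have "e \<in> edges G" using e by blast
      then obtain p q where pq: "e = {p, q}" "p \<noteq> q" by (rule simple_graph_edgeE[OF assms(1)])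
      then show thesis using that True by (cases "v = p") (auto simp: insert_commute)
    qed
    with e have "x \<noteq> u" "{u, x} \<notin> edges G" by (auto simp: insert_commute)
    with x show ?thesis by auto
  next
    case False
    then show ?thesis by force
  qed
  have inj: "inj_on (image ?f) ?E"
  proof (rule inj_onI)
    fix d e assume d: "d \<in> ?E" and e: "e \<in> ?E" and eq: "?f ` d = ?f ` e"
    have dE: "d \<in> edges G" "e \<in> edges G" using d e by auto
    from shape[OF d] shape[OF e] show "d = e"
    proof (elim disjE conjE exE)
      assume "d = ?f ` d" "e = ?f ` e"
      then show ?thesis using eq by argo
    next
      fix x assume "d = ?f ` d" "?f ` e = {u, x}" "{u, x} \<notin> edges G"
      then show ?thesis using eq dE(1) by argo
    next
      fix x assume "e = ?f ` e" "?f ` d = {u, x}" "{u, x} \<notin> edges G"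
      then show ?thesis using eq dE(2) by argo
    next
      fix x y assume xy: "d = {v, x}" "?f ` d = {u, x}" "e = {v, y}" "?f ` e = {u, y}" "x \<noteq> u" "y \<noteq> u"
      then have "{u, x} = {u, y}" using eq by argo
      then have "x = y" using xy(5,6) by (simp add: doubleton_eq_iff)
      then show ?thesis using xy by simp
    qed
  qed
  have sub: "image ?f ` ?E \<subseteq> edges (contract G u v)"
  proof
    fix e' assume "e' \<in> image ?f ` ?E"
    then obtain e where e: "e \<in> ?E" "e' = ?f ` e" by blast
    have "card e = 2" using e assms(1) unfolding simple_graph_def by blast
    have "card e' = 2" using shape[OF e(1)]
    proof (elim disjE conjE exE)
      assume "e = ?f ` e" then show ?thesis using \<open>card e = 2\<close> e(2) by argo
    next
      fix x assume "?f ` e = {u, x}" "x \<noteq> u" then show ?thesis using e(2) by auto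
    qed
    then show "e' \<in> edges (contract G u v)" unfolding contract_def using e by auto
  qed
  have fc: "finite (edges (contract G u v))" unfolding contract_def using fe by simp
  have "card (edges G) \<le> card ?E + card {{u, v}} + card ((\<lambda>x. {v, x}) ` ?N)"
  proof -
    have "edges G \<subseteq> ?E \<union> {{u, v}} \<union> (\<lambda>x. {v, x}) ` ?N" by auto
    then have "card (edges G) \<le> card (?E \<union> {{u, v}} \<union> (\<lambda>x. {v, x}) ` ?N)"
      using fe fN by (intro card_mono) auto
    also have "\<dots> \<le> card ?E + card {{u, v}} + card ((\<lambda>x. {v, x}) ` ?N)"
      by (meson add_right_mono card_Un_le le_trans)
    finally show ?thesis .
  qed
  also have "card ?E = card (image ?f ` ?E)" using card_image[OF inj] by (rule sym)
  also have "card (image ?f ` ?E) \<le> card (edges (contract G u v))"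
    using sub fc by (rule card_mono[rotated])
  also have "card ((\<lambda>x. {v, x}) ` ?N) \<le> card ?N" using fN by (rule card_image_le)
  finally show ?thesis by simp
qed

text \<open>Mader's argument: edges are contracted as long as this preserves the density. Afterwards every
  edge lies in many triangles, so that the graph induced by the neighbours of a vertex is dense.\<close>

lemma clique_minor_of_dense:
  assumes "simple_graph G" "finite (verts G)" "verts G \<noteq> {}" "2 ^ t * card (verts G) \<le> card (edges G)"
  shows "\<exists>H K. minor_step\<^sup>*\<^sup>* G H \<and> clique H K \<and> card K = t"
  using assms
proof (induction t arbitrary: G)
  case 0
  show ?case by (rule exI[of _ G], rule exI[of _ "{}"]) (simp add: clique_def)
next
  case (Suc t)
  note outer = Suc.IH
  from Suc.prems show ?case
  proof (induction "card (verts G)" arbitrary: G rule: less_induct)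
    case less
    note G = less.prems
    show ?case
    proof (cases "\<exists>u v. {u, v} \<in> edges G \<and>
        2 ^ Suc t * card (verts (contract G u v)) \<le> card (edges (contract G u v))")
      case True
      then obtain u v where uv: "{u, v} \<in> edges G"
        and big: "2 ^ Suc t * card (verts (contract G u v)) \<le> card (edges (contract G u v))"
        by blast
      note uv' = simple_graph_edge_verts[OF G(1) uv]
      have vc: "verts (contract G u v) = verts G - {v}" by (simp add: contract_def)
      have "\<exists>H K. minor_step\<^sup>*\<^sup>* (contract G u v) H \<and> clique H K \<and> card K = Suc t"
      proof (rule less.hyps)
        show "card (verts (contract G u v)) < card (verts G)"
          unfolding vc using uv' G(2) by (intro card_Diff1_less) auto
        show "simple_graph (contract G u v)" using simple_graph_contract[OF G(1) uv] uv' by simp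
        show "finite (verts (contract G u v))" using G(2) vc by simp
        show "verts (contract G u v) \<noteq> {}" using vc uv' by auto
        show "2 ^ Suc t * card (verts (contract G u v)) \<le> card (edges (contract G u v))" by (rule big)
      qed
      moreover have "minor_step G (contract G u v)"
        using uv uv' by (auto intro: minor_step.contract_edge)
      ultimately show ?thesis by (meson converse_rtranclp_into_rtranclp)
    next
      case False
      \<comment> \<open>The contraction removes one vertex but falls below the density, so it loses
        more than \<open>2 ^ Suc t\<close> edges. One of these is \<open>{u, v}\<close>; the others
        come from triangles.\<close>
      have triangles: "2 ^ Suc t \<le> card {x. {u, x} \<in> edges G \<and> {v, x} \<in> edges G}"
        if uv: "{u, v} \<in> edges G" for u v
      proof -
        note uv' = simple_graph_edge_verts[OF G(1) uv]
        have pos: "card (verts G) \<ge> 1" using G(2,3) by (simp add: Suc_le_eq card_gt_0_iff)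
        have "card (verts (contract G u v)) = card (verts G) - 1"
          using uv' G(2) by (simp add: contract_def)
        moreover have "card (edges (contract G u v)) < 2 ^ Suc t * card (verts (contract G u v))"
          using False uv by (meson not_le)
        ultimately have "card (edges (contract G u v)) < 2 ^ Suc t * card (verts G) - 2 ^ Suc t"
          by (simp add: diff_mult_distrib2)
        moreover have "(2::nat) ^ Suc t \<le> 2 ^ Suc t * card (verts G)" using pos by simp
        moreover note card_edges_contract[OF G(1,2) uv] G(4)
        ultimately show ?thesis by linarith
      qed
      have "card (edges G) > 0"
      proof -
        have "0 < 2 ^ Suc t * card (verts G)" using G(2,3) by (simp add: card_gt_0_iff)
        then show ?thesis using G(4) by linarith
      qed
      then obtain e where "e \<in> edges G" by (metis card.empty ex_in_conv less_irrefl)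
      then obtain v w where e: "{v, w} \<in> edges G" by (metis simple_graph_edgeE[OF G(1)])
      define N where "N = {x. {v, x} \<in> edges G}"
      define H where "H = (N, {e \<in> edges G. e \<subseteq> N})"
      have Nv: "N \<subseteq> verts G" "v \<notin> N" "v \<in> verts G" "w \<in> N"
        using simple_graph_edge_verts[OF G(1)] e unfolding N_def by blast+
      then have fN: "finite N" using G(2) finite_subset by blast
      have sH: "simple_graph H" using G(1) unfolding simple_graph_def H_def by auto
      \<comment> \<open>The triangles on \<open>{v, x}\<close> are the neighbours of
        \<open>x\<close> inside \<open>N\<close>. Minimum degree \<open>2 ^ Suc t\<close> gives
        density \<open>2 ^ t\<close>, which is what the outer induction asks for.\<close>
      have "2 ^ Suc t * card N \<le> (\<Sum>x\<in>N. card {y. {x, y} \<in> edges H})"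
      proof -
        have "2 ^ Suc t \<le> card {y. {x, y} \<in> edges H}" if "x \<in> N" for x
        proof -
          have "{y. {v, y} \<in> edges G \<and> {x, y} \<in> edges G} = {y. {x, y} \<in> edges H}"
            using that by (auto simp: H_def N_def)
          with triangles[of v x] that show ?thesis by (simp add: N_def)
        qed
        from sum_mono[of N "\<lambda>_. 2 ^ Suc t", OF this] show ?thesis by (simp add: mult.commute)
      qed
      also have "\<dots> \<le> 2 * card (edges H)" using sum_degree_le[OF sH] fN by (simp add: H_def)
      finally have "2 ^ t * card (verts H) \<le> card (edges H)" by (simp add: H_def)
      from outer[OF sH _ _ this] obtain H' K where H': "minor_step\<^sup>*\<^sup>* H H'" "clique H' K" "card K = t"
        using fN Nv by (auto simp: H_def)
      \<comment> \<open>The vertex \<open>v\<close> stays adjacent to everything while the clique is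
        formed among its neighbours, and finally extends it by one.\<close>
      have "dominated_subgraph G {v} H"
        using Nv by (auto simp: dominated_subgraph_def subgraph_def H_def N_def)
      from minor_steps_supergraph[OF H'(1) sH this] obtain G' where
        G': "minor_step\<^sup>*\<^sup>* G G'" "verts H' \<subseteq> verts G'" "edges H' \<subseteq> edges G'"
        "v \<in> verts G'" "v \<notin> verts H'" "\<forall>u\<in>verts H'. {v, u} \<in> edges G'"
        by (auto simp: dominated_subgraph_def subgraph_def)
      have "clique G' (insert v K)"
        using G' H'(2) unfolding clique_def by (auto simp: insert_commute)
      moreover have "card (insert v K) = Suc t"
        using G'(5) H' unfolding clique_def by (subst card_insert_disjoint) auto
      ultimately show ?thesis using G'(1) by blast
    qed
  qed
qed


section \<open>Tree decompositions and cliques\<close>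

definition adj :: "'a ugraph \<Rightarrow> ('a \<times> 'a) set" where
  "adj G = {(x, y). {x, y} \<in> edges G}"

lemma adj_commute: "(x, y) \<in> adj G \<longleftrightarrow> (y, x) \<in> adj G"
  by (simp add: adj_def insert_commute)

lemma walk_imp_adj:
  assumes "walk G p"
  shows "(hd p, last p) \<in> (adj G)\<^sup>*"
  using assms
proof (induction p)
  case Nil
  then show ?case by (simp add: walk_def)
next
  case (Cons a p)
  show ?case
  proof (cases "p = []")
    case False
    have step: "{(a # p) ! i, (a # p) ! Suc i} \<in> edges G" if "Suc i < length (a # p)" for i
      using Cons.prems that unfolding walk_def by blast
    have "{p ! i, p ! Suc i} \<in> edges G" if "Suc i < length p" for i
      using step[of "Suc i"] that by simp
    then have "walk G p" using Cons.prems False by (simp add: walk_def)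
    from Cons.IH[OF this] have "(hd p, last p) \<in> (adj G)\<^sup>*" .
    moreover have "(a, hd p) \<in> adj G"
      using step[of 0] False by (simp add: adj_def hd_conv_nth)
    ultimately show ?thesis using False by (simp add: converse_rtrancl_into_rtrancl)
  qed simp
qed

lemma connected_graph_adj:
  "connected_graph G \<Longrightarrow> x \<in> verts G \<Longrightarrow> y \<in> verts G \<Longrightarrow> (x, y) \<in> (adj G)\<^sup>*"
  unfolding connected_graph_def using walk_imp_adj by metis

text \<open>A detour from \<open>a\<close> to \<open>b\<close> can be shortened to a path without
  repeated vertices. It has an inner vertex because the edge itself is excluded, so the edge closes
  it to a cycle.\<close>

lemma tree_edge_is_bridge:
  assumes T: "tree T" and ab: "(a, b) \<in> adj T"
  shows "(a, b) \<notin> (adj T - {(a, b), (b, a)})\<^sup>*"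
proof
  let ?R = "adj T - {(a, b), (b, a)}"
  have simple: "simple_graph T" using T by (simp add: tree_def)
  note edge = simple_graph_edge_verts[OF simple]
  assume "(a, b) \<in> ?R\<^sup>*"
  then have "(\<lambda>x y. (x, y) \<in> ?R)\<^sup>*\<^sup>* a b" by (simp add: rtrancl_def)
  then obtain xs0 where "rtrancl_path (\<lambda>x y. (x, y) \<in> ?R) a xs0 b"
    by (auto simp: rtranclp_eq_rtrancl_path)
  then obtain xs where xs: "rtrancl_path (\<lambda>x y. (x, y) \<in> ?R) a xs b" "distinct (a # xs)"
    by (rule rtrancl_path_distinct)
  have ne: "a \<noteq> b" using ab edge unfolding adj_def by blast
  have xs_ne: "xs \<noteq> []"
  proof
    assume "xs = []"
    with xs(1) have "a = b" by (auto elim: rtrancl_path.cases)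
    with ne show False ..
  qed
  have last: "last xs = b" using rtrancl_path_last[OF xs(1) xs_ne] .
  have nth: "((a # xs) ! i, xs ! i) \<in> ?R" if "i < length xs" for i
    using rtrancl_path_nth[OF xs(1) that] .
  have "length xs \<noteq> 1"
  proof
    assume l: "length xs = 1"
    have "xs ! 0 = b" using last l xs_ne by (simp add: last_conv_nth)
    with nth[of 0] l show False by simp
  qed
  then have len: "3 \<le> length (a # xs)" using xs_ne by (cases xs) (auto simp: Suc_le_eq)
  have "set (a # xs) \<subseteq> verts T"
  proof
    fix y assume "y \<in> set (a # xs)"
    then consider "y = a" | i where "i < length xs" "y = xs ! i" by (auto simp: in_set_conv_nth)
    then show "y \<in> verts T"
    proof cases
      case 1
      then show ?thesis using ab edge unfolding adj_def by blast
    next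
      case 2
      then show ?thesis using nth edge unfolding adj_def by blast
    qed
  qed
  then have "cycle T (a # xs)"
    using xs(2) len nth xs_ne last ab unfolding cycle_def walk_def adj_def
    by (auto simp: insert_commute)
  then show False using T unfolding tree_def by blast
qed

text \<open>The part of the walk before the entry stays outside \<open>S\<close>, so it can be
  retraced without using the entering edge.\<close>

lemma rtrancl_first_entry:
  assumes "(x, z) \<in> R\<^sup>*" "x \<notin> S" "z \<in> S"
  shows "\<exists>p q. (x, p) \<in> (R \<inter> (- S) \<times> (- S))\<^sup>* \<and> (p, q) \<in> R \<and> p \<notin> S \<and> q \<in> S"
  using assms
proof (induction rule: converse_rtrancl_induct)
  case (step x y)
  show ?case
  proof (cases "y \<in> S")
    case False
    with step obtain p q where pq: "(y, p) \<in> (R \<inter> (- S) \<times> (- S))\<^sup>*" "(p, q) \<in> R" "p \<notin> S" "q \<in> S"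
      by blast
    have "(x, y) \<in> R \<inter> (- S) \<times> (- S)" using step.hyps step.prems False by blast
    with pq show ?thesis by (meson converse_rtrancl_into_rtrancl)
  qed (use step in blast)
qed simp

text \<open>Choose a bag that contains as much of \<open>K\<close> as possible. If \<open>v\<close> is missing, walk from this bag to
  the subtree of the bags with \<open>v\<close>: where the walk enters it, nothing of \<open>K\<close> has been lost.\<close>

lemma clique_in_bag:
  assumes td: "tree_decomposition G T B" and K: "clique G K"
  shows "\<exists>t\<in>verts T. K \<subseteq> B t"
proof -
  have T: "tree T" using td unfolding tree_decomposition_def by blast
  have cover_vert: "\<exists>t\<in>verts T. v \<in> B t" if "v \<in> verts G" for v
    using that td unfolding tree_decomposition_def by blast
  have cover_edge: "\<exists>t\<in>verts T. e \<subseteq> B t" if "e \<in> edges G" for e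
    using that td unfolding tree_decomposition_def by blast
  have conT: "connected_graph T" using T unfolding tree_def by blast
  have simple: "simple_graph T" using T unfolding tree_def by blast
  have fK: "finite K" "K \<subseteq> verts G" using K unfolding clique_def by auto
  have fin: "finite ((\<lambda>t. card (K \<inter> B t)) ` verts T)"
    by (rule finite_subset[of _ "{..card K}"]) (use fK in \<open>auto intro: card_mono\<close>)
  have "(\<lambda>t. card (K \<inter> B t)) ` verts T \<noteq> {}" using conT unfolding connected_graph_def by blast
  from Max_in[OF fin this] obtain t where
    t: "t \<in> verts T" "Max ((\<lambda>t. card (K \<inter> B t)) ` verts T) = card (K \<inter> B t)" by blast
  have max: "card (K \<inter> B s) \<le> card (K \<inter> B t)" if "s \<in> verts T" for s
    using Max_ge[OF fin, of "card (K \<inter> B s)"] that t(2) by simp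
  have "K \<subseteq> B t"
  proof (rule ccontr)
    assume "\<not> K \<subseteq> B t"
    then obtain v where v: "v \<in> K" "v \<notin> B t" by blast
    let ?S = "\<lambda>w. {s \<in> verts T. w \<in> B s}"
    have conn: "(x, y) \<in> (adj T \<inter> ?S w \<times> ?S w)\<^sup>*" if "x \<in> ?S w" "y \<in> ?S w" "w \<in> K" for x y w
    proof -
      have "connected_graph (induced T {t. w \<in> B t})"
        using that fK td unfolding tree_decomposition_def by blast
      then have "(x, y) \<in> (adj (induced T {t. w \<in> B t}))\<^sup>*"
        using that by (intro connected_graph_adj) (auto simp: induced_def)
      moreover have "adj (induced T {t. w \<in> B t}) \<subseteq> adj T \<inter> ?S w \<times> ?S w"
        using simple_graph_edge_verts[OF simple] unfolding adj_def induced_def by auto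
      ultimately show ?thesis using rtrancl_mono by blast
    qed
    obtain z where z: "z \<in> ?S v"
    proof -
      have "v \<in> verts G" using v fK by blast
      from cover_vert[OF this] show thesis using that by blast
    qed
    have "(t, z) \<in> (adj T)\<^sup>*" using conT t z by (intro connected_graph_adj) auto
    from rtrancl_first_entry[OF this, of "?S v"] obtain p q where
      pq: "(t, p) \<in> (adj T \<inter> (- ?S v) \<times> (- ?S v))\<^sup>*" "(p, q) \<in> adj T" "p \<notin> ?S v" "q \<in> ?S v"
      using v z by blast
    let ?R = "adj T - {(p, q), (q, p)}"
    have pt: "(p, t) \<in> ?R\<^sup>*"
    proof -
      have "sym (adj T \<inter> (- ?S v) \<times> (- ?S v))" by (auto simp: sym_def adj_commute)
      then have "(p, t) \<in> (adj T \<inter> (- ?S v) \<times> (- ?S v))\<^sup>*" using pq(1) by (meson symD sym_rtrancl)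
      moreover have "adj T \<inter> (- ?S v) \<times> (- ?S v) \<subseteq> ?R" using pq by blast
      ultimately show ?thesis using rtrancl_mono by blast
    qed
    \<comment> \<open>Otherwise \<open>p\<close> and \<open>q\<close> are connected without their
      edge: from \<open>p\<close> back to \<open>t\<close>, inside the subtree of \<open>w\<close>
      to a bag \<open>y\<close> with both \<open>v\<close> and \<open>w\<close>, and inside the
      subtree of \<open>v\<close> to \<open>q\<close>. But the edge is a bridge.\<close>
    have "q \<in> ?S w" if w: "w \<in> K \<inter> B t" for w
    proof (rule ccontr)
      assume q: "q \<notin> ?S w"
      have "v \<noteq> w" "w \<in> K" using v w by auto
      then have "{v, w} \<in> edges G" using v K unfolding clique_def by simp
      from cover_edge[OF this] obtain y where y: "y \<in> verts T" "v \<in> B y" "w \<in> B y" by blast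
      have "(t, y) \<in> (adj T \<inter> ?S w \<times> ?S w)\<^sup>*" using conn[of t w y] t w y by blast
      moreover have "adj T \<inter> ?S w \<times> ?S w \<subseteq> ?R" using q by blast
      ultimately have ty: "(t, y) \<in> ?R\<^sup>*" using rtrancl_mono by blast
      have "(y, q) \<in> (adj T \<inter> ?S v \<times> ?S v)\<^sup>*" using conn[of y v q] y pq v by blast
      moreover have "adj T \<inter> ?S v \<times> ?S v \<subseteq> ?R" using pq(3) by blast
      ultimately have "(y, q) \<in> ?R\<^sup>*" using rtrancl_mono by blast
      with pt ty have "(p, q) \<in> ?R\<^sup>*" by (meson rtrancl_trans)
      with tree_edge_is_bridge[OF T pq(2)] show False ..
    qed
    then have "insert v (K \<inter> B t) \<subseteq> K \<inter> B q" using v pq by blast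
    then have "card (insert v (K \<inter> B t)) \<le> card (K \<inter> B q)" using fK by (intro card_mono) auto
    then have "card (K \<inter> B t) < card (K \<inter> B q)" using v fK by simp
    with max[of q] pq(4) show False by simp
  qed
  with t show ?thesis by blast
qed

lemma clique_card_bound:
  assumes simple: "\<forall>H\<in>C. simple_graph H" and "locally_bounded_tree_width C"
  shows "\<exists>k. \<forall>G\<in>C. \<forall>K. clique G K \<longrightarrow> card K \<le> k"
proof -
  obtain f where f: "\<forall>G\<in>C. \<forall>v\<in>verts G. \<forall>\<rho>. tree_width_at_most (induced G (neighbourhood G \<rho> v)) (f \<rho>)"
    using assms(2) unfolding locally_bounded_tree_width_def by blast
  have "card K \<le> f 1 + 1" if G: "G \<in> C" "clique G K" for G K
  proof (cases "K = {}")
    case False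
    then obtain v where v: "v \<in> K" by blast
    then have vG: "v \<in> verts G" using G unfolding clique_def by blast
    have "u \<in> neighbourhood G 1 v" if "u \<in> K" for u
    proof (cases "u = v")
      case True
      then show ?thesis unfolding neighbourhood_def walk_def
        using vG by (auto intro!: exI[of _ "[v]"])
    next
      case False
      then have "{v, u} \<in> edges G" "u \<in> verts G" using that v G unfolding clique_def by auto
      then have "walk G [v, u]" using vG unfolding walk_def by simp
      then show ?thesis unfolding neighbourhood_def
        by (intro CollectI exI[of _ "[v, u]"]) simp
    qed
    then have "clique (induced G (neighbourhood G 1 v)) K"
      using G unfolding clique_def induced_def by auto
    moreover from f G vG obtain T B where
      TB: "tree_decomposition (induced G (neighbourhood G 1 v)) T B"
      "\<forall>t\<in>verts T. finite (B t) \<and> card (B t) \<le> f 1 + 1"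
      unfolding tree_width_at_most_def by blast
    ultimately obtain t where "t \<in> verts T" "K \<subseteq> B t" using clique_in_bag by metis
    with TB show ?thesis by (meson card_mono le_trans)
  qed simp
  then show ?thesis by blast
qed

text \<open>A dense subgraph would yield a clique minor of the member itself that exceeds the bound
  on cliques. Subgraphs are included because the minors built later arise by contractions alone and
  contain the desired graph only as a subgraph.\<close>

lemma minor_closed_sparse:
  assumes "\<forall>H\<in>C. simple_graph H" "minor_closed C" "locally_bounded_tree_width C"
  shows "\<exists>D. \<forall>G\<in>C. \<forall>H. subgraph H G \<longrightarrow> simple_graph H \<longrightarrow> finite (verts H) \<longrightarrow>
    card (edges H) \<le> D * card (verts H)"
proof -
  obtain k where k: "\<forall>G\<in>C. \<forall>K. clique G K \<longrightarrow> card K \<le> k"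
    using clique_card_bound assms by blast
  have "card (edges H) \<le> 2 ^ Suc k * card (verts H)"
    if GH: "G \<in> C" "subgraph H G" "simple_graph H" "finite (verts H)" for G H
  proof (rule ccontr)
    assume gt: "\<not> card (edges H) \<le> 2 ^ Suc k * card (verts H)"
    have "verts H \<noteq> {}"
    proof
      assume "verts H = {}"
      with GH(3) have "edges H = {}" unfolding simple_graph_def by fastforce
      with gt show False by simp
    qed
    then obtain H' K where K: "minor_step\<^sup>*\<^sup>* H H'" "clique H' K" "card K = Suc k"
      using clique_minor_of_dense[of H "Suc k"] GH gt by (metis linear)
    have "dominated_subgraph G {} H" using GH(2) by (simp add: dominated_subgraph_def)
    from minor_steps_supergraph[OF K(1) GH(3) this] obtain G' where
      "minor_step\<^sup>*\<^sup>* G G'" "verts H' \<subseteq> verts G'" "edges H' \<subseteq> edges G'"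
      by (auto simp: dominated_subgraph_def subgraph_def)
    moreover from this have "clique G' K" using K(2) unfolding clique_def by blast
    moreover have "G' \<in> C" using calculation GH(1) assms(2) unfolding minor_closed_def by blast
    ultimately show False using k K(3) by fastforce
  qed
  then show ?thesis by blast
qed

section \<open>Scattered sets\<close>

text \<open>A minor model in which each branch set is named by one of its own vertices, its root.
  This fits contractions that keep the name of an endpoint: the minor lives on the roots.\<close>

definition branch_sets :: "'a ugraph \<Rightarrow> 'a set \<Rightarrow> ('a \<Rightarrow> 'a set) \<Rightarrow> bool" where
  "branch_sets G A B \<longleftrightarrow>
     (\<forall>a\<in>A. a \<in> B a \<and> B a \<subseteq> verts G \<and> (\<forall>x\<in>B a. (a, x) \<in> (adj G \<inter> B a \<times> B a)\<^sup>*)) \<and>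
     (\<forall>a\<in>A. \<forall>b\<in>A. a \<noteq> b \<longrightarrow> B a \<inter> B b = {})"

definition touching :: "'a ugraph \<Rightarrow> 'a set \<Rightarrow> 'a set \<Rightarrow> bool" where
  "touching G X Y \<longleftrightarrow> (\<exists>x\<in>X. \<exists>y\<in>Y. {x, y} \<in> edges G)"

lemma touching_commute: "touching G X Y \<longleftrightarrow> touching G Y X"
  unfolding touching_def by (metis insert_commute)

text \<open>While some branch set is not a singleton, its root \<open>a\<close> has a neighbour
  \<open>x\<close> in it. Merging \<open>x\<close> into \<open>a\<close> leaves a model with the
  same roots and at least the same touching pairs on fewer vertices.\<close>

lemma branch_sets_minor:
  assumes "simple_graph G" "finite (verts G)" "branch_sets G A B"
    "\<forall>e\<in>F. \<exists>a\<in>A. \<exists>b\<in>A. e = {a, b} \<and> a \<noteq> b \<and> touching G (B a) (B b)"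
  shows "\<exists>G'. minor_step\<^sup>*\<^sup>* G G' \<and> A \<subseteq> verts G' \<and> F \<subseteq> edges G'"
  using assms
proof (induction "card (verts G)" arbitrary: G B rule: less_induct)
  case less
  note simple = less.prems(1) and fin = less.prems(2) and F = less.prems(4)
  note edge = simple_graph_edge_verts[OF simple]
  have root: "a \<in> B a" and sub: "B a \<subseteq> verts G"
    and reach: "x \<in> B a \<Longrightarrow> (a, x) \<in> (adj G \<inter> B a \<times> B a)\<^sup>*" if "a \<in> A" for a x
    using that less.prems(3) unfolding branch_sets_def by auto
  have disj: "B a \<inter> B b = {}" if "a \<in> A" "b \<in> A" "a \<noteq> b" for a b
    using that less.prems(3) unfolding branch_sets_def by auto
  show ?case
  proof (cases "\<forall>a\<in>A. B a = {a}")
    case True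
    have "e \<in> edges G" if e: "e \<in> F" for e
    proof -
      obtain a b where "a \<in> A" "b \<in> A" "e = {a, b}" "touching G (B a) (B b)"
        using F e by blast
      then show ?thesis using True unfolding touching_def by simp
    qed
    moreover have "A \<subseteq> verts G" using root sub by blast
    ultimately show ?thesis by (intro exI[of _ G]) auto
  next
    case False
    then obtain a z where a: "a \<in> A" "z \<in> B a" "z \<noteq> a" using root by blast
    from reach[OF a(1,2)] obtain x where x: "(a, x) \<in> adj G" "x \<in> B a"
    proof (cases rule: converse_rtranclE)
      case base
      then show thesis using a(3) by simp
    next
      case (step y)
      then show thesis using that[of y] by simp
    qed
    have ax: "{a, x} \<in> edges G" using x by (simp add: adj_def)
    have xa: "x \<noteq> a" "x \<in> verts G" "a \<in> verts G" using edge[OF ax] by auto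
    define f where "f = (\<lambda>y. if y = x then a else y)"
    define G1 where "G1 = contract G a x"
    define B1 where "B1 = (\<lambda>b. B b - {x})"
    have v1: "verts G1 = verts G - {x}" by (simp add: G1_def contract_def)
    have xB: "x \<in> B b \<longleftrightarrow> b = a" if "b \<in> A" for b using disj[OF that a(1)] x(2) by (cases "b = a") auto
    have fB: "f y \<in> B1 b" if "b \<in> A" "y \<in> B b" for y b
      using that xB[OF that(1)] root xa unfolding f_def B1_def by auto
    have f_edge: "{f p, f q} \<in> edges G1" if "{p, q} \<in> edges G" "f p \<noteq> f q" for p q
      using contract_edgeI[OF that(1), where u = a and v = x] that(2) unfolding f_def G1_def by simp
    have "\<exists>G'. minor_step\<^sup>*\<^sup>* G1 G' \<and> A \<subseteq> verts G' \<and> F \<subseteq> edges G'"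
    proof (rule less.hyps)
      show "card (verts G1) < card (verts G)"
        unfolding v1 using xa fin by (intro card_Diff1_less) auto
      show "simple_graph G1" unfolding G1_def
        using simple_graph_contract[OF simple ax] xa by simp
      show "finite (verts G1)" using fin v1 by simp
      show "\<forall>e\<in>F. \<exists>a\<in>A. \<exists>b\<in>A. e = {a, b} \<and> a \<noteq> b \<and> touching G1 (B1 a) (B1 b)"
      proof
        fix e assume "e \<in> F"
        then obtain c d where cd: "c \<in> A" "d \<in> A" "e = {c, d}" "c \<noteq> d" "touching G (B c) (B d)"
          using F by blast
        then obtain p q where pq: "p \<in> B c" "q \<in> B d" "{p, q} \<in> edges G"
          unfolding touching_def by blast
        have fpq: "f p \<in> B1 c" "f q \<in> B1 d" using fB pq cd by auto
        then have "f p \<noteq> f q" using disj[OF cd(1,2,4)] unfolding B1_def by auto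
        with f_edge[OF pq(3)] fpq have "touching G1 (B1 c) (B1 d)" unfolding touching_def by blast
        with cd show "\<exists>a\<in>A. \<exists>b\<in>A. e = {a, b} \<and> a \<noteq> b \<and> touching G1 (B1 a) (B1 b)" by blast
      qed
      have reach1: "(b, y) \<in> (adj G1 \<inter> B1 b \<times> B1 b)\<^sup>*" if b: "b \<in> A" and y: "y \<in> B1 b" for b y
      proof -
        \<comment> \<open>The renaming maps paths in a branch set to paths in the new branch set;
          the contracted edge collapses to a point.\<close>
        have "(f b, f y) \<in> (adj G1 \<inter> B1 b \<times> B1 b)\<^sup>*" if "(b, y) \<in> (adj G \<inter> B b \<times> B b)\<^sup>*" for y
          using that
        proof (induction rule: rtrancl_induct)
          case (step y z)
          show ?case
          proof (cases "f y = f z")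
            case False
            then have "(f y, f z) \<in> adj G1 \<inter> B1 b \<times> B1 b"
              using step.hyps f_edge[of y z] fB[OF b] unfolding adj_def by blast
            with step.IH show ?thesis by (rule rtrancl_into_rtrancl)
          qed (use step.IH in simp)
        qed simp
        moreover have "f b = b" using xB[OF b] xa root[OF b] unfolding f_def by auto
        moreover have "f y = y" "y \<in> B b" using y unfolding f_def B1_def by auto
        ultimately show ?thesis using reach[OF b] by metis
      qed
      have "b \<in> B1 b" if "b \<in> A" for b using xB[OF that] xa root[OF that] unfolding B1_def by auto
      moreover have "B1 b \<subseteq> verts G1" if "b \<in> A" for b using sub[OF that] unfolding v1 B1_def by blast
      moreover have "B1 b \<inter> B1 c = {}" if "b \<in> A" "c \<in> A" "b \<noteq> c" for b c
        using disj[OF that] unfolding B1_def by blast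
      ultimately show "branch_sets G1 A B1" using reach1 unfolding branch_sets_def by simp
    qed
    moreover have "minor_step G G1" unfolding G1_def using ax xa by (intro minor_step.contract_edge) auto
    ultimately show ?thesis by (meson converse_rtranclp_into_rtranclp)
  qed
qed

text \<open>The later arguments use the class only through this property of a single graph: the
  edges \<open>F\<close> between touching branch sets form a minor on \<open>A\<close>, and their
  number is linear in \<open>card A\<close>.\<close>

definition minor_sparse :: "nat \<Rightarrow> 'a ugraph \<Rightarrow> bool" where
  "minor_sparse D G \<longleftrightarrow> (\<forall>A B F. branch_sets G A B \<longrightarrow>
     (\<forall>e\<in>F. \<exists>a\<in>A. \<exists>b\<in>A. e = {a, b} \<and> a \<noteq> b \<and> touching G (B a) (B b)) \<longrightarrow> card F \<le> D * card A)"

lemma class_minor_sparse: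
  assumes "\<forall>H\<in>C. simple_graph H" "minor_closed C" "locally_bounded_tree_width C"
  shows "\<exists>D. \<forall>G\<in>C. finite (verts G) \<longrightarrow> minor_sparse D G"
proof -
  obtain D where D: "\<forall>G\<in>C. \<forall>H. subgraph H G \<longrightarrow> simple_graph H \<longrightarrow> finite (verts H) \<longrightarrow>
    card (edges H) \<le> D * card (verts H)"
    using minor_closed_sparse[OF assms] by blast
  have "card F \<le> D * card A"
    if G: "G \<in> C" "finite (verts G)" "branch_sets G A B"
      and F: "\<forall>e\<in>F. \<exists>a\<in>A. \<exists>b\<in>A. e = {a, b} \<and> a \<noteq> b \<and> touching G (B a) (B b)" for G A B F
  proof -
    obtain G' where G': "minor_step\<^sup>*\<^sup>* G G'" "A \<subseteq> verts G'" "F \<subseteq> edges G'"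
      using branch_sets_minor G F assms(1) by metis
    have "G' \<in> C" using G' G assms(2) unfolding minor_closed_def by blast
    moreover have "subgraph (A, F) G'" using G' by (simp add: subgraph_def)
    moreover have "simple_graph (A, F)" using F unfolding simple_graph_def by fastforce
    moreover have "A \<subseteq> verts G" using G(3) unfolding branch_sets_def by blast
    then have "finite A" using G(2) finite_subset by blast
    ultimately show ?thesis using D by (metis fst_conv snd_conv)
  qed
  then show ?thesis unfolding minor_sparse_def by blast
qed

text \<open>Repeatedly pick a vertex with at most \<open>k\<close> conflicts and discard these; each
  pick costs at most \<open>k + 1\<close> elements.\<close>

lemma greedy_independent_set:
  assumes "finite A" "\<And>X. X \<subseteq> A \<Longrightarrow> X \<noteq> {} \<Longrightarrow> \<exists>x\<in>X. card {y \<in> X. y \<noteq> x \<and> P x y} \<le> k"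
    "\<And>x y. P x y \<Longrightarrow> P y x"
  shows "\<exists>I\<subseteq>A. card A \<le> (k + 1) * card I \<and> (\<forall>x\<in>I. \<forall>y\<in>I. x \<noteq> y \<longrightarrow> \<not> P x y)"
  using assms(1,2)
proof (induction "card A" arbitrary: A rule: less_induct)
  case less
  show ?case
  proof (cases "A = {}")
    case False
    then obtain x where x: "x \<in> A" "card {y \<in> A. y \<noteq> x \<and> P x y} \<le> k" using less.prems(2) by blast
    let ?N = "{y \<in> A. y \<noteq> x \<and> P x y}"
    let ?A = "A - insert x ?N"
    have lt: "card ?A < card A" using x less.prems(1) by (intro psubset_card_mono) auto
    have "\<exists>I\<subseteq>?A. card ?A \<le> (k + 1) * card I \<and> (\<forall>x\<in>I. \<forall>y\<in>I. x \<noteq> y \<longrightarrow> \<not> P x y)"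
    proof (rule less.hyps[OF lt])
      show "finite ?A" using less.prems(1) by simp
      show "\<exists>x\<in>X. card {y \<in> X. y \<noteq> x \<and> P x y} \<le> k" if "X \<subseteq> ?A" "X \<noteq> {}" for X
        using less.prems(2)[of X] that by blast
    qed
    then obtain I where I: "I \<subseteq> ?A" "card ?A \<le> (k + 1) * card I" "\<forall>x\<in>I. \<forall>y\<in>I. x \<noteq> y \<longrightarrow> \<not> P x y"
      by blast
    have fI: "finite I" using I(1) less.prems(1) finite_subset by blast
    have xI: "x \<notin> I" using I(1) by blast
    have indep: "\<forall>y\<in>insert x I. \<forall>z\<in>insert x I. y \<noteq> z \<longrightarrow> \<not> P y z"
      using I assms(3) by blast
    have "card A = card ?A + card (insert x ?N)"
    proof -
      have "insert x ?N \<subseteq> A" using x by blast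
      from card_Diff_subset[OF _ this] card_mono[OF less.prems(1) this] show ?thesis
        using less.prems(1) by simp
    qed
    also have "card (insert x ?N) = Suc (card ?N)" using less.prems(1) by simp
    finally have "card A \<le> (k + 1) * card (insert x I)" using I(2) x(2) fI xI by simp
    with indep I(1) x(1) show ?thesis by (intro exI[of _ "insert x I"]) auto
  qed auto
qed

text \<open>The average degree in every subset is at most \<open>2 * k\<close>, so some vertex
  attains this bound. The loss is only a constant factor, which is what keeps all later bounds
  polynomial.\<close>

lemma sparse_independent_set:
  assumes "finite A" and sym: "\<And>x y. P x y \<Longrightarrow> P y x"
    and sparse: "\<And>X. X \<subseteq> A \<Longrightarrow> card {{a, b} |a b. a \<in> X \<and> b \<in> X \<and> a \<noteq> b \<and> P a b} \<le> k * card X"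
  shows "\<exists>I\<subseteq>A. card A \<le> (2 * k + 1) * card I \<and> (\<forall>x\<in>I. \<forall>y\<in>I. x \<noteq> y \<longrightarrow> \<not> P x y)"
proof (rule greedy_independent_set[OF assms(1) _ sym])
  fix X assume X: "X \<subseteq> A" "X \<noteq> {}"
  have fX: "finite X" using X assms(1) finite_subset by blast
  let ?E = "{{a, b} |a b. a \<in> X \<and> b \<in> X \<and> a \<noteq> b \<and> P a b}"
  have simple: "simple_graph (X, ?E)" unfolding simple_graph_def by auto
  show "\<exists>x\<in>X. card {y \<in> X. y \<noteq> x \<and> P x y} \<le> 2 * k"
  proof (rule ccontr)
    assume contr: "\<not> ?thesis"
    have "(\<Sum>x\<in>X. 2 * k + 1) \<le> (\<Sum>x\<in>X. card {y. {x, y} \<in> edges (X, ?E)})"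
    proof (rule sum_mono)
      fix x assume x: "x \<in> X"
      have "{y \<in> X. y \<noteq> x \<and> P x y} = {y. {x, y} \<in> edges (X, ?E)}"
        using x sym by (auto simp: doubleton_eq_iff)
      with contr x show "2 * k + 1 \<le> card {y. {x, y} \<in> edges (X, ?E)}" by auto
    qed
    also have "\<dots> \<le> 2 * card ?E" using sum_degree_le[OF simple] fX by simp
    also have "\<dots> \<le> 2 * (k * card X)" using sparse[OF X(1)] by simp
    finally have "card X = 0" by simp
    with X fX show False by simp
  qed
qed auto


section \<open>Separating a set by deleting few vertices\<close>

text \<open>The effect of contractions, abstractly: once \<open>w\<close> is merged into
  \<open>h w\<close>, its adjacency to \<open>g w\<close> becomes the edge
  \<open>{h w, g w}\<close>. By injectivity these edges are distinct, so \<open>card Y\<close>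
  counts edges of a minor on \<open>X\<close>.\<close>

definition new_edges :: "('a \<Rightarrow> 'b \<Rightarrow> bool) \<Rightarrow> 'a set \<Rightarrow> 'b set \<Rightarrow> bool" where
  "new_edges R X Y \<longleftrightarrow> (\<exists>h g. (\<forall>w\<in>Y. h w \<in> X \<and> g w \<in> X \<and> h w \<noteq> g w \<and> R (h w) w \<and> R (g w) w) \<and>
     inj_on (\<lambda>w. {h w, g w}) Y)"

text \<open>Take a largest set \<open>Y\<close> of vertices of \<open>W\<close> which can be contracted onto one of their neighbours so
  that each creates a new edge. Sparsity bounds \<open>card Y\<close>, and by maximality every pair with a
  common neighbour in \<open>W\<close> has one in \<open>Y\<close>.\<close>

lemma sparse_conflicts:
  assumes fin: "finite A" "finite W"
    and sparse: "\<And>X Y. X \<subseteq> A \<Longrightarrow> Y \<subseteq> W \<Longrightarrow> new_edges R X Y \<Longrightarrow> card Y \<le> D * card X"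
    and deg: "\<And>w. w \<in> W \<Longrightarrow> card {a \<in> A. R a w} \<le> \<Delta>"
    and X: "X \<subseteq> A"
  shows "card {{a, b} |a b. a \<in> X \<and> b \<in> X \<and> a \<noteq> b \<and> (\<exists>w\<in>W. R a w \<and> R b w)} \<le> D * \<Delta>\<^sup>2 * card X"
proof -
  define good where "good = (\<lambda>Y. Y \<subseteq> W \<and> new_edges R X Y)"
  have "finite (card ` {Y. good Y})"
    by (rule finite_subset[of _ "card ` Pow W"]) (use fin in \<open>auto simp: good_def\<close>)
  moreover have "good {}" by (simp add: good_def new_edges_def)
  then have "card ` {Y. good Y} \<noteq> {}" by blast
  ultimately have "Max (card ` {Y. good Y}) \<in> card ` {Y. good Y}" by (rule Max_in)
  then obtain Y where Y: "good Y" "Max (card ` {Y. good Y}) = card Y" by blast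
  have max: "card Z \<le> card Y" if "good Z" for Z
    using Max_ge[OF \<open>finite (card ` {Y. good Y})\<close>, of "card Z"] that Y(2) by auto
  obtain h g where hg: "Y \<subseteq> W" "\<forall>w\<in>Y. h w \<in> X \<and> g w \<in> X \<and> h w \<noteq> g w \<and> R (h w) w \<and> R (g w) w"
    "inj_on (\<lambda>w. {h w, g w}) Y" using Y(1) unfolding good_def new_edges_def by blast
  have fY: "finite Y" using hg(1) fin(2) finite_subset by blast
  let ?N = "\<lambda>w. {a \<in> X. R a w}"
  have fX: "finite X" using X fin(1) finite_subset by blast
  have cover: "\<exists>y\<in>Y. a \<in> ?N y \<and> b \<in> ?N y"
    if ab: "a \<in> X" "b \<in> X" "a \<noteq> b" "w \<in> W" "R a w" "R b w" for a b w
  proof (cases "w \<in> Y \<or> (\<exists>y\<in>Y. {a, b} = {h y, g y})")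
    case True
    then show ?thesis
    proof
      assume "w \<in> Y" then show ?thesis using ab by auto
    next
      assume "\<exists>y\<in>Y. {a, b} = {h y, g y}"
      then obtain y where y: "y \<in> Y" "{a, b} = {h y, g y}" by blast
      then have "a \<in> {h y, g y}" "b \<in> {h y, g y}" by auto
      then show ?thesis using hg(2) y(1) ab by blast
    qed
  next
    case False
    have "inj_on (\<lambda>v. {(h(w := a)) v, (g(w := b)) v}) (insert w Y)"
      proof (rule inj_onI)
        fix p q assume p: "p \<in> insert w Y" and q: "q \<in> insert w Y"
          and eq: "{(h(w := a)) p, (g(w := b)) p} = {(h(w := a)) q, (g(w := b)) q}"
        show "p = q"
        proof (rule ccontr)
          assume ne: "p \<noteq> q"
          consider "p = w" "q \<in> Y" "q \<noteq> w" | "q = w" "p \<in> Y" "p \<noteq> w" | "p \<in> Y" "q \<in> Y" "p \<noteq> w" "q \<noteq> w"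
            using p q ne by auto
          then show False
          proof cases
            case 1
            then show False using eq False by auto
          next
            case 2
            then show False using eq[symmetric] False by auto
          next
            case 3
            then have "{h p, g p} = {h q, g q}" using eq by simp
            then show False using inj_onD[OF hg(3)] 3 ne by blast
          qed
        qed
      qed
    moreover have "\<forall>v\<in>insert w Y. (h(w := a)) v \<in> X \<and> (g(w := b)) v \<in> X \<and> (h(w := a)) v \<noteq> (g(w := b)) v \<and>
        R ((h(w := a)) v) v \<and> R ((g(w := b)) v) v"
      using ab hg(2) by simp
    moreover have "insert w Y \<subseteq> W" using ab hg(1) by simp
    ultimately have "good (insert w Y)" unfolding good_def new_edges_def by blast
    from max[OF this] have False using False fY by simp
    then show ?thesis ..
  qed
  have sub: "{{a, b} |a b. a \<in> X \<and> b \<in> X \<and> a \<noteq> b \<and> (\<exists>w\<in>W. R a w \<and> R b w)}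
      \<subseteq> (\<Union>y\<in>Y. (\<lambda>(a, b). {a, b}) ` (?N y \<times> ?N y))"
  proof
    fix e assume "e \<in> {{a, b} |a b. a \<in> X \<and> b \<in> X \<and> a \<noteq> b \<and> (\<exists>w\<in>W. R a w \<and> R b w)}"
    then obtain a b w where "e = {a, b}" "a \<in> X" "b \<in> X" "a \<noteq> b" "w \<in> W" "R a w" "R b w" by blast
    with cover[of a b w] obtain y where "y \<in> Y" "(a, b) \<in> ?N y \<times> ?N y" "e = {a, b}" by blast
    then show "e \<in> (\<Union>y\<in>Y. (\<lambda>(a, b). {a, b}) ` (?N y \<times> ?N y))" by force
  qed
  have "card {{a, b} |a b. a \<in> X \<and> b \<in> X \<and> a \<noteq> b \<and> (\<exists>w\<in>W. R a w \<and> R b w)}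
      \<le> card (\<Union>y\<in>Y. (\<lambda>(a, b). {a, b}) ` (?N y \<times> ?N y))"
    by (rule card_mono[OF _ sub]) (use fY fX in auto)
  also have "\<dots> \<le> (\<Sum>y\<in>Y. card ((\<lambda>(a, b). {a, b}) ` (?N y \<times> ?N y)))"
    by (rule card_UN_le[OF fY])
  \<comment> \<open>Each \<open>y\<close> has at most \<Delta> neighbours in \<open>X\<close> and
    covers at most the pairs among them.\<close>
  also have "\<dots> \<le> (\<Sum>y\<in>Y. \<Delta>\<^sup>2)"
  proof (rule sum_mono)
    fix y assume "y \<in> Y"
    then have y: "y \<in> W" using hg(1) by blast
    have "card (?N y) \<le> card {a \<in> A. R a y}" using X fin(1) by (intro card_mono) auto
    also have "\<dots> \<le> \<Delta>" using deg y .
    finally have "card (?N y \<times> ?N y) \<le> \<Delta>\<^sup>2"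
      by (simp add: card_cartesian_product power2_eq_square mult_mono)
    moreover have "card ((\<lambda>(a, b). {a, b}) ` (?N y \<times> ?N y)) \<le> card (?N y \<times> ?N y)"
      using fX by (intro card_image_le) auto
    ultimately show "card ((\<lambda>(a, b). {a, b}) ` (?N y \<times> ?N y)) \<le> \<Delta>\<^sup>2" by linarith
  qed
  also have "\<dots> = card Y * \<Delta>\<^sup>2" by simp
  also have "\<dots> \<le> (D * card X) * \<Delta>\<^sup>2"
    using sparse[OF X] Y(1) unfolding good_def by (intro mult_right_mono) auto
  finally show ?thesis by (simp add: mult_ac)
qed

text \<open>The number \<open>(D + 1) * (2 * D + 1)\<close> counts the pairs of
  \<open>2 * D + 2\<close> elements. If \<open>X\<close> had that many elements, each vertex of
  \<open>Y\<close> could supply a pair of its own, and \<open>2 * D + 2\<close> vertices would carry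
  more than \<open>D * (2 * D + 2)\<close> new edges.\<close>

lemma complete_bipartite_bound:
  assumes sparse: "\<And>X Y. X \<subseteq> A \<Longrightarrow> Y \<subseteq> W \<Longrightarrow> new_edges R X Y \<Longrightarrow> card Y \<le> D * card X"
    and X: "X \<subseteq> A" and Y: "Y \<subseteq> W" "card Y = (D + 1) * (2 * D + 1)" and XY: "\<forall>x\<in>X. \<forall>y\<in>Y. R x y"
  shows "card X < 2 * D + 2"
proof (rule ccontr)
  assume "\<not> ?thesis"
  then obtain Z where Z: "Z \<subseteq> X" "card Z = 2 * D + 2" by (metis not_less obtain_subset_with_card_n)
  have fZ: "finite Z" using Z(2) by (intro card_ge_0_finite) simp
  have fY: "finite Y" using Y(2) by (intro card_ge_0_finite) simp
  let ?P = "{e. e \<subseteq> Z \<and> card e = 2}"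
  have "card ?P = (2 * D + 2) choose 2" using n_subsets[OF fZ] Z(2) by simp
  also have "\<dots> = card Y" using Y(2) by (simp add: choose_two)
  finally obtain f where f: "bij_betw f Y ?P"
    using finite_same_card_bij[OF fY, of ?P] fZ by auto
  have "\<exists>a b. f w = {a, b} \<and> a \<noteq> b \<and> a \<in> Z \<and> b \<in> Z" if "w \<in> Y" for w
  proof -
    have fw: "f w \<subseteq> Z" "card (f w) = 2" using bij_betwE[OF f] that by auto
    then obtain a b where "f w = {a, b}" "a \<noteq> b" by (meson card_2_iff)
    with fw(1) show ?thesis by blast
  qed
  then obtain h g where hg: "\<And>w. w \<in> Y \<Longrightarrow> f w = {h w, g w} \<and> h w \<noteq> g w \<and> h w \<in> Z \<and> g w \<in> Z"
    by metis
  have "inj_on (\<lambda>w. {h w, g w}) Y"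
    using bij_betw_imp_inj_on[OF f] hg by (simp add: inj_on_def)
  then have "new_edges R Z Y" using hg XY Z(1) unfolding new_edges_def by blast
  then have "(D + 1) * (2 * D + 1) \<le> D * (2 * D + 2)"
    using sparse[of Z Y] X Y Z by auto
  then show False by (simp add: algebra_simps)
qed

text \<open>The size that suffices when \<open>k\<close> more deletions are allowed. The value for
  \<open>k\<close> is the degree from which a vertex counts as having many neighbours at stage
  \<open>Suc k\<close>. If there is none, the independent set costs the factor
  \<open>2 * (D * \<Delta>\<^sup>2) + 1\<close> with \<Delta> this degree. At stage \<open>0\<close>
  the size contradicts the bound for complete bipartite graphs.\<close>

fun rounds :: "nat \<Rightarrow> nat \<Rightarrow> nat \<Rightarrow> nat" where
  "rounds D m 0 = 2 * D + 2"
| "rounds D m (Suc k) = m * (2 * (D * (rounds D m k)\<^sup>2) + 1)"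

text \<open>A vertex of \<open>W\<close> with many neighbours is deleted and \<open>A\<close> is replaced by these neighbours. This
  can happen less than \<open>(D + 1) * (2 * D + 1)\<close> times, since the deleted vertices and what is left of \<open>A\<close> form
  a complete bipartite graph. If there is no such vertex, then the pairs with a common neighbour
  form a sparse graph.\<close>

lemma separate_by_deletion:
  assumes fin: "finite A" "finite W"
    and sparse: "\<And>X Y. X \<subseteq> A \<Longrightarrow> Y \<subseteq> W \<Longrightarrow> new_edges R X Y \<Longrightarrow> card Y \<le> D * card X"
    and X: "X \<subseteq> A" "Z \<subseteq> W" "card Z + k = (D + 1) * (2 * D + 1)" "\<forall>x\<in>X. \<forall>z\<in>Z. R x z" "rounds D m k \<le> card X"
  shows "\<exists>Z'\<subseteq>W. card Z' \<le> (D + 1) * (2 * D + 1) \<and> (\<exists>I\<subseteq>X. m \<le> card I \<and>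
    (\<forall>w\<in>W - Z'. \<forall>a\<in>I. \<forall>b\<in>I. a \<noteq> b \<longrightarrow> \<not> (R a w \<and> R b w)))"
  using X
proof (induction k arbitrary: X Z)
  case 0
  have "card X < 2 * D + 2"
    by (rule complete_bipartite_bound[where A = A and W = W and R = R and Y = Z])
      (use 0 sparse in auto)
  with 0 show ?case by simp
next
  case (Suc k)
  have fX: "finite X" using Suc.prems(1) fin(1) finite_subset by blast
  have fZ: "finite Z" using Suc.prems(2) fin(2) finite_subset by blast
  show ?case
  proof (cases "\<exists>w\<in>W - Z. rounds D m k \<le> card {a \<in> X. R a w}")
    case True
    then obtain w where w: "w \<in> W" "w \<notin> Z" "rounds D m k \<le> card {a \<in> X. R a w}" by blast
    have weak: "I \<subseteq> {a \<in> X. R a w} \<Longrightarrow> I \<subseteq> X" for I by blast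
    have "\<exists>Z'\<subseteq>W. card Z' \<le> (D + 1) * (2 * D + 1) \<and> (\<exists>I\<subseteq>{a \<in> X. R a w}. m \<le> card I \<and>
      (\<forall>w\<in>W - Z'. \<forall>a\<in>I. \<forall>b\<in>I. a \<noteq> b \<longrightarrow> \<not> (R a w \<and> R b w)))"
      by (rule Suc.IH[of _ "insert w Z"]) (use w Suc.prems fZ in auto)
    then obtain Z' I where "Z' \<subseteq> W" "card Z' \<le> (D + 1) * (2 * D + 1)" "I \<subseteq> {a \<in> X. R a w}" "m \<le> card I"
      "\<forall>w\<in>W - Z'. \<forall>a\<in>I. \<forall>b\<in>I. a \<noteq> b \<longrightarrow> \<not> (R a w \<and> R b w)" by (elim exE conjE)
    with weak[of I] show ?thesis by (intro exI[of _ Z'] conjI exI[of _ I])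
  next
    case False
    let ?\<Delta> = "rounds D m k"
    let ?P = "\<lambda>a b. \<exists>w\<in>W - Z. R a w \<and> R b w"
    have "\<exists>I\<subseteq>X. card X \<le> (2 * (D * ?\<Delta>\<^sup>2) + 1) * card I \<and> (\<forall>x\<in>I. \<forall>y\<in>I. x \<noteq> y \<longrightarrow> \<not> ?P x y)"
    proof (rule sparse_independent_set[OF fX])
      show "?P x y \<Longrightarrow> ?P y x" for x y by blast
      show "card {{a, b} |a b. a \<in> Y \<and> b \<in> Y \<and> a \<noteq> b \<and> ?P a b} \<le> D * ?\<Delta>\<^sup>2 * card Y" if "Y \<subseteq> X" for Y
      proof (rule sparse_conflicts[OF fX])
        show "finite (W - Z)" using fin(2) by simp
        show "card {a \<in> X. R a w} \<le> ?\<Delta>" if "w \<in> W - Z" for w using False that by force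
        show "card Y' \<le> D * card X'" if "X' \<subseteq> X" "Y' \<subseteq> W - Z" "new_edges R X' Y'" for X' Y'
          using sparse[OF _ _ that(3)] that(1,2) Suc.prems(1) by blast
      qed (rule that)
    qed
    then obtain I where I: "I \<subseteq> X" "card X \<le> (2 * (D * ?\<Delta>\<^sup>2) + 1) * card I"
      "\<forall>x\<in>I. \<forall>y\<in>I. x \<noteq> y \<longrightarrow> \<not> ?P x y" by blast
    have "(2 * (D * ?\<Delta>\<^sup>2) + 1) * m \<le> (2 * (D * ?\<Delta>\<^sup>2) + 1) * card I"
      using Suc.prems(5) I(2) by (simp add: mult.commute)
    then have "m \<le> card I" using mult_le_cancel1 by (metis add_gr_0 less_one)
    moreover have "card Z \<le> (D + 1) * (2 * D + 1)" using Suc.prems(3) by simp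
    ultimately show ?thesis using I Suc.prems(2)
      by (intro exI[of _ Z] conjI exI[of _ I]) auto
  qed
qed


section \<open>Balls after deletions, and increasing their radius\<close>

text \<open>Reflexive on the remaining vertices, so that the \<open>i\<close>-th power means
  distance at most \<open>i\<close>.\<close>

definition nbr :: "'a ugraph \<Rightarrow> 'a set \<Rightarrow> ('a \<times> 'a) set" where
  "nbr G S = {(x, y). x \<in> verts G - S \<and> y \<in> verts G - S \<and> (x = y \<or> {x, y} \<in> edges G)}"

definition ball :: "'a ugraph \<Rightarrow> 'a set \<Rightarrow> nat \<Rightarrow> 'a \<Rightarrow> 'a set" where
  "ball G S i a = {x. (a, x) \<in> nbr G S ^^ i}"

definition scattered :: "'a ugraph \<Rightarrow> 'a set \<Rightarrow> nat \<Rightarrow> 'a set \<Rightarrow> bool" where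
  "scattered G S i A \<longleftrightarrow> A \<subseteq> verts G - S \<and>
     (\<forall>a\<in>A. \<forall>b\<in>A. a \<noteq> b \<longrightarrow> ball G S i a \<inter> ball G S i b = {})"

lemma relpow_subset:
  fixes R R' :: "('a \<times> 'a) set"
  shows "R \<subseteq> R' \<Longrightarrow> R ^^ i \<subseteq> R' ^^ i"
  by (induction i) (auto simp: relcomp_mono)

lemma ball_antimono: "S \<subseteq> S' \<Longrightarrow> ball G S' i a \<subseteq> ball G S i a"
proof -
  assume "S \<subseteq> S'"
  then have "nbr G S' \<subseteq> nbr G S" by (auto simp: nbr_def)
  from relpow_subset[OF this, of i] show ?thesis by (auto simp: ball_def)
qed

lemma ball_0: "ball G S 0 a = {a}"
  by (auto simp: ball_def)

lemma ball_Suc: "x \<in> ball G S (Suc i) a \<longleftrightarrow> (\<exists>y\<in>ball G S i a. (y, x) \<in> nbr G S)"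
  by (auto simp: ball_def)

lemma ball_subset: "a \<in> verts G - S \<Longrightarrow> ball G S i a \<subseteq> verts G - S"
  by (induction i) (auto simp: ball_0 ball_Suc nbr_def)

lemma centre_in_ball: "a \<in> verts G - S \<Longrightarrow> a \<in> ball G S i a"
proof (induction i)
  case (Suc i)
  then have "a \<in> ball G S i a" "(a, a) \<in> nbr G S" by (simp_all add: nbr_def)
  then show ?case unfolding ball_Suc by blast
qed (simp add: ball_0)

lemma ball_subset_Suc: "a \<in> verts G - S \<Longrightarrow> ball G S i a \<subseteq> ball G S (Suc i) a"
proof
  fix x assume a: "a \<in> verts G - S" and x: "x \<in> ball G S i a"
  have "x \<in> verts G - S" using ball_subset[OF a] x by (rule subsetD)
  then have "(x, x) \<in> nbr G S" by (simp add: nbr_def)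
  with x show "x \<in> ball G S (Suc i) a" unfolding ball_Suc by blast
qed

lemma ball_connected:
  assumes "a \<in> verts G - S" "x \<in> ball G S i a"
  shows "(a, x) \<in> (adj G \<inter> ball G S i a \<times> ball G S i a)\<^sup>*"
  using assms(2)
proof (induction i arbitrary: x)
  case (Suc i)
  then obtain y where y: "y \<in> ball G S i a" "(y, x) \<in> nbr G S" by (auto simp: ball_Suc)
  let ?R = "adj G \<inter> ball G S (Suc i) a \<times> ball G S (Suc i) a"
  have sub: "ball G S i a \<subseteq> ball G S (Suc i) a" by (rule ball_subset_Suc[OF assms(1)])
  then have "adj G \<inter> ball G S i a \<times> ball G S i a \<subseteq> ?R" by (intro Int_mono Sigma_mono order_refl)
  from rtrancl_mono[OF this] have ay: "(a, y) \<in> ?R\<^sup>*" using Suc.IH[OF y(1)] by (rule subsetD)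
  show ?case
  proof (cases "x = y")
    case False
    then have "(y, x) \<in> adj G" using y(2) by (simp add: nbr_def adj_def)
    then have "(y, x) \<in> ?R" using subsetD[OF sub y(1)] Suc.prems by simp
    with ay show ?thesis by (rule rtrancl_into_rtrancl)
  qed (use ay in simp)
qed (simp add: ball_0)

lemma branch_sets_balls:
  assumes "scattered G S i A"
  shows "branch_sets G A (ball G S i)"
proof -
  have "a \<in> verts G - S" if "a \<in> A" for a using assms that unfolding scattered_def by (meson subsetD)
  note a = this
  have "ball G S i a \<subseteq> verts G" if "a \<in> A" for a using ball_subset[OF a[OF that]] by (meson Diff_subset order_trans)
  then show ?thesis
    using assms ball_connected[OF a] centre_in_ball[OF a] unfolding branch_sets_def scattered_def by simp
qed

text \<open>Disjoint balls can become joined after one more step in two ways only: through an edge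
  between two of the balls, or through a vertex outside all of them that touches two. Contracting
  the balls turns the first obstacle into edges of a sparse graph, avoided by an independent set at
  the cost of a factor \<open>2 * D + 1\<close>. The second is removed by deleting vertices.\<close>

lemma scatter_step:
  assumes fin: "finite (verts G)" and sparse: "minor_sparse D G"
    and A: "scattered G S i A" "(2 * D + 1) * rounds D m ((D + 1) * (2 * D + 1)) \<le> card A" and S: "finite S"
  shows "\<exists>S' A'. finite S' \<and> card S' \<le> card S + (D + 1) * (2 * D + 1) \<and> A' \<subseteq> A \<and> m \<le> card A' \<and>
    scattered G S' (Suc i) A'"
proof -
  let ?B = "ball G S i"
  have disj: "?B a \<inter> ?B b = {}" if "a \<in> A" "b \<in> A" "a \<noteq> b" for a b
    using A(1) that unfolding scattered_def by auto
  have AV: "A \<subseteq> verts G - S" using A(1) unfolding scattered_def by auto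
  have fA: "finite A" using AV fin finite_subset by blast
  have "\<exists>I\<subseteq>A. card A \<le> (2 * D + 1) * card I \<and>
      (\<forall>x\<in>I. \<forall>y\<in>I. x \<noteq> y \<longrightarrow> \<not> touching G (?B x) (?B y))"
  proof (rule sparse_independent_set[OF fA])
    show "touching G (?B x) (?B y) \<Longrightarrow> touching G (?B y) (?B x)" for x y
      by (simp add: touching_commute)
    show "card {{a, b} |a b. a \<in> X \<and> b \<in> X \<and> a \<noteq> b \<and> touching G (?B a) (?B b)} \<le> D * card X"
      if X: "X \<subseteq> A" for X
    proof -
      have "scattered G S i X" using A(1) X unfolding scattered_def by blast
      note B = branch_sets_balls[OF this]
      have "\<forall>e\<in>{{a, b} |a b. a \<in> X \<and> b \<in> X \<and> a \<noteq> b \<and> touching G (?B a) (?B b)}.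
        \<exists>a\<in>X. \<exists>b\<in>X. e = {a, b} \<and> a \<noteq> b \<and> touching G (?B a) (?B b)" by blast
      with B sparse show ?thesis unfolding minor_sparse_def by simp
    qed
  qed
  then obtain A1 where A1: "A1 \<subseteq> A" "card A \<le> (2 * D + 1) * card A1"
    "\<forall>x\<in>A1. \<forall>y\<in>A1. x \<noteq> y \<longrightarrow> \<not> touching G (?B x) (?B y)" by blast
  have fA1: "finite A1" using A1(1) fA finite_subset by blast
  have "(2 * D + 1) * rounds D m ((D + 1) * (2 * D + 1)) \<le> (2 * D + 1) * card A1" using A(2) A1(2) by linarith
  then have big: "rounds D m ((D + 1) * (2 * D + 1)) \<le> card A1"
    by (metis add_gr_0 less_one nat_mult_le_cancel_disj not_gr0 not_less_zero)
  \<comment> \<open>The balls around discarded centres count as outside.\<close>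
  define W where "W = verts G - S - (\<Union>a\<in>A1. ?B a)"
  define R where "R = (\<lambda>a w. touching G (?B a) {w})"
  have fW: "finite W" using fin unfolding W_def by simp
  have conn: "(a, x) \<in> (adj G \<inter> Y \<times> Y)\<^sup>*" if "a \<in> A1" "x \<in> ?B a" "?B a \<subseteq> Y" for a x Y
  proof -
    have "a \<in> verts G - S" using that(1) A1(1) AV by (meson subsetD)
    then have "(a, x) \<in> (adj G \<inter> ?B a \<times> ?B a)\<^sup>*" using that(2) by (rule ball_connected)
    moreover have "adj G \<inter> ?B a \<times> ?B a \<subseteq> adj G \<inter> Y \<times> Y" using that(3) by blast
    ultimately show ?thesis using rtrancl_mono subsetD by metis
  qed
  have BV: "?B a \<subseteq> verts G" "a \<in> ?B a" if "a \<in> A1" for a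
  proof -
    have "a \<in> verts G - S" using that A1(1) AV by (meson subsetD)
    from ball_subset[OF this] centre_in_ball[OF this] show "?B a \<subseteq> verts G" "a \<in> ?B a" by blast+
  qed
  have BW: "?B a \<inter> W = {}" if "a \<in> A1" for a using that unfolding W_def by blast
  have A1W: "A1 \<inter> W = {}" using BV BW by blast
  have disj1: "?B a \<inter> ?B b = {}" if "a \<in> A1" "b \<in> A1" "a \<noteq> b" for a b
    using disj that A1(1) by blast
  have "\<exists>Z'\<subseteq>W. card Z' \<le> (D + 1) * (2 * D + 1) \<and> (\<exists>I\<subseteq>A1. m \<le> card I \<and>
    (\<forall>w\<in>W - Z'. \<forall>a\<in>I. \<forall>b\<in>I. a \<noteq> b \<longrightarrow> \<not> (R a w \<and> R b w)))"
  proof (rule separate_by_deletion[OF fA1 fW, where Z = "{}" and k = "(D + 1) * (2 * D + 1)"])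
    show "rounds D m ((D + 1) * (2 * D + 1)) \<le> card A1" by (rule big)
  next
    fix X Y assume X: "X \<subseteq> A1" and Y: "Y \<subseteq> W" and "new_edges R X Y"
    then obtain h g where hg: "\<forall>w\<in>Y. h w \<in> X \<and> g w \<in> X \<and> h w \<noteq> g w \<and> R (h w) w \<and> R (g w) w"
      and inj: "inj_on (\<lambda>w. {h w, g w}) Y" unfolding new_edges_def by blast
    \<comment> \<open>Absorbing each \<open>w\<close> into the ball of \<open>h w\<close> gives a
      minor model in which every \<open>{h w, g w}\<close> is a touching pair.\<close>
    let ?C = "\<lambda>a. ?B a \<union> {w \<in> Y. h w = a}"
    have branch: "branch_sets G X ?C"
      unfolding branch_sets_def
    proof (intro conjI ballI impI)
      fix a assume a: "a \<in> X"
      then have a1: "a \<in> A1" using X by blast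
      show "a \<in> ?C a" using BV a1 by blast
      show "?C a \<subseteq> verts G" using BV(1)[OF a1] Y by (auto simp: W_def)
      show "(a, x) \<in> (adj G \<inter> ?C a \<times> ?C a)\<^sup>*" if x: "x \<in> ?C a" for x
      proof (cases "x \<in> ?B a")
        case True
        then show ?thesis using conn[OF a1 True] by blast
      next
        case False
        then have "x \<in> Y" "h x = a" using x by auto
        then have "R a x" using hg by blast
        then obtain z where z: "z \<in> ?B a" "{z, x} \<in> edges G" unfolding R_def touching_def by blast
        then have "(a, z) \<in> (adj G \<inter> ?C a \<times> ?C a)\<^sup>*" using conn[OF a1 z(1)] by blast
        moreover have "(z, x) \<in> adj G \<inter> ?C a \<times> ?C a" using z x by (simp add: adj_def)
        ultimately show ?thesis by (rule rtrancl_into_rtrancl)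
      qed
      fix b assume b: "b \<in> X" "a \<noteq> b"
      then have b1: "b \<in> A1" using X by blast
      show "?C a \<inter> ?C b = {}"
        using disj1[OF a1 b1 b(2)] BW[OF a1] BW[OF b1] Y b(2) by blast
    qed
    have "\<exists>a\<in>X. \<exists>b\<in>X. e = {a, b} \<and> a \<noteq> b \<and> touching G (?C a) (?C b)"
      if e: "e \<in> (\<lambda>w. {h w, g w}) ` Y" for e
    proof -
      obtain w where w: "w \<in> Y" "e = {h w, g w}" using e by blast
      then have hw: "h w \<in> X" "g w \<in> X" "h w \<noteq> g w" "R (g w) w" using hg by auto
      then have "touching G (?C (g w)) (?C (h w))" using w(1) unfolding R_def touching_def by blast
      then have "touching G (?C (h w)) (?C (g w))" using touching_commute by blast
      with hw w show ?thesis by blast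
    qed
    then have "card ((\<lambda>w. {h w, g w}) ` Y) \<le> D * card X"
      using sparse branch unfolding minor_sparse_def by simp
    then show "card Y \<le> D * card X" using card_image[OF inj] by simp
  qed simp_all
  then obtain Z I where Z: "Z \<subseteq> W" "card Z \<le> (D + 1) * (2 * D + 1)" and I: "I \<subseteq> A1" "m \<le> card I"
    and sep: "\<forall>w\<in>W - Z. \<forall>a\<in>I. \<forall>b\<in>I. a \<noteq> b \<longrightarrow> \<not> (R a w \<and> R b w)" by (elim exE conjE)
  let ?S = "S \<union> Z"
  have IS: "I \<subseteq> verts G - ?S" using I(1) A1 AV A1W Z by blast
  have "ball G ?S (Suc i) a \<inter> ball G ?S (Suc i) b = {}" if ab: "a \<in> I" "b \<in> I" "a \<noteq> b" for a b
  proof (rule ccontr)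
    assume "\<not> ?thesis"
    then obtain u where u: "u \<in> ball G ?S (Suc i) a" "u \<in> ball G ?S (Suc i) b" by blast
    have ab1: "a \<in> A1" "b \<in> A1" using ab I(1) by auto
    \<comment> \<open>Further deletions only shrink balls, so a point reached in
      \<open>Suc i\<close> steps lies in or next to the old ball of radius \<open>i\<close>.\<close>
    have near: "u \<in> ?B c \<or> touching G (?B c) {u}" if uc: "u \<in> ball G ?S (Suc i) c" for c
    proof -
      obtain y where y: "y \<in> ball G ?S i c" "(y, u) \<in> nbr G ?S" using uc by (auto simp: ball_Suc)
      then have "y \<in> ?B c" using ball_antimono[of S ?S G i c] by blast
      with y show ?thesis by (auto simp: nbr_def touching_def)
    qed
    have uS: "u \<in> verts G - ?S" using u(1) ball_subset[of a G ?S "Suc i"] IS ab by blast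
    show False
    proof (cases "u \<in> W")
      case True
      then have "R a u" "R b u" using near[OF u(1)] near[OF u(2)] BW ab1 unfolding R_def by blast+
      then show False using sep ab True uS by blast
    next
      case False
      then obtain c where c: "c \<in> A1" "u \<in> ?B c" using uS unfolding W_def by blast
      have *: "d = c" if d: "d \<in> A1" "u \<in> ball G ?S (Suc i) d" for d
      proof (rule ccontr)
        assume ne: "d \<noteq> c"
        then have "u \<notin> ?B d" using disj1[OF d(1) c(1)] c(2) by blast
        then have "touching G (?B d) {u}" using near[OF d(2)] by blast
        then have "touching G (?B d) (?B c)" using c(2) unfolding touching_def by blast
        with A1(3) d(1) c(1) ne show False by blast
      qed
      from *[OF ab1(1) u(1)] *[OF ab1(2) u(2)] ab(3) show False by simp
    qed
  qed
  then have "scattered G ?S (Suc i) I" using IS unfolding scattered_def by blast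
  moreover have "card ?S \<le> card S + (D + 1) * (2 * D + 1)" using Z(2) card_Un_le[of S Z] by linarith
  moreover have "finite ?S" using S Z(1) fW finite_subset by blast
  ultimately show ?thesis using I A1(1) by (intro exI[of _ ?S] exI[of _ I]) auto
qed

text \<open>The demand is computed from the last step backwards: the last step needs the displayed
  number of centres, which the earlier steps must deliver.\<close>

fun scatter_size :: "nat \<Rightarrow> nat \<Rightarrow> nat \<Rightarrow> nat" where
  "scatter_size D 0 m = m"
| "scatter_size D (Suc i) m = scatter_size D i ((2 * D + 1) * rounds D m ((D + 1) * (2 * D + 1)))"

lemma large_scattered_set:
  assumes "finite (verts G)" "minor_sparse D G" "A \<subseteq> verts G"
    "scatter_size D i m \<le> card A"
  shows "\<exists>S A'. finite S \<and> card S \<le> i * ((D + 1) * (2 * D + 1)) \<and> A' \<subseteq> A \<and> m \<le> card A' \<and> scattered G S i A'"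
  using assms(4)
proof (induction i arbitrary: m)
  case 0
  then show ?case using assms(3)
    by (intro exI[of _ "{}"] exI[of _ A]) (auto simp: scattered_def ball_0)
next
  case (Suc i)
  let ?m = "(2 * D + 1) * rounds D m ((D + 1) * (2 * D + 1))"
  from Suc.IH[of ?m] Suc.prems obtain S A1 where
    S: "finite S" "card S \<le> i * ((D + 1) * (2 * D + 1))" "A1 \<subseteq> A" "?m \<le> card A1" "scattered G S i A1"
    by auto
  from scatter_step[OF assms(1,2) S(5,4,1)] obtain S' A' where
    "finite S'" "card S' \<le> card S + (D + 1) * (2 * D + 1)" "A' \<subseteq> A1" "m \<le> card A'" "scattered G S' (Suc i) A'"
    by blast
  with S show ?case by (intro exI[of _ S'] exI[of _ A']) auto
qed

section \<open>Polynomial bounds\<close>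

text \<open>The base \<open>m + 1\<close> is never \<open>0\<close>, so that raising the exponent
  only weakens the bound; sums, products and compositions then need no case distinctions.\<close>

definition poly_bounded :: "(nat \<Rightarrow> nat) \<Rightarrow> bool" where
  "poly_bounded g \<longleftrightarrow> (\<exists>c k. \<forall>m. g m \<le> c * (m + 1) ^ k)"

lemma poly_bounded_const: "poly_bounded (\<lambda>_. c)"
  unfolding poly_bounded_def by (intro exI[of _ c] exI[of _ 0]) simp

lemma poly_bounded_id: "poly_bounded (\<lambda>m. m)"
  unfolding poly_bounded_def by (intro exI[of _ 1] exI[of _ 1]) simp

lemma poly_bounded_add:
  assumes "poly_bounded f" "poly_bounded g"
  shows "poly_bounded (\<lambda>m. f m + g m)"
proof -
  obtain c k c' k' where f: "\<And>m. f m \<le> c * (m + 1) ^ k" and g: "\<And>m. g m \<le> c' * (m + 1) ^ k'"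
    using assms unfolding poly_bounded_def by blast
  have "f m + g m \<le> (c + c') * (m + 1) ^ (k + k')" for m
  proof -
    have "c * (m + 1) ^ k \<le> c * (m + 1) ^ (k + k')" "c' * (m + 1) ^ k' \<le> c' * (m + 1) ^ (k + k')"
      by (simp_all add: power_add)
    with f[of m] g[of m] show ?thesis unfolding distrib_right by linarith
  qed
  then show ?thesis unfolding poly_bounded_def by blast
qed

lemma poly_bounded_mult:
  assumes "poly_bounded f" "poly_bounded g"
  shows "poly_bounded (\<lambda>m. f m * g m)"
proof -
  obtain c k c' k' where f: "\<And>m. f m \<le> c * (m + 1) ^ k" and g: "\<And>m. g m \<le> c' * (m + 1) ^ k'"
    using assms unfolding poly_bounded_def by blast
  have "f m * g m \<le> (c * c') * (m + 1) ^ (k + k')" for m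
    using mult_le_mono[OF f[of m] g[of m]] by (simp add: power_add mult_ac)
  then show ?thesis unfolding poly_bounded_def by blast
qed

lemma poly_bounded_compose:
  assumes "poly_bounded f" "poly_bounded g"
  shows "poly_bounded (\<lambda>m. f (g m))"
proof -
  obtain c k c' k' where f: "\<And>m. f m \<le> c * (m + 1) ^ k" and g: "\<And>m. g m \<le> c' * (m + 1) ^ k'"
    using assms unfolding poly_bounded_def by blast
  have "f (g m) \<le> (c * (c' + 1) ^ k) * (m + 1) ^ (k' * k)" for m
  proof -
    have "1 \<le> (m + 1) ^ k'" by simp
    then have "g m + 1 \<le> (c' + 1) * (m + 1) ^ k'" using g[of m] unfolding distrib_right by linarith
    then have "c * (g m + 1) ^ k \<le> c * ((c' + 1) * (m + 1) ^ k') ^ k"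
      by (intro mult_le_mono2 power_mono) auto
    also have "\<dots> = (c * (c' + 1) ^ k) * (m + 1) ^ (k' * k)"
      unfolding power_mult_distrib power_mult by (rule mult.assoc[symmetric])
    finally show ?thesis using f[of "g m"] by linarith
  qed
  then show ?thesis unfolding poly_bounded_def by blast
qed

lemma poly_bounded_rounds: "poly_bounded (\<lambda>m. rounds D m k)"
proof (induction k)
  case 0
  show ?case using poly_bounded_const by simp
next
  case (Suc k)
  show ?case unfolding rounds.simps power2_eq_square
    by (intro poly_bounded_mult poly_bounded_add poly_bounded_const poly_bounded_id Suc)
qed

lemma poly_bounded_scatter_size: "poly_bounded (scatter_size D i)"
proof (induction i)
  case 0
  show ?case using poly_bounded_id by (simp add: fun_eq_iff poly_bounded_def)
next
  case (Suc i)
  have "poly_bounded (\<lambda>m. scatter_size D i ((2 * D + 1) * rounds D m ((D + 1) * (2 * D + 1))))"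
    by (intro poly_bounded_compose[OF Suc] poly_bounded_mult poly_bounded_const poly_bounded_rounds)
  then show ?case by (simp add: poly_bounded_def)
qed

section \<open>Locality of first-order formulas\<close>

lemma relpow_sym:
  fixes E :: "('a \<times> 'a) set"
  assumes "sym E" "(x, y) \<in> E ^^ k"
  shows "(y, x) \<in> E ^^ k"
  using assms(2)
proof (induction k arbitrary: y)
  case (Suc k)
  then obtain z where z: "(x, z) \<in> E ^^ k" "(z, y) \<in> E" by auto
  then have "(y, z) \<in> E" "(z, x) \<in> E ^^ k" using assms(1) Suc.IH by (auto dest: symD)
  then show ?case by (rule relpow_Suc_I2)
qed simp

lemma relpow_trans:
  fixes E :: "('a \<times> 'a) set"
  shows "(x, y) \<in> E ^^ k \<Longrightarrow> (y, z) \<in> E ^^ l \<Longrightarrow> (x, z) \<in> E ^^ (k + l)"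
  by (auto simp: relpow_add)

text \<open>A loop at the end point suffices to prolong a walk. Loops cannot be assumed everywhere,
  as deleted vertices may lack them.\<close>

lemma relpow_mono_refl:
  fixes E :: "('a \<times> 'a) set"
  assumes "(x, y) \<in> E ^^ k" "k \<le> l" "(y, y) \<in> E"
  shows "(x, y) \<in> E ^^ l"
  using assms(2)
proof (induction rule: dec_induct)
  case (step m)
  with assms(3) show ?case by (auto intro: relpow_Suc_I)
qed (rule assms(1))

text \<open>In a largest subset with pairwise distances above \<open>k\<close>, the balls of radius
  \<open>k\<close> cover \<open>P\<close>, by maximality. The centres form a list so that balls can
  be named by numbers below \<open>n\<close>, which keeps the set of types finite.\<close>

lemma scattered_or_covered:
  fixes E :: "('a \<times> 'a) set"
  assumes "finite P" "sym E" "\<forall>p\<in>P. (p, p) \<in> E"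
  shows "(\<exists>X\<subseteq>P. card X = Suc n \<and> (\<forall>p\<in>X. \<forall>q\<in>X. p \<noteq> q \<longrightarrow> (p, q) \<notin> E ^^ k)) \<or>
    (\<exists>ms. length ms \<le> n \<and> (\<forall>u\<in>P. \<exists>j<length ms. (ms ! j, u) \<in> E ^^ k) \<and> set ms \<subseteq> P)"
proof -
  let ?good = "\<lambda>X. X \<subseteq> P \<and> (\<forall>p\<in>X. \<forall>q\<in>X. p \<noteq> q \<longrightarrow> (p, q) \<notin> E ^^ k)"
  have fin: "finite (card ` {X. ?good X})"
    by (rule finite_subset[of _ "card ` Pow P"]) (use assms(1) in auto)
  have "?good {}" by simp
  then have "card ` {X. ?good X} \<noteq> {}" by blast
  from Max_in[OF fin this] obtain X where X: "?good X" "Max (card ` {X. ?good X}) = card X" by blast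
  have max: "card Y \<le> card X" if "?good Y" for Y
    using Max_ge[OF fin, of "card Y"] that X(2) by auto
  have fX: "finite X" using X(1) assms(1) finite_subset by blast
  show ?thesis
  proof (cases "Suc n \<le> card X")
    case True
    then obtain Y where "Y \<subseteq> X" "card Y = Suc n" using obtain_subset_with_card_n by metis
    then show ?thesis using X(1) by (intro disjI1 exI[of _ Y]) auto
  next
    case False
    obtain ms where ms: "set ms = X" "distinct ms" using finite_distinct_list[OF fX] by blast
    have "\<exists>j<length ms. (ms ! j, u) \<in> E ^^ k" if u: "u \<in> P" for u
    proof (rule ccontr)
      assume "\<not> ?thesis"
      then have far: "(p, u) \<notin> E ^^ k" if "p \<in> X" for p
        using that ms(1) by (auto simp: in_set_conv_nth)
      have far': "(u, p) \<notin> E ^^ k" if "p \<in> X" for p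
        using far[OF that] relpow_sym[OF assms(2)] by blast
      have "(u, u) \<in> E ^^ 0" by simp
      then have "(u, u) \<in> E ^^ k" by (rule relpow_mono_refl) (use assms(3) u in auto)
      then have "u \<notin> X" using far by blast
      have "?good (insert u X)" using X(1) u far far' by auto
      from max[OF this] show False using \<open>u \<notin> X\<close> fX by simp
    qed
    moreover have "length ms \<le> n" using ms False distinct_card by fastforce
    ultimately show ?thesis using ms X(1) by (intro disjI2 exI[of _ ms]) auto
  qed
qed

section \<open>Blocks of variables and their types\<close>

text \<open>What the locality argument needs of the Gaifman graph after deletions: remaining
  elements of one tuple are adjacent, and the loops let walks be prolonged. The deleted vertices
  come as a list so that a type can refer to them by index.\<close>

definition locality_graph :: "signature \<Rightarrow> nat \<Rightarrow> struct \<Rightarrow> nat list \<Rightarrow> (nat \<times> nat) set \<Rightarrow> bool" where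
  "locality_graph \<tau> s G ss E \<longleftrightarrow> finite_structure \<tau> G \<and> length ss \<le> s \<and> sym E \<and>
     (\<forall>x\<in>univ G - set ss. (x, x) \<in> E) \<and>
     (\<forall>i<length \<tau>. \<forall>t\<in>rels G ! i. \<forall>u\<in>set t. \<forall>v\<in>set t. u \<notin> set ss \<longrightarrow> v \<notin> set ss \<longrightarrow> (u, v) \<in> E)"

definition separated :: "(nat \<Rightarrow> nat option) \<Rightarrow> nat set \<Rightarrow> (nat \<times> nat) set \<Rightarrow> nat \<Rightarrow> (nat \<Rightarrow> nat) \<Rightarrow> bool" where
  "separated blk S E k \<sigma> \<longleftrightarrow> (\<forall>x\<in>dom blk. \<forall>y\<in>dom blk. blk x \<noteq> blk y \<longrightarrow> \<sigma> x \<notin> S \<longrightarrow> \<sigma> y \<notin> S \<longrightarrow>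
     (\<sigma> x, \<sigma> y) \<notin> E ^^ k)"

lemma separatedD:
  "separated blk S E k \<sigma> \<Longrightarrow> x \<in> dom blk \<Longrightarrow> y \<in> dom blk \<Longrightarrow> blk x \<noteq> blk y \<Longrightarrow> \<sigma> x \<notin> S \<Longrightarrow> \<sigma> y \<notin> S \<Longrightarrow>
    (\<sigma> x, \<sigma> y) \<notin> E ^^ k"
  unfolding separated_def by blast

definition block_local :: "(nat \<Rightarrow> nat option) \<Rightarrow> (nat \<Rightarrow> (nat \<Rightarrow> nat) \<Rightarrow> 'b) \<Rightarrow> bool" where
  "block_local blk F \<longleftrightarrow> (\<forall>l \<sigma> \<sigma>'. (\<forall>x. blk x = Some l \<longrightarrow> \<sigma> x = \<sigma>' x) \<longrightarrow> F l \<sigma> = F l \<sigma>')"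

lemma block_localD:
  "block_local blk F \<Longrightarrow> (\<And>x. blk x = Some l \<Longrightarrow> \<sigma> x = \<sigma>' x) \<Longrightarrow> F l \<sigma> = F l \<sigma>'"
  unfolding block_local_def by blast

text \<open>An implication is enough, since the conditions are symmetric in \<open>\<sigma>\<close>
  and \<open>\<sigma>'\<close>; negation uses this.\<close>

definition determines ::
    "(nat \<Rightarrow> nat option) \<Rightarrow> struct \<Rightarrow> nat set \<Rightarrow> (nat \<times> nat) set \<Rightarrow> nat \<Rightarrow> (nat \<Rightarrow> (nat \<Rightarrow> nat) \<Rightarrow> 'b) \<Rightarrow>
      formula \<Rightarrow> bool" where
  "determines blk G S E k F \<phi> \<longleftrightarrow> (\<forall>\<sigma> \<sigma>'. \<sigma> ` dom blk \<subseteq> univ G \<longrightarrow> \<sigma>' ` dom blk \<subseteq> univ G \<longrightarrow>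
     separated blk S E k \<sigma> \<longrightarrow> separated blk S E k \<sigma>' \<longrightarrow> (\<forall>l. F l \<sigma> = F l \<sigma>') \<longrightarrow>
     sat G \<sigma> \<phi> \<longrightarrow> sat G \<sigma>' \<phi>)"

lemma determinesD:
  "determines blk G S E k F \<phi> \<Longrightarrow> \<sigma> ` dom blk \<subseteq> univ G \<Longrightarrow> \<sigma>' ` dom blk \<subseteq> univ G \<Longrightarrow>
    separated blk S E k \<sigma> \<Longrightarrow> separated blk S E k \<sigma>' \<Longrightarrow> (\<And>l. F l \<sigma> = F l \<sigma>') \<Longrightarrow>
    sat G \<sigma> \<phi> \<Longrightarrow> sat G \<sigma>' \<phi>"
  unfolding determines_def by blast

lemma separated_mono:
  assumes "separated blk (set ss) E k' \<sigma>" "k \<le> k'" "locality_graph \<tau> s G ss E" "\<sigma> ` dom blk \<subseteq> univ G"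
  shows "separated blk (set ss) E k \<sigma>"
  unfolding separated_def
proof (intro ballI impI notI)
  fix x y assume xy: "x \<in> dom blk" "y \<in> dom blk" "blk x \<noteq> blk y" "\<sigma> x \<notin> set ss" "\<sigma> y \<notin> set ss"
    "(\<sigma> x, \<sigma> y) \<in> E ^^ k"
  have "\<sigma> y \<in> univ G" using assms(4) xy(2) by blast
  then have "(\<sigma> y, \<sigma> y) \<in> E" using assms(3) xy(5) unfolding locality_graph_def by simp
  from relpow_mono_refl[OF xy(6) assms(2) this] assms(1) xy show False unfolding separated_def by blast
qed

text \<open>The map \<open>blk\<close> partitions finitely many variables into blocks. Truth of \<open>\<phi>\<close> is to depend only on
  the type of each block, from a finite set \<open>T\<close>, provided that values in different blocks are more than \<open>k\<close> apart;
  the at most \<open>s\<close> vertices in \<open>ss\<close> are exempt. It is essential that \<open>k\<close> can be chosen before \<open>s\<close>, as the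
  number of deleted vertices grows with the radius.\<close>

definition typed_by :: "signature \<Rightarrow> formula \<Rightarrow> nat \<Rightarrow> nat \<Rightarrow> nat \<Rightarrow> 'b set \<Rightarrow> bool" where
  "typed_by \<tau> \<phi> n s k T \<longleftrightarrow> (\<forall>blk G ss E. locality_graph \<tau> s G ss E \<longrightarrow>
     finite (dom blk) \<longrightarrow> card (dom blk) \<le> n \<longrightarrow> ran blk \<subseteq> {..<n} \<longrightarrow> free_vars \<phi> \<subseteq> dom blk \<longrightarrow>
     (\<exists>F. (\<forall>l \<sigma>. F l \<sigma> \<in> T) \<and> block_local blk F \<and> determines blk G (set ss) E k F \<phi>))"

lemma typed_byI:
  assumes "\<And>blk G ss E. locality_graph \<tau> s G ss E \<Longrightarrow> finite (dom blk) \<Longrightarrow> card (dom blk) \<le> n \<Longrightarrow>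
    ran blk \<subseteq> {..<n} \<Longrightarrow> free_vars \<phi> \<subseteq> dom blk \<Longrightarrow>
    \<exists>F. (\<forall>l \<sigma>. F l \<sigma> \<in> T) \<and> block_local blk F \<and> determines blk G (set ss) E k F \<phi>"
  shows "typed_by \<tau> \<phi> n s k T"
  using assms unfolding typed_by_def by blast

lemma typed_byD:
  "typed_by \<tau> \<phi> n s k T \<Longrightarrow> locality_graph \<tau> s G ss E \<Longrightarrow> finite (dom blk) \<Longrightarrow> card (dom blk) \<le> n \<Longrightarrow>
    ran blk \<subseteq> {..<n} \<Longrightarrow> free_vars \<phi> \<subseteq> dom blk \<Longrightarrow>
    \<exists>F. (\<forall>l \<sigma>. F l \<sigma> \<in> T) \<and> block_local blk F \<and> determines blk G (set ss) E k F \<phi>"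
  unfolding typed_by_def by blast

definition local_formula :: "signature \<Rightarrow> formula \<Rightarrow> bool" where
  "local_formula \<tau> \<phi> \<longleftrightarrow> (\<exists>k\<ge>1. \<forall>n s. \<exists>N :: nat. typed_by \<tau> \<phi> n s k {..<N})"

text \<open>Each step of the induction builds its block types in an HOL type of its own. Recoding
  finitely many of them by numbers keeps the induction statement monomorphic.\<close>

lemma local_formulaI:
  assumes k: "1 \<le> k" and T: "\<And>n s. \<exists>T :: 'b set. finite T \<and> typed_by \<tau> \<phi> n s k T"
  shows "local_formula \<tau> \<phi>"
  unfolding local_formula_def
proof (rule exI[of _ k], intro conjI allI k)
  fix n s
  from T[of n s] obtain T :: "'b set" where fin: "finite T" and typed: "typed_by \<tau> \<phi> n s k T" by blast
  obtain code :: "'b \<Rightarrow> nat" and N where code: "code ` T = {i. i < N}" "inj_on code T"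
    using finite_imp_inj_to_nat_seg[OF fin] by blast
  have "typed_by \<tau> \<phi> n s k {..<N}"
  proof (rule typed_byI)
    fix blk :: "nat \<Rightarrow> nat option" and G ss E
    assume "locality_graph \<tau> s G ss E" "finite (dom blk)" "card (dom blk) \<le> n"
      "ran blk \<subseteq> {..<n}" "free_vars \<phi> \<subseteq> dom blk"
    from typed_byD[OF typed this] obtain F where
      F: "\<forall>l \<sigma>. F l \<sigma> \<in> T" "block_local blk F" "determines blk G (set ss) E k F \<phi>" by blast
    let ?tp = "\<lambda>l \<sigma>. code (F l \<sigma>)"
    have "\<forall>l \<sigma>. ?tp l \<sigma> \<in> {..<N}" using F(1) code(1) by blast
    moreover have "block_local blk ?tp" using F(2) unfolding block_local_def by metis
    moreover have "F l \<sigma> = F l \<sigma>'" if "?tp l \<sigma> = ?tp l \<sigma>'" for l \<sigma> \<sigma>'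
      using inj_onD[OF code(2) that] F(1) by blast
    then have "determines blk G (set ss) E k ?tp \<phi>" using F(3) unfolding determines_def by metis
    ultimately show "\<exists>F. (\<forall>l \<sigma>. F l \<sigma> \<in> {..<N}) \<and> block_local blk F \<and> determines blk G (set ss) E k F \<phi>"
      by (intro exI[of _ ?tp] conjI)
  qed
  then show "\<exists>N :: nat. typed_by \<tau> \<phi> n s k {..<N}" by blast
qed

text \<open>Undeleted elements of a tuple in \<open>R\<close> are adjacent, so under separation they
  all come from one block. The type of a block records which of its variables sit at which deleted
  vertices (\<open>pos\<close>), and which choices of deleted vertices for the remaining positions
  complete its values to a tuple of \<open>R\<close> (\<open>fill\<close>).\<close>

lemma local_atom:
  assumes fv: "free_vars \<phi> = set xs"
    and atom: "\<And>s G ss E. locality_graph \<tau> s G ss E \<Longrightarrow>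
      \<exists>R. (\<forall>t\<in>R. \<forall>u\<in>set t. \<forall>v\<in>set t. u \<notin> set ss \<longrightarrow> v \<notin> set ss \<longrightarrow> (u, v) \<in> E) \<and>
        (\<forall>\<sigma>. \<sigma> ` set xs \<subseteq> univ G \<longrightarrow> (sat G \<sigma> \<phi> \<longleftrightarrow> map \<sigma> xs \<in> R))"
  shows "local_formula \<tau> \<phi>"
proof (rule local_formulaI[of 1])
  fix n s :: nat
  \<comment> \<open>Indices go up to \<open>s\<close> inclusively, so that an index exists for the
    positions filled by the block itself even if nothing is deleted.\<close>
  let ?T = "Pow (set xs \<times> {..s}) \<times> Pow {L. set L \<subseteq> {..s} \<and> length L = length xs}"
  have "typed_by \<tau> \<phi> n s 1 ?T"
  proof (rule typed_byI)
    fix blk :: "nat \<Rightarrow> nat option" and G ss E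
    assume G: "locality_graph \<tau> s G ss E" and blk: "free_vars \<phi> \<subseteq> dom blk"
    obtain R where R: "\<forall>t\<in>R. \<forall>u\<in>set t. \<forall>v\<in>set t. u \<notin> set ss \<longrightarrow> v \<notin> set ss \<longrightarrow> (u, v) \<in> E"
      "\<forall>\<sigma>. \<sigma> ` set xs \<subseteq> univ G \<longrightarrow> (sat G \<sigma> \<phi> \<longleftrightarrow> map \<sigma> xs \<in> R)" using atom[OF G] by blast
    define fill where "fill = (\<lambda>l \<sigma> L. map (\<lambda>p. if blk (xs ! p) = Some l then \<sigma> (xs ! p) else ss ! (L ! p))
      [0..<length xs] :: nat list)"
    define pos where "pos = (\<lambda>l \<sigma>. {(v, j). v \<in> set xs \<and> blk v = Some l \<and> j < length ss \<and> \<sigma> v = ss ! j})"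
    define F where "F = (\<lambda>l \<sigma>. (pos l \<sigma>, {L. set L \<subseteq> {..s} \<and> length L = length xs \<and> fill l \<sigma> L \<in> R}))"
    have ls: "length ss \<le> s" using G by (simp add: locality_graph_def)
    then have "F l \<sigma> \<in> ?T" for l \<sigma> by (auto simp: F_def pos_def)
    moreover have "block_local blk F"
      unfolding block_local_def
    proof (intro allI impI)
      fix l and \<sigma> \<sigma>' :: "nat \<Rightarrow> nat" assume *: "\<forall>x. blk x = Some l \<longrightarrow> \<sigma> x = \<sigma>' x"
      then have "fill l \<sigma> L = fill l \<sigma>' L" for L by (simp add: fill_def)
      moreover have "pos l \<sigma> = pos l \<sigma>'" using * by (auto simp: pos_def)
      ultimately show "F l \<sigma> = F l \<sigma>'" by (simp add: F_def)
    qed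
    moreover have "determines blk G (set ss) E 1 F \<phi>"
      unfolding determines_def
    proof (intro allI impI)
      fix \<sigma> \<sigma>' assume V: "\<sigma> ` dom blk \<subseteq> univ G" "\<sigma>' ` dom blk \<subseteq> univ G"
        and sep: "separated blk (set ss) E 1 \<sigma>" and eq: "\<forall>l. F l \<sigma> = F l \<sigma>'" and "sat G \<sigma> \<phi>"
      have "set xs \<subseteq> dom blk" using blk fv by simp
      then have "\<sigma> ` set xs \<subseteq> univ G" "\<sigma>' ` set xs \<subseteq> univ G"
        by (rule order_trans[OF image_mono V(1)], rule order_trans[OF image_mono V(2)])
      then have sat: "map \<sigma> xs \<in> R" "sat G \<sigma>' \<phi> \<longleftrightarrow> map \<sigma>' xs \<in> R"
        using R(2)[rule_format, of \<sigma>] R(2)[rule_format, of \<sigma>'] \<open>sat G \<sigma> \<phi>\<close> by simp_all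
      have same: "\<sigma>' v = \<sigma> v" if v: "v \<in> set xs" "\<sigma> v \<in> set ss" for v
      proof -
        obtain l where l: "blk v = Some l" using blk fv v(1) by auto
        obtain j where j: "j < length ss" "\<sigma> v = ss ! j" using v(2) by (metis in_set_conv_nth)
        have "(v, j) \<in> pos l \<sigma>" using v l j by (simp add: pos_def)
        then have "(v, j) \<in> pos l \<sigma>'" using eq by (simp add: F_def)
        with j show ?thesis by (simp add: pos_def)
      qed
      \<comment> \<open>Values in different blocks are not adjacent, so the undeleted ones share a
        block; if all values are deleted, any block will do.\<close>
      have "\<exists>l. \<forall>v\<in>set xs. \<sigma> v \<notin> set ss \<longrightarrow> blk v = Some l"
      proof (cases "\<exists>w\<in>set xs. \<sigma> w \<notin> set ss")
        case True
        then obtain w where w: "w \<in> set xs" "\<sigma> w \<notin> set ss" by blast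
        have "blk v = blk w" if v: "v \<in> set xs" "\<sigma> v \<notin> set ss" for v
        proof (rule ccontr)
          assume ne: "blk v \<noteq> blk w"
          have "(\<sigma> v, \<sigma> w) \<in> E" by (rule R(1)[rule_format, OF sat(1)]) (use v w in auto)
          then show False using separatedD[OF sep _ _ ne v(2) w(2)] v(1) w(1) blk fv by auto
        qed
        then show ?thesis using w(1) blk fv by (metis domD subsetD)
      qed auto
      then obtain l where l: "\<forall>v\<in>set xs. \<sigma> v \<notin> set ss \<longrightarrow> blk v = Some l" by blast
      have "\<exists>j\<le>s. blk v \<noteq> Some l \<longrightarrow> ss ! j = \<sigma> v" if "v \<in> set xs" for v
      proof (cases "\<sigma> v \<in> set ss")
        case True
        then obtain j where "j < length ss" "ss ! j = \<sigma> v" by (metis in_set_conv_nth)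
        with ls show ?thesis by (intro exI[of _ j]) auto
      qed (use that l in auto)
      then obtain J where J: "\<And>v. v \<in> set xs \<Longrightarrow> J v \<le> s \<and> (blk v \<noteq> Some l \<longrightarrow> ss ! J v = \<sigma> v)"
        by metis
      have "\<sigma>' v = ss ! J v" if "v \<in> set xs" "blk v \<noteq> Some l" for v
        using J[OF that(1)] l same[OF that(1)] that by metis
      then have fill: "fill l \<sigma> (map J xs) = map \<sigma> xs" "fill l \<sigma>' (map J xs) = map \<sigma>' xs"
        using J by (auto simp: fill_def intro!: nth_equalityI)
      have "map J xs \<in> snd (F l \<sigma>)" using sat J fill by (auto simp: F_def)
      then have "map J xs \<in> snd (F l \<sigma>')" using eq by simp
      then show "sat G \<sigma>' \<phi>" using fill sat(2) by (simp add: F_def)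
    qed
    ultimately show "\<exists>F. (\<forall>l \<sigma>. F l \<sigma> \<in> ?T) \<and> block_local blk F \<and> determines blk G (set ss) E 1 F \<phi>"
      by (intro exI[of _ F] conjI allI)
  qed
  moreover have "finite ?T" by (simp add: finite_lists_length_eq)
  ultimately show "\<exists>T :: ((nat \<times> nat) set \<times> nat list set) set. finite T \<and> typed_by \<tau> \<phi> n s 1 T"
    by (intro exI[of _ ?T] conjI)
qed simp

lemma local_Rel:
  assumes "well_formed \<tau> (Rel i xs)"
  shows "local_formula \<tau> (Rel i xs)"
proof (rule local_atom[where xs = xs], goal_cases)
  case (2 s G ss E)
  have "i < length \<tau>" using assms by simp
  with 2 have "\<forall>t\<in>rels G ! i. \<forall>u\<in>set t. \<forall>v\<in>set t. u \<notin> set ss \<longrightarrow> v \<notin> set ss \<longrightarrow> (u, v) \<in> E"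
    unfolding locality_graph_def by blast
  then show ?case by (intro exI[of _ "rels G ! i"]) simp
qed simp

text \<open>Equality is treated as the relation of the tuples \<open>[a, a]\<close>, which link an
  element only to itself.\<close>

lemma local_Eq: "local_formula \<tau> (Eq x y)"
proof (rule local_atom[where xs = "[x, y]"], goal_cases)
  case (2 s G ss E)
  then show ?case
    by (intro exI[of _ "{[a, a] |a. a \<in> univ G}"]) (auto simp: locality_graph_def)
qed simp

lemma local_Neg:
  assumes "local_formula \<tau> \<phi>"
  shows "local_formula \<tau> (Neg \<phi>)"
proof -
  have "determines blk G S E k F (Neg \<phi>)" if "determines blk G S E k F \<phi>"
    for blk G S E k and F :: "nat \<Rightarrow> (nat \<Rightarrow> nat) \<Rightarrow> nat"
    unfolding determines_def
  proof (intro allI impI)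
    fix \<sigma> \<sigma>'
    assume "\<sigma> ` dom blk \<subseteq> univ G" "\<sigma>' ` dom blk \<subseteq> univ G" "separated blk S E k \<sigma>"
      "separated blk S E k \<sigma>'" "\<forall>l. F l \<sigma> = F l \<sigma>'" "sat G \<sigma> (Neg \<phi>)"
    then show "sat G \<sigma>' (Neg \<phi>)" using determinesD[OF that, of \<sigma>' \<sigma>] by auto
  qed
  then have "typed_by \<tau> (Neg \<phi>) n s k T" if "typed_by \<tau> \<phi> n s k T" for n s k and T :: "nat set"
    using typed_byD[OF that] by (intro typed_byI) (metis free_vars.simps(3))
  then show ?thesis using assms unfolding local_formula_def by meson
qed

lemma local_Conj:
  assumes "local_formula \<tau> \<phi>" "local_formula \<tau> \<chi>"
  shows "local_formula \<tau> (Conj \<phi> \<chi>)"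
proof -
  obtain k1 where k1: "1 \<le> k1" and types1: "\<And>n s. \<exists>N :: nat. typed_by \<tau> \<phi> n s k1 {..<N}"
    using assms(1) unfolding local_formula_def by blast
  obtain k2 where types2: "\<And>n s. \<exists>N :: nat. typed_by \<tau> \<chi> n s k2 {..<N}"
    using assms(2) unfolding local_formula_def by blast
  show ?thesis
  proof (rule local_formulaI[of "max k1 k2"])
    fix n s :: nat
    obtain N1 :: nat where 1: "typed_by \<tau> \<phi> n s k1 {..<N1}" using types1 by blast
    obtain N2 :: nat where 2: "typed_by \<tau> \<chi> n s k2 {..<N2}" using types2 by blast
    let ?T = "{..<N1} \<times> {..<N2}"
    have "typed_by \<tau> (Conj \<phi> \<chi>) n s (max k1 k2) ?T"
    proof (rule typed_byI)
      fix blk :: "nat \<Rightarrow> nat option" and G ss E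
      assume G: "locality_graph \<tau> s G ss E" and blk: "finite (dom blk)" "card (dom blk) \<le> n"
        "ran blk \<subseteq> {..<n}" "free_vars (Conj \<phi> \<chi>) \<subseteq> dom blk"
      obtain tp1 where tp1: "\<forall>l \<sigma>. tp1 l \<sigma> \<in> {..<N1}" "block_local blk tp1"
        "determines blk G (set ss) E k1 tp1 \<phi>" using typed_byD[OF 1 G blk(1-3)] blk(4) by auto
      obtain tp2 where tp2: "\<forall>l \<sigma>. tp2 l \<sigma> \<in> {..<N2}" "block_local blk tp2"
        "determines blk G (set ss) E k2 tp2 \<chi>" using typed_byD[OF 2 G blk(1-3)] blk(4) by auto
      let ?F = "\<lambda>l \<sigma>. (tp1 l \<sigma>, tp2 l \<sigma>)"
      have "block_local blk ?F" using tp1(2) tp2(2) unfolding block_local_def by simp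
      moreover have "determines blk G (set ss) E (max k1 k2) ?F (Conj \<phi> \<chi>)"
        unfolding determines_def
      proof (intro allI impI)
        fix \<sigma> \<sigma>' assume V: "\<sigma> ` dom blk \<subseteq> univ G" "\<sigma>' ` dom blk \<subseteq> univ G"
          and sep: "separated blk (set ss) E (max k1 k2) \<sigma>" "separated blk (set ss) E (max k1 k2) \<sigma>'"
          and eq: "\<forall>l. ?F l \<sigma> = ?F l \<sigma>'" and sat: "sat G \<sigma> (Conj \<phi> \<chi>)"
        note sep = separated_mono[OF sep(1) _ G V(1)] separated_mono[OF sep(2) _ G V(2)]
        have "sat G \<sigma>' \<phi>" using determinesD[OF tp1(3) V sep] eq sat by simp
        moreover have "sat G \<sigma>' \<chi>" using determinesD[OF tp2(3) V sep] eq sat by simp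
        ultimately show "sat G \<sigma>' (Conj \<phi> \<chi>)" by simp
      qed
      ultimately show "\<exists>F. (\<forall>l \<sigma>. F l \<sigma> \<in> ?T) \<and> block_local blk F \<and>
          determines blk G (set ss) E (max k1 k2) F (Conj \<phi> \<chi>)"
        using tp1(1) tp2(1) by (intro exI[of _ ?F]) auto
    qed
    then show "\<exists>T :: (nat \<times> nat) set. finite T \<and> typed_by \<tau> (Conj \<phi> \<chi>) n s (max k1 k2) T"
      by (intro exI[of _ ?T]) simp
  qed (use k1 in auto)
qed

text \<open>A witness that is far from all blocks forms a block of its own. If its type has more than \<open>n\<close>
  scattered realisations, then one of them is far from the blocks of \<open>\<sigma>'\<close> as well. Otherwise all
  realisations are covered by \<open>n\<close> balls of radius \<open>2 * k\<close>. Each ball comes near at most one of the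
  separated blocks, so the types of the single blocks tell whether the realisations are all near
  blocks.\<close>

lemma local_Ex:
  assumes "local_formula \<tau> \<phi>"
  shows "local_formula \<tau> (Ex x \<phi>)"
proof -
  obtain k where k: "1 \<le> k" and types: "\<And>n s. \<exists>N :: nat. typed_by \<tau> \<phi> n s k {..<N}"
    using assms unfolding local_formula_def by blast
  \<comment> \<open>Suppose two blocks come near realisations in the same ball of radius
    \<open>2 * k\<close>. Walking from one block to its realisation, to the centre, to the other
    realisation and to the other block takes \<open>k + 2 * k + 2 * k + k\<close> steps.\<close>
  show ?thesis
  proof (rule local_formulaI[of "6 * k"])
  fix n s :: nat
  obtain N :: nat where *: "typed_by \<tau> \<phi> (Suc n) s k {..<N}" using types by blast
  \<comment> \<open>The components record the type of the block when \<open>x\<close> forms the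
    fresh block \<open>n\<close>, its types when \<open>x\<close> joins another block, its types
    when a nearby witness joins it, and the balls in which all realisations are near it. The
    inserted quadruple is the default for block numbers from \<open>n\<close> on.\<close>
  let ?T = "insert (0, {}, {}, {})
    ({..<N} \<times> Pow ({..<n} \<times> {..<N}) \<times> Pow {..<N} \<times> Pow ({..<N} \<times> {..<n}))"
  have "finite ?T" by simp
  moreover have "typed_by \<tau> (Ex x \<phi>) n s (6 * k) ?T"
  proof (rule typed_byI)
    fix blk :: "nat \<Rightarrow> nat option" and G ss E
    assume G: "locality_graph \<tau> s G ss E" and fin: "finite (dom blk)" and card: "card (dom blk) \<le> n"
      and ran: "ran blk \<subseteq> {..<n}" and fv: "free_vars (Ex x \<phi>) \<subseteq> dom blk"
    have symE: "sym E" and reflE: "\<And>u. u \<in> univ G \<Longrightarrow> u \<notin> set ss \<Longrightarrow> (u, u) \<in> E"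
      and finG: "finite (univ G)"
      using G unfolding locality_graph_def finite_structure_def by auto
    \<comment> \<open>The quantifier rebinds \<open>x\<close>, so an outer \<open>x\<close> has to
      leave its block.\<close>
    define blk0 where "blk0 = blk(x := None)"
    have blk0x: "blk0 x = None" by (simp add: blk0_def)
    have dom0: "dom blk0 = dom blk - {x}" by (auto simp: blk0_def)
    have fin0: "finite (dom blk0)" using fin dom0 by simp
    have card0: "card (dom blk0) \<le> n" using card card_mono[OF fin, of "dom blk0"] dom0 by auto
    have lt_n: "l < n" if "blk0 y = Some l" for y l
    proof -
      have "blk y = Some l" using that by (auto simp: blk0_def split: if_splits)
      then show ?thesis using ran by (meson lessThan_iff ranI subsetD)
    qed
    have ext: "\<exists>tp :: nat \<Rightarrow> (nat \<Rightarrow> nat) \<Rightarrow> nat. (\<forall>l \<sigma>. tp l \<sigma> \<in> {..<N}) \<and> block_local (blk0(x \<mapsto> b)) tp \<and>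
        determines (blk0(x \<mapsto> b)) G (set ss) E k tp \<phi>" if b: "b \<le> n" for b
    proof (rule typed_byD[OF * G])
      show "finite (dom (blk0(x \<mapsto> b)))" using fin0 by simp
      show "card (dom (blk0(x \<mapsto> b))) \<le> Suc n" using card0 fin0 blk0x by (auto simp: card_insert_if)
      show "ran (blk0(x \<mapsto> b)) \<subseteq> {..<Suc n}" using b lt_n by (auto simp: ran_def less_Suc_eq split: if_splits)
      show "free_vars \<phi> \<subseteq> dom (blk0(x \<mapsto> b))" using fv dom0 by auto
    qed
    define TP where "TP = (\<lambda>b. SOME tp :: nat \<Rightarrow> (nat \<Rightarrow> nat) \<Rightarrow> nat. (\<forall>l \<sigma>. tp l \<sigma> \<in> {..<N}) \<and>
      block_local (blk0(x \<mapsto> b)) tp \<and> determines (blk0(x \<mapsto> b)) G (set ss) E k tp \<phi>)"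
    have TP: "(\<forall>l \<sigma>. TP b l \<sigma> \<in> {..<N}) \<and> block_local (blk0(x \<mapsto> b)) (TP b) \<and>
        determines (blk0(x \<mapsto> b)) G (set ss) E k (TP b) \<phi>" if "b \<le> n" for b
      using someI_ex[OF ext[OF that]] unfolding TP_def .
    have TP_local: "TP b l \<sigma> = TP b l \<sigma>'"
      if "b \<le> n" "\<And>y. blk0 y = Some l \<Longrightarrow> \<sigma> y = \<sigma>' y" "l = b \<Longrightarrow> \<sigma> x = \<sigma>' x" for b l \<sigma> \<sigma>'
    proof (rule block_localD[of "blk0(x \<mapsto> b)" "TP b" l \<sigma> \<sigma>'])
      show "block_local (blk0(x \<mapsto> b)) (TP b)" using TP that(1) by blast
      show "\<sigma> y = \<sigma>' y" if "(blk0(x \<mapsto> b)) y = Some l" for y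
        using that \<open>\<And>y. blk0 y = Some l \<Longrightarrow> \<sigma> y = \<sigma>' y\<close> \<open>l = b \<Longrightarrow> \<sigma> x = \<sigma>' x\<close>
        by (cases "y = x") auto
    qed
    define near where "near = (\<lambda>l \<sigma> u. \<exists>y. blk0 y = Some l \<and> \<sigma> y \<notin> set ss \<and> (u, \<sigma> y) \<in> E ^^ k)"
    \<comment> \<open>The undeleted elements that realise \<theta> as a block of their own. Block
      \<open>n\<close> contains only \<open>x\<close>, so a constant valuation can be used.\<close>
    define P where "P = (\<lambda>\<theta>. {u \<in> univ G - set ss. TP n n (\<lambda>_. u) = \<theta>})"
    \<comment> \<open>Two realisations near the same value of \<open>\<sigma>'\<close> are within
      \<open>2 * k\<close> of each other. Hence \<open>Suc n\<close> realisations that are farther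
      apart cannot all be near the values of at most \<open>n\<close> variables.\<close>
    have "\<exists>ms. (\<exists>X\<subseteq>P \<theta>. card X = Suc n \<and> (\<forall>p\<in>X. \<forall>q\<in>X. p \<noteq> q \<longrightarrow> (p, q) \<notin> E ^^ (2 * k))) \<or>
      (length ms \<le> n \<and> (\<forall>u\<in>P \<theta>. \<exists>j<length ms. (ms ! j, u) \<in> E ^^ (2 * k)) \<and> set ms \<subseteq> P \<theta>)" for \<theta>
      using scattered_or_covered[of "P \<theta>" E n "2 * k"] finG symE reflE by (auto simp: P_def)
    then obtain ms where ms: "\<And>\<theta>. (\<exists>X\<subseteq>P \<theta>. card X = Suc n \<and> (\<forall>p\<in>X. \<forall>q\<in>X. p \<noteq> q \<longrightarrow> (p, q) \<notin> E ^^ (2 * k))) \<or>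
      (length (ms \<theta>) \<le> n \<and> (\<forall>u\<in>P \<theta>. \<exists>j<length (ms \<theta>). (ms \<theta> ! j, u) \<in> E ^^ (2 * k)) \<and> set (ms \<theta>) \<subseteq> P \<theta>)"
      by metis
    define F where "F = (\<lambda>l \<sigma>. if l < n then (TP n l \<sigma>,
        {(b, t). b < n \<and> b \<noteq> l \<and> t = TP b l \<sigma>},
        {t. \<exists>u\<in>univ G - set ss. near l \<sigma> u \<and> t = TP l l (\<sigma>(x := u))},
        {(\<theta>, j). \<theta> < N \<and> j < n \<and> (\<forall>u\<in>P \<theta>. (ms \<theta> ! j, u) \<in> E ^^ (2 * k) \<longrightarrow> near l \<sigma> u)})
      else (0, {}, {}, {}))"
    have "F l \<sigma> \<in> ?T" for l \<sigma> using TP by (auto simp: F_def)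
    moreover have "block_local blk F"
      unfolding block_local_def
    proof (intro allI impI)
      fix l and \<sigma> \<sigma>' :: "nat \<Rightarrow> nat" assume "\<forall>y. blk y = Some l \<longrightarrow> \<sigma> y = \<sigma>' y"
      then have eq: "\<sigma> y = \<sigma>' y" if "blk0 y = Some l" for y
        using that by (auto simp: blk0_def split: if_splits)
      have near: "near l \<sigma> u = near l \<sigma>' u" for u
        unfolding near_def using eq by metis
      have "TP b l \<sigma> = TP b l \<sigma>'" if "b \<le> n" "b \<noteq> l" for b
        by (rule TP_local) (use that eq in auto)
      moreover have "TP l l (\<sigma>(x := u)) = TP l l (\<sigma>'(x := u))" if "l \<le> n" for u
        by (rule TP_local) (use that eq in auto)
      ultimately show "F l \<sigma> = F l \<sigma>'" by (auto simp: F_def near)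
    qed
    moreover have "determines blk G (set ss) E (6 * k) F (Ex x \<phi>)"
      unfolding determines_def
    proof (intro allI impI)
      fix \<sigma> \<sigma>' assume V: "\<sigma> ` dom blk \<subseteq> univ G" "\<sigma>' ` dom blk \<subseteq> univ G"
        and sep6: "separated blk (set ss) E (6 * k) \<sigma>" "separated blk (set ss) E (6 * k) \<sigma>'"
        and eq: "\<forall>l. F l \<sigma> = F l \<sigma>'" and "sat G \<sigma> (Ex x \<phi>)"
      then obtain u where u: "u \<in> univ G" "sat G (\<sigma>(x := u)) \<phi>" by auto
      have far: "(\<rho> y, \<rho> z) \<notin> E ^^ j"
        if \<rho>: "\<rho> = \<sigma> \<or> \<rho> = \<sigma>'" and yz: "blk0 y = Some l" "blk0 z = Some l'" "l \<noteq> l'"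
          "\<rho> y \<notin> set ss" "\<rho> z \<notin> set ss" and j: "j \<le> 6 * k" for \<rho> y z l l' j
      proof
        assume E: "(\<rho> y, \<rho> z) \<in> E ^^ j"
        have yz': "blk y = Some l" "blk z = Some l'" using yz by (auto simp: blk0_def split: if_splits)
        then have "\<rho> z \<in> univ G" using V \<rho> by blast
        then have "(\<rho> y, \<rho> z) \<in> E ^^ (6 * k)" using relpow_mono_refl[OF E j] reflE yz by blast
        moreover have "separated blk (set ss) E (6 * k) \<rho>" using sep6 \<rho> by blast
        ultimately show False using separatedD[of blk "set ss" E "6 * k" \<rho> y z] yz yz' by auto
      qed
      \<comment> \<open>Putting \<open>x\<close> into block \<open>b\<close> on both sides, equal
        types suffice if the new values stay more than \<open>k\<close> away from all other
        blocks.\<close>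
      have finish: "sat G \<sigma>' (Ex x \<phi>)"
        if b: "b \<le> n" and u': "u' \<in> univ G"
          and tp: "\<And>l. TP b l (\<sigma>(x := u)) = TP b l (\<sigma>'(x := u'))"
          and far1: "\<And>l y. blk0 y = Some l \<Longrightarrow> l \<noteq> b \<Longrightarrow> u \<notin> set ss \<Longrightarrow> \<sigma> y \<notin> set ss \<Longrightarrow> (u, \<sigma> y) \<notin> E ^^ k"
          and far2: "\<And>l y. blk0 y = Some l \<Longrightarrow> l \<noteq> b \<Longrightarrow> u' \<notin> set ss \<Longrightarrow> \<sigma>' y \<notin> set ss \<Longrightarrow> (u', \<sigma>' y) \<notin> E ^^ k"
        for b u'
      proof -
        have sep: "separated (blk0(x \<mapsto> b)) (set ss) E k (\<rho>(x := w))"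
          if \<rho>: "\<rho> = \<sigma> \<or> \<rho> = \<sigma>'" and farw: "\<And>l y. blk0 y = Some l \<Longrightarrow> l \<noteq> b \<Longrightarrow> w \<notin> set ss \<Longrightarrow>
            \<rho> y \<notin> set ss \<Longrightarrow> (w, \<rho> y) \<notin> E ^^ k" for \<rho> w
          unfolding separated_def
        proof (intro ballI impI)
          fix y z assume y: "y \<in> dom (blk0(x \<mapsto> b))" and z: "z \<in> dom (blk0(x \<mapsto> b))"
            and ne: "(blk0(x \<mapsto> b)) y \<noteq> (blk0(x \<mapsto> b)) z"
            and S: "(\<rho>(x := w)) y \<notin> set ss" "(\<rho>(x := w)) z \<notin> set ss"
          consider "y = x" "z \<noteq> x" | "y \<noteq> x" "z = x" | "y \<noteq> x" "z \<noteq> x" using ne by auto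
          then show "((\<rho>(x := w)) y, (\<rho>(x := w)) z) \<notin> E ^^ k"
          proof cases
            case 1
            then obtain l where "blk0 z = Some l" "l \<noteq> b" using z ne by auto
            with farw[OF this] S 1 show ?thesis by auto
          next
            case 2
            then obtain l where "blk0 y = Some l" "l \<noteq> b" using y ne by auto
            from farw[OF this] S 2 have "(w, \<rho> y) \<notin> E ^^ k" by auto
            then show ?thesis using 2 relpow_sym[OF symE] by auto
          next
            case 3
            then obtain l l' where "blk0 y = Some l" "blk0 z = Some l'" "l \<noteq> l'" using y z ne by auto
            from far[OF \<rho> this, of k] S 3 show ?thesis by auto
          qed
        qed
        have "sat G (\<sigma>'(x := u')) \<phi>"
        proof (rule determinesD[of "blk0(x \<mapsto> b)" G "set ss" E k "TP b"])
          show "determines (blk0(x \<mapsto> b)) G (set ss) E k (TP b) \<phi>" using TP b by blast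
          show "(\<sigma>(x := u)) ` dom (blk0(x \<mapsto> b)) \<subseteq> univ G" using V(1) u(1) dom0 by auto
          show "(\<sigma>'(x := u')) ` dom (blk0(x \<mapsto> b)) \<subseteq> univ G" using V(2) u' dom0 by auto
          show "separated (blk0(x \<mapsto> b)) (set ss) E k (\<sigma>(x := u))" by (rule sep) (use far1 in auto)
          show "separated (blk0(x \<mapsto> b)) (set ss) E k (\<sigma>'(x := u'))" by (rule sep) (use far2 in auto)
          show "TP b l (\<sigma>(x := u)) = TP b l (\<sigma>'(x := u'))" for l by (rule tp)
          show "sat G (\<sigma>(x := u)) \<phi>" by (rule u(2))
        qed
        then show ?thesis using u' by auto
      qed
      have TP_outside: "TP b l (\<rho>(x := w)) = TP b l \<rho>" if "b \<le> n" "l \<noteq> b" for b l \<rho> w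
        by (rule TP_local) (use that blk0x in auto)
      have TP_eq: "TP b l (\<sigma>(x := w)) = TP b l (\<sigma>'(x := w'))" if b: "b \<le> n" "l \<noteq> b" for b l w w'
      proof (cases "l < n")
        case True
        have Feq: "F l \<sigma> = F l \<sigma>'" using eq by blast
        have "TP b l \<sigma> = TP b l \<sigma>'"
        proof (cases "b = n")
          case True
          then show ?thesis using Feq \<open>l < n\<close> by (simp add: F_def)
        next
          case False
          then have "(b, TP b l \<sigma>) \<in> fst (snd (F l \<sigma>))" using True b by (simp add: F_def)
          then have "(b, TP b l \<sigma>) \<in> fst (snd (F l \<sigma>'))" using Feq by simp
          then show ?thesis using True by (simp add: F_def)
        qed
        then show ?thesis using TP_outside b by simp
      next
        case False
        then show ?thesis using lt_n b by (intro TP_local) auto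
      qed
      consider "u \<in> set ss" | l where "u \<notin> set ss" "near l \<sigma> u" | "u \<notin> set ss" "\<forall>l. \<not> near l \<sigma> u" by blast
      then show "sat G \<sigma>' (Ex x \<phi>)"
      proof cases
        \<comment> \<open>A deleted witness is used again under \<open>\<sigma>'\<close>, as
          separation exempts deleted values.\<close>
        case 1
        show ?thesis
        proof (rule finish[of n u])
          show "TP n l (\<sigma>(x := u)) = TP n l (\<sigma>'(x := u))" for l
          proof (cases "l = n")
            case True
            then show ?thesis using lt_n by (intro TP_local) fastforce+
          qed (use TP_eq in auto)
        qed (use 1 u in auto)
      next
        case 2
        then obtain y where y: "blk0 y = Some l" "\<sigma> y \<notin> set ss" "(u, \<sigma> y) \<in> E ^^ k"
          unfolding near_def by blast
        have l: "l < n" using lt_n y(1) .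
        have Feq: "F l \<sigma> = F l \<sigma>'" using eq by blast
        have "TP l l (\<sigma>(x := u)) \<in> fst (snd (snd (F l \<sigma>)))" using 2 u(1) l by (auto simp: F_def)
        then have "TP l l (\<sigma>(x := u)) \<in> fst (snd (snd (F l \<sigma>')))" using Feq by simp
        then obtain u' where u': "u' \<in> univ G" "u' \<notin> set ss" "near l \<sigma>' u'"
          "TP l l (\<sigma>(x := u)) = TP l l (\<sigma>'(x := u'))" using l by (auto simp: F_def)
        \<comment> \<open>The blocks are more than \<open>6 * k\<close> apart, so a point within
          \<open>k\<close> of one block is farther than \<open>k\<close> from all others.\<close>
        have away: "(w, \<rho> z) \<notin> E ^^ k"
          if "near l \<rho> w" "\<rho> = \<sigma> \<or> \<rho> = \<sigma>'" "blk0 z = Some l'" "l' \<noteq> l" "\<rho> z \<notin> set ss" for w \<rho> z l'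
        proof
          assume wz: "(w, \<rho> z) \<in> E ^^ k"
          from that(1) obtain v where v: "blk0 v = Some l" "\<rho> v \<notin> set ss" "(w, \<rho> v) \<in> E ^^ k"
            unfolding near_def by blast
          have "(\<rho> v, \<rho> z) \<in> E ^^ (k + k)" using relpow_trans[OF relpow_sym[OF symE v(3)] wz] .
          then show False using far[OF that(2) v(1) that(3) _ v(2) that(5), of "k + k"] that(4) by auto
        qed
        show ?thesis
        proof (rule finish[of l u'])
          show "TP l l' (\<sigma>(x := u)) = TP l l' (\<sigma>'(x := u'))" for l'
            using TP_eq[of l l'] l u'(4) by (cases "l' = l") auto
          show "(u, \<sigma> z) \<notin> E ^^ k" if "blk0 z = Some l'" "l' \<noteq> l" "\<sigma> z \<notin> set ss" for l' z
            using away[OF 2(2) _ that] by blast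
          show "(u', \<sigma>' z) \<notin> E ^^ k" if "blk0 z = Some l'" "l' \<noteq> l" "\<sigma>' z \<notin> set ss" for l' z
            using away[OF u'(3) _ that] by blast
        qed (use l u' in auto)
      next
        case 3
        define \<theta> where "\<theta> = TP n n (\<lambda>_. u)"
        have uP: "u \<in> P \<theta>" using u 3 by (simp add: P_def \<theta>_def)
        have \<theta>: "\<theta> < N" using TP by (simp add: \<theta>_def)
        have "\<exists>u'\<in>P \<theta>. \<forall>l. \<not> near l \<sigma>' u'"
        proof (rule ccontr)
          assume "\<not> ?thesis"
          then have all_near: "\<exists>l. near l \<sigma>' w" if "w \<in> P \<theta>" for w using that by blast
          from ms[of \<theta>] show False
          proof
            assume "\<exists>X\<subseteq>P \<theta>. card X = Suc n \<and> (\<forall>p\<in>X. \<forall>q\<in>X. p \<noteq> q \<longrightarrow> (p, q) \<notin> E ^^ (2 * k))"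
            then obtain X where X: "X \<subseteq> P \<theta>" "card X = Suc n"
              "\<forall>p\<in>X. \<forall>q\<in>X. p \<noteq> q \<longrightarrow> (p, q) \<notin> E ^^ (2 * k)" by blast
            have "\<exists>y\<in>dom blk0. (w, \<sigma>' y) \<in> E ^^ k" if "w \<in> X" for w
              using all_near[of w] that X(1) unfolding near_def by blast
            then obtain h where h: "\<And>w. w \<in> X \<Longrightarrow> h w \<in> dom blk0 \<and> (w, \<sigma>' (h w)) \<in> E ^^ k" by metis
            have "inj_on h X"
            proof (rule inj_onI)
              fix p q assume pq: "p \<in> X" "q \<in> X" "h p = h q"
              then have "(p, \<sigma>' (h p)) \<in> E ^^ k" "(\<sigma>' (h p), q) \<in> E ^^ k"
                using h[of p] h[of q] relpow_sym[OF symE] by auto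
              from relpow_trans[OF this] have "(p, q) \<in> E ^^ (2 * k)" by (simp add: mult_2)
              with X(3) pq show "p = q" by blast
            qed
            moreover have "h ` X \<subseteq> dom blk0" using h by blast
            ultimately have "card X \<le> card (dom blk0)" using fin0 by (metis card_inj_on_le)
            with X(2) card0 show False by simp
          next
            assume "length (ms \<theta>) \<le> n \<and> (\<forall>u\<in>P \<theta>. \<exists>j<length (ms \<theta>). (ms \<theta> ! j, u) \<in> E ^^ (2 * k)) \<and>
              set (ms \<theta>) \<subseteq> P \<theta>"
            then obtain j where j: "j < n" "(ms \<theta> ! j, u) \<in> E ^^ (2 * k)"
              using uP by (meson less_le_trans)
            obtain l where l: "near l \<sigma>' u" using all_near[OF uP] by blast
            then obtain y where y: "blk0 y = Some l" "\<sigma>' y \<notin> set ss" "(u, \<sigma>' y) \<in> E ^^ k"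
              unfolding near_def by blast
            \<comment> \<open>All realisations in this ball are near the same block \<open>l\<close>
              of \<open>\<sigma>'\<close>. This is recorded in the type of that single block, hence
              it also holds for \<open>\<sigma>\<close>, and puts \<open>u\<close> near block
              \<open>l\<close>.\<close>
            have "near l \<sigma>' w" if w: "w \<in> P \<theta>" "(ms \<theta> ! j, w) \<in> E ^^ (2 * k)" for w
            proof -
              obtain l' where l': "near l' \<sigma>' w" using all_near[OF w(1)] by blast
              then obtain z where z: "blk0 z = Some l'" "\<sigma>' z \<notin> set ss" "(w, \<sigma>' z) \<in> E ^^ k"
                unfolding near_def by blast
              have "(\<sigma>' y, ms \<theta> ! j) \<in> E ^^ (k + 2 * k)"
                using relpow_trans[OF relpow_sym[OF symE y(3)] relpow_sym[OF symE j(2)]] .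
              from relpow_trans[OF relpow_trans[OF this w(2)] z(3)]
              moreover have "k + 2 * k + 2 * k + k = 6 * k" by simp
              ultimately have "(\<sigma>' y, \<sigma>' z) \<in> E ^^ (6 * k)" by metis
              then have "l = l'" using far[of \<sigma>' y l z l' "6 * k"] y z by auto
              with l' show ?thesis by simp
            qed
            then have "(\<theta>, j) \<in> snd (snd (snd (F l \<sigma>')))" using \<theta> j lt_n[OF y(1)] by (simp add: F_def)
            then have "(\<theta>, j) \<in> snd (snd (snd (F l \<sigma>)))" using eq by simp
            then have "near l \<sigma> u" using uP j lt_n[OF y(1)] by (simp add: F_def)
            then show False using 3 by blast
          qed
        qed
        then obtain u' where u': "u' \<in> P \<theta>" "\<forall>l. \<not> near l \<sigma>' u'" by blast
        show ?thesis
        proof (rule finish[of n u'])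
          show "TP n l (\<sigma>(x := u)) = TP n l (\<sigma>'(x := u'))" for l
          proof (cases "l = n")
            case True
            have "TP n n (\<sigma>(x := u)) = TP n n (\<lambda>_. u)" "TP n n (\<sigma>'(x := u')) = TP n n (\<lambda>_. u')"
              by (rule TP_local; use lt_n in fastforce)+
            then show ?thesis using u'(1) True by (simp add: P_def \<theta>_def)
          qed (use TP_eq in auto)
          show "(u, \<sigma> y) \<notin> E ^^ k" if "blk0 y = Some l" "\<sigma> y \<notin> set ss" for l y
            using 3 that unfolding near_def by blast
          show "(u', \<sigma>' y) \<notin> E ^^ k" if "blk0 y = Some l" "\<sigma>' y \<notin> set ss" for l y
            using u'(2) that unfolding near_def by blast
        qed (use u' in \<open>auto simp: P_def\<close>)
      qed
    qed
    ultimately show "\<exists>F. (\<forall>l \<sigma>. F l \<sigma> \<in> ?T) \<and> block_local blk F \<and>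
      determines blk G (set ss) E (6 * k) F (Ex x \<phi>)" by (intro exI[of _ F] conjI allI)
  qed
  ultimately show "\<exists>T :: (nat \<times> (nat \<times> nat) set \<times> nat set \<times> (nat \<times> nat) set) set. finite T \<and>
      typed_by \<tau> (Ex x \<phi>) n s (6 * k) T" by (intro exI[of _ ?T] conjI)
  qed (use k in auto)
qed

theorem first_order_locality: "well_formed \<tau> \<phi> \<Longrightarrow> local_formula \<tau> \<phi>"
  by (induction \<phi>) (use local_Rel local_Eq local_Neg local_Conj local_Ex in auto)

section \<open>Pairs that few queries separate\<close>

text \<open>Pairs are removed one by one by the pigeonhole principle, as more than \<open>N\<close>
  elements are left whenever a pair is still wanted. Pair \<open>i\<close> occupies positions
  \<open>2 * i\<close> and \<open>Suc (2 * i)\<close> of a flat list; the marker and the detector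
  use the same layout.\<close>

lemma equal_type_pairs:
  fixes tp :: "'a \<Rightarrow> nat"
  assumes "finite A" "\<forall>a\<in>A. tp a < N" "2 * m + N \<le> card A"
  shows "\<exists>ps. length ps = 2 * m \<and> distinct ps \<and> set ps \<subseteq> A \<and>
    (\<forall>i<m. tp (ps ! (2 * i)) = tp (ps ! Suc (2 * i)))"
  using assms
proof (induction m arbitrary: A)
  case 0
  then show ?case by (intro exI[of _ "[]"]) simp
next
  case (Suc m)
  have "\<not> inj_on tp A"
  proof
    assume "inj_on tp A"
    then have "card A = card (tp ` A)" by (simp add: card_image)
    also have "\<dots> \<le> card {..<N}" using Suc.prems(2) by (intro card_mono) auto
    finally show False using Suc.prems(3) by simp
  qed
  then obtain x y where xy: "x \<in> A" "y \<in> A" "x \<noteq> y" "tp x = tp y" unfolding inj_on_def by blast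
  have "card (A - {x, y}) = card A - 2"
    using xy Suc.prems(1) by (simp add: card_Diff_subset)
  then have "2 * m + N \<le> card (A - {x, y})" using Suc.prems(3) by simp
  with Suc.IH[of "A - {x, y}"] Suc.prems obtain ps where
    ps: "length ps = 2 * m" "distinct ps" "set ps \<subseteq> A - {x, y}"
      "\<forall>i<m. tp (ps ! (2 * i)) = tp (ps ! Suc (2 * i))" by auto
  have "tp ((x # y # ps) ! (2 * i)) = tp ((x # y # ps) ! Suc (2 * i))" if "i < Suc m" for i
    using that ps(4) xy(4) by (cases i) auto
  with ps xy show ?case by (intro exI[of _ "x # y # ps"]) auto
qed

lemma locality_graph_nbr:
  assumes "finite_structure \<tau> G" "length ss \<le> s"
  shows "locality_graph \<tau> s G ss (nbr (Gaifman_graph G) (set ss))"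
proof -
  let ?E = "nbr (Gaifman_graph G) (set ss)"
  have "sym ?E" by (auto simp: sym_def nbr_def insert_commute)
  moreover have "\<forall>x\<in>univ G - set ss. (x, x) \<in> ?E" by (simp add: nbr_def Gaifman_graph_def)
  moreover have "(u, v) \<in> ?E"
    if "i < length \<tau>" "t \<in> rels G ! i" "u \<in> set t" "v \<in> set t" "u \<notin> set ss" "v \<notin> set ss" for i t u v
  proof -
    have "set t \<subseteq> univ G" "rels G ! i \<in> set (rels G)"
      using that assms(1) unfolding finite_structure_def tuples_def by auto
    then have "u \<in> univ G" "v \<in> univ G" "u \<noteq> v \<longrightarrow> {u, v} \<in> edges (Gaifman_graph G)"
      using that unfolding Gaifman_graph_def by auto
    then show ?thesis using that by (auto simp: nbr_def Gaifman_graph_def)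
  qed
  ultimately show ?thesis using assms unfolding locality_graph_def by blast
qed

text \<open>The elements are given by a function on positions, because they come both as a list
  \<open>(!) ps\<close> and as a number read by \<open>lnth p\<close>.\<close>

definition split_pairs :: "nat \<Rightarrow> (nat \<Rightarrow> 'a) \<Rightarrow> 'a set \<Rightarrow> nat set" where
  "split_pairs m b X = {i. i < m \<and> (b (2 * i) \<in> X) \<noteq> (b (Suc (2 * i)) \<in> X)}"

theorem query_pairs:
  fixes C :: "nat ugraph set"
  assumes C: "\<forall>H\<in>C. simple_graph H" "minor_closed C" "locally_bounded_tree_width C"
    and \<psi>: "unary_query \<tau> r \<psi>"
  shows "\<exists>g. poly_bounded g \<and> (\<forall>G\<in>structures_over \<tau> C. \<forall>m. g m \<le> card (active r \<psi> G) \<longrightarrow>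
    (\<exists>ps. length ps = 2 * m \<and> distinct ps \<and> set ps \<subseteq> active r \<psi> G \<and>
      (\<forall>a\<in>tuples (univ G) r. card (split_pairs m ((!) ps) (query_output r \<psi> G a)) \<le> r)))"
proof -
  obtain D where D: "\<forall>G\<in>C. finite (verts G) \<longrightarrow> minor_sparse D G"
    using class_minor_sparse[OF C] by blast
  have "local_formula \<tau> \<psi>" using first_order_locality \<psi> unfolding unary_query_def by blast
  then obtain k where types: "\<And>n s. \<exists>N :: nat. typed_by \<tau> \<psi> n s k {..<N}" unfolding local_formula_def by blast
  \<comment> \<open>The number of vertices deleted to scatter at radius \<open>k\<close>; it is
    available only now that the formula has fixed \<open>k\<close>.\<close>
  define s where "s = k * ((D + 1) * (2 * D + 1))"
  obtain N :: nat where N: "typed_by \<tau> \<psi> (r + 2) s k {..<N}" using types by blast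
  \<comment> \<open>There must be \<open>2 * m\<close> elements for the pairs and \<open>N\<close>
    more for the pigeonhole principle.\<close>
  define g where "g = (\<lambda>m. scatter_size D k (2 * m + N))"
  have "poly_bounded g" unfolding g_def
    by (intro poly_bounded_compose[OF poly_bounded_scatter_size] poly_bounded_add poly_bounded_mult
        poly_bounded_const poly_bounded_id)
  moreover have "\<exists>ps. length ps = 2 * m \<and> distinct ps \<and> set ps \<subseteq> active r \<psi> G \<and>
      (\<forall>a\<in>tuples (univ G) r. card (split_pairs m ((!) ps) (query_output r \<psi> G a)) \<le> r)"
    if G: "G \<in> structures_over \<tau> C" and large: "g m \<le> card (active r \<psi> G)" for G m
  proof -
    let ?H = "Gaifman_graph G"
    have H: "?H \<in> C" and finG: "finite_structure \<tau> G"
      using G unfolding structures_over_def by auto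
    have vH: "verts ?H = univ G" by (simp add: Gaifman_graph_def)
    have finV: "finite (univ G)" using finG unfolding finite_structure_def by blast
    have active: "active r \<psi> G \<subseteq> univ G" unfolding active_def query_output_def by auto
    have "minor_sparse D ?H" using D H finV vH by auto
    from large_scattered_set[OF _ this, of "active r \<psi> G" k "2 * m + N"]
    obtain S A where S: "finite S" "card S \<le> k * ((D + 1) * (2 * D + 1))" and
      A: "A \<subseteq> active r \<psi> G" "2 * m + N \<le> card A" "scattered ?H S k A"
      using finV vH active large unfolding g_def by auto
    obtain ss where ss: "set ss = S" "distinct ss" using finite_distinct_list[OF S(1)] by blast
    then have "length ss \<le> s" using S(2) distinct_card unfolding s_def by fastforce
    let ?E = "nbr ?H S"
    have loc: "locality_graph \<tau> s G ss ?E" using locality_graph_nbr[OF finG \<open>length ss \<le> s\<close>] ss by simp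
    \<comment> \<open>All parameters share one block, since they may be arbitrarily close to each
      other; only their distance from the value of \<open>y\<close> matters.\<close>
    define blk :: "nat \<Rightarrow> nat option" where
      "blk = (\<lambda>v. if v < r then Some 0 else if v = r then Some 1 else None)"
    have dom: "dom blk = {..r}" by (auto simp: blk_def split: if_splits)
    have "\<exists>tp :: nat \<Rightarrow> (nat \<Rightarrow> nat) \<Rightarrow> nat. (\<forall>l \<sigma>. tp l \<sigma> \<in> {..<N}) \<and> block_local blk tp \<and>
        determines blk G (set ss) ?E k tp \<psi>"
    proof (rule typed_byD[OF N loc])
      show "finite (dom blk)" "card (dom blk) \<le> r + 2" using dom by auto
      show "ran blk \<subseteq> {..<r + 2}" by (auto simp: ran_def blk_def split: if_splits)
      show "free_vars \<psi> \<subseteq> dom blk" using \<psi> dom unfolding unary_query_def by simp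
    qed
    then obtain tp :: "nat \<Rightarrow> (nat \<Rightarrow> nat) \<Rightarrow> nat" where tp: "\<forall>l \<sigma>. tp l \<sigma> \<in> {..<N}" "block_local blk tp"
      "determines blk G (set ss) ?E k tp \<psi>" by blast
    have AV: "A \<subseteq> univ G" using A(1) active by blast
    then have finA: "finite A" using finV finite_subset by blast
    obtain ps where ps: "length ps = 2 * m" "distinct ps" "set ps \<subseteq> A"
      "\<forall>i<m. tp 1 (\<lambda>_. ps ! (2 * i)) = tp 1 (\<lambda>_. ps ! Suc (2 * i))"
      using equal_type_pairs[OF finA, of "\<lambda>b. tp 1 (\<lambda>_. b)" N m] tp(1) A(2) by blast
    have psA: "ps ! (2 * i) \<in> A" "ps ! Suc (2 * i) \<in> A" if "i < m" for i
    proof -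
      have "2 * i < length ps" "Suc (2 * i) < length ps" using that ps(1) by auto
      then show "ps ! (2 * i) \<in> A" "ps ! Suc (2 * i) \<in> A" using ps(3) nth_mem by blast+
    qed
    have "card (split_pairs m ((!) ps) (query_output r \<psi> G a)) \<le> r" (is "card ?bad \<le> r")
      if a: "a \<in> tuples (univ G) r" for a
    proof -
      have la: "length a = r" and aV: "j < r \<Longrightarrow> a ! j \<in> univ G" for j
        using a unfolding tuples_def by auto
      let ?val = "\<lambda>b i. if i < r then a ! i else b"
      have transfer: "sat G (?val b') \<psi>"
        if b: "b \<in> A" "b' \<in> A" "tp 1 (\<lambda>_. b) = tp 1 (\<lambda>_. b')" "sat G (?val b) \<psi>"
          and far: "\<forall>j<r. a ! j \<notin> ball ?H S k b \<and> a ! j \<notin> ball ?H S k b'" for b b'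
      proof -
        have image: "?val c ` dom blk \<subseteq> univ G" if "c \<in> A" for c
          using that AV aV dom by auto
        have symE: "sym ?E" using loc unfolding locality_graph_def by blast
        have sep: "separated blk (set ss) ?E k (?val c)"
          if "\<forall>j<r. a ! j \<notin> ball ?H S k c" for c
        proof -
          have 1: "(c, a ! j) \<notin> ?E ^^ k" if "j < r" for j
            using \<open>\<forall>j<r. a ! j \<notin> ball ?H S k c\<close> that unfolding ball_def by blast
          then have 2: "(a ! j, c) \<notin> ?E ^^ k" if "j < r" for j
            using that relpow_sym[OF symE] by blast
          show ?thesis unfolding separated_def using 1 2 by (auto simp: blk_def split: if_splits)
        qed
        have type1: "tp 1 (?val c) = tp 1 (\<lambda>_. c)" for c
          by (rule block_localD[OF tp(2)]) (auto simp: blk_def split: if_splits)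
        have "tp l (?val b) = tp l (?val b')" for l
        proof (cases "l = 1")
          case True
          then show ?thesis using type1 b(3) by simp
        next
          case False
          then show ?thesis
            by (intro block_localD[OF tp(2)]) (auto simp: blk_def split: if_splits)
        qed
        then show ?thesis
          using determinesD[OF tp(3) image[OF b(1)] image[OF b(2)] sep sep] far b(4) by blast
      qed
      have ex: "\<exists>j<r. a ! j \<in> ball ?H S k (ps ! (2 * i)) \<union> ball ?H S k (ps ! Suc (2 * i))"
        if i: "i \<in> ?bad" for i
      proof (rule ccontr)
        assume "\<not> ?thesis"
        then have far: "\<forall>j<r. a ! j \<notin> ball ?H S k (ps ! (2 * i)) \<and> a ! j \<notin> ball ?H S k (ps ! Suc (2 * i))"
          by blast
        then have far': "\<forall>j<r. a ! j \<notin> ball ?H S k (ps ! Suc (2 * i)) \<and> a ! j \<notin> ball ?H S k (ps ! (2 * i))"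
          by blast
        have im: "i < m" using i by (simp add: split_pairs_def)
        have eq: "tp 1 (\<lambda>_. ps ! (2 * i)) = tp 1 (\<lambda>_. ps ! Suc (2 * i))" using ps(4) im by blast
        have "sat G (?val (ps ! (2 * i))) \<psi> \<longleftrightarrow> sat G (?val (ps ! Suc (2 * i))) \<psi>"
          using transfer[OF psA[OF im] eq _ far] transfer[OF psA(2,1)[OF im] eq[symmetric] _ far'] by blast
        then show False using i psA[OF im] AV unfolding query_output_def split_pairs_def by blast
      qed
      \<comment> \<open>Each separated pair is charged to a parameter in the ball of one of its
        members. The balls are disjoint, so no parameter is charged twice.\<close>
      define h where "h = (\<lambda>i. SOME j. j < r \<and>
          a ! j \<in> ball ?H S k (ps ! (2 * i)) \<union> ball ?H S k (ps ! Suc (2 * i)))"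
      have h: "h i < r \<and> a ! h i \<in> ball ?H S k (ps ! (2 * i)) \<union> ball ?H S k (ps ! Suc (2 * i))"
        if "i \<in> ?bad" for i
        using someI_ex[OF ex[OF that]] unfolding h_def .
      have "inj_on h ?bad"
      proof (rule inj_onI)
        fix i j assume i: "i \<in> ?bad" and j: "j \<in> ?bad" and eq: "h i = h j"
        obtain i' where i': "i' = 2 * i \<or> i' = Suc (2 * i)" "a ! h i \<in> ball ?H S k (ps ! i')"
          using h[OF i] by blast
        obtain j' where j': "j' = 2 * j \<or> j' = Suc (2 * j)" "a ! h i \<in> ball ?H S k (ps ! j')"
          using h[OF j] eq by auto
        have lt: "i' < length ps" "j' < length ps"
          using i j i'(1) j'(1) ps(1) by (auto simp: split_pairs_def)
        have "ps ! i' \<in> A" "ps ! j' \<in> A" using lt ps(3) nth_mem by blast+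
        then have "ps ! i' = ps ! j'" using A(3) i'(2) j'(2) unfolding scattered_def by blast
        then have "i' = j'" using ps(2) lt nth_eq_iff_index_eq by blast
        then show "i = j" using i'(1) j'(1) by presburger
      qed
      moreover have "h ` ?bad \<subseteq> {..<r}" using h by blast
      ultimately have "card ?bad \<le> card {..<r}" by (rule card_inj_on_le) simp
      then show ?thesis by simp
    qed
    with ps A(1) show ?thesis by (intro exI[of _ ps]) auto
  qed
  ultimately show ?thesis by blast
qed

section \<open>Computable functions\<close>

text \<open>In the rules below, a binder extends the argument list in front, so that the outer arguments are
  found in the tail.\<close>

definition crec :: "nat \<Rightarrow> ((nat \<Rightarrow> nat) \<Rightarrow> nat list \<Rightarrow> nat) \<Rightarrow> bool" where
  "crec n F \<longleftrightarrow> (\<exists>p. \<forall>Q xs. length xs = n \<longrightarrow> computes Q p xs (F Q xs))"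

definition cpred :: "nat \<Rightarrow> ((nat \<Rightarrow> nat) \<Rightarrow> nat list \<Rightarrow> bool) \<Rightarrow> bool" where
  "cpred n P \<longleftrightarrow> crec n (\<lambda>Q xs. of_bool (P Q xs))"

lemma crec_cong:
  assumes "crec n F" "\<And>Q xs. length xs = n \<Longrightarrow> F Q xs = G Q xs"
  shows "crec n G"
  using assms unfolding crec_def by metis

lemma cpred_cong:
  assumes "cpred n P" "\<And>Q xs. length xs = n \<Longrightarrow> P Q xs = R Q xs"
  shows "cpred n R"
  using assms(1) unfolding cpred_def by (rule crec_cong) (simp add: assms(2))

lemma crec_nth: "i < n \<Longrightarrow> crec n (\<lambda>Q xs. xs ! i)"
  unfolding crec_def using computes.Proj by metis

lemma crec_comp:
  assumes F: "crec k F" and k: "length Gs = k" and Gs: "\<forall>G\<in>set Gs. crec n G"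
  shows "crec n (\<lambda>Q xs. F Q (map (\<lambda>G. G Q xs) Gs))"
proof -
  obtain p where p: "\<And>Q xs. length xs = k \<Longrightarrow> computes Q p xs (F Q xs)"
    using F unfolding crec_def by blast
  obtain q where q: "\<And>G Q xs. G \<in> set Gs \<Longrightarrow> length xs = n \<Longrightarrow> computes Q (q G) xs (G Q xs)"
    using Gs unfolding crec_def by metis
  have "computes Q (Comp p (map q Gs)) xs (F Q (map (\<lambda>G. G Q xs) Gs))" if "length xs = n" for Q xs
  proof (rule computes.Comp)
    show "list_all2 (\<lambda>q y. computes Q q xs y) (map q Gs) (map (\<lambda>G. G Q xs) Gs)"
      using q that by (simp add: list_all2_conv_all_nth)
    show "computes Q p (map (\<lambda>G. G Q xs) Gs) (F Q (map (\<lambda>G. G Q xs) Gs))"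
      using p k by simp
  qed
  then show ?thesis unfolding crec_def by blast
qed

lemma crec_comp1:
  assumes "crec 1 (\<lambda>Q xs. f (xs ! 0))" "crec n F"
  shows "crec n (\<lambda>Q xs. f (F Q xs))"
  using crec_comp[OF assms(1), of "[F]" n] assms(2) by simp

lemma crec_comp2:
  assumes "crec 2 (\<lambda>Q xs. f (xs ! 0) (xs ! 1))" "crec n F" "crec n G"
  shows "crec n (\<lambda>Q xs. f (F Q xs) (G Q xs))"
  using crec_comp[OF assms(1), of "[F, G]" n] assms(2,3) by simp

lemma cpred_comp2:
  assumes "cpred 2 (\<lambda>Q xs. f (xs ! 0) (xs ! 1))" "crec n F" "crec n G"
  shows "cpred n (\<lambda>Q xs. f (F Q xs) (G Q xs))"
  using assms unfolding cpred_def by (rule crec_comp2)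

lemma crec_drop:
  assumes "crec n F"
  shows "crec (k + n) (\<lambda>Q xs. F Q (drop k xs))"
proof -
  have "crec (k + n) (\<lambda>Q xs. F Q (map (\<lambda>G. G Q xs) (map (\<lambda>i Q xs. xs ! (k + i)) [0..<n])))"
    by (rule crec_comp[OF assms]) (auto intro: crec_nth)
  then show ?thesis
  proof (rule crec_cong)
    fix Q :: "nat \<Rightarrow> nat" and xs :: "nat list" assume "length xs = k + n"
    then have "map (\<lambda>G. G Q xs) (map (\<lambda>i Q xs. xs ! (k + i)) [0..<n]) = drop k xs"
      by (intro nth_equalityI) auto
    then show "F Q (map (\<lambda>G. G Q xs) (map (\<lambda>i Q xs. xs ! (k + i)) [0..<n])) = F Q (drop k xs)"
      by simp
  qed
qed

lemma crec_tl:
  assumes "crec n F"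
  shows "crec (Suc n) (\<lambda>Q xs. F Q (tl xs))"
  using crec_drop[OF assms, of 1] by (simp add: drop_Suc)

text \<open>Puts the term \<open>T\<close> in place of the bound argument at the front, in a context
  with \<open>k\<close> further arguments. Inside a primitive recursion the two extra arguments are
  the counter and the previous value.\<close>

lemma crec_subst:
  assumes P: "crec (Suc n) (\<lambda>Q ys. P Q (tl ys) (ys ! 0))" and T: "crec (k + n) T"
  shows "crec (k + n) (\<lambda>Q ys. P Q (drop k ys) (T Q ys))"
proof -
  let ?Gs = "T # map (\<lambda>i Q ys. ys ! (k + i)) [0..<n]"
  have "crec (k + n) (\<lambda>Q ys. (\<lambda>Q zs. P Q (tl zs) (zs ! 0)) Q (map (\<lambda>G. G Q ys) ?Gs))"
    by (rule crec_comp[OF P]) (auto intro: crec_nth T)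
  then show ?thesis
  proof (rule crec_cong)
    fix Q :: "nat \<Rightarrow> nat" and ys :: "nat list" assume "length ys = k + n"
    then have "map (\<lambda>G. G Q ys) (map (\<lambda>i Q ys. ys ! (k + i)) [0..<n]) = drop k ys"
      by (intro nth_equalityI) auto
    then show "(\<lambda>Q zs. P Q (tl zs) (zs ! 0)) Q (map (\<lambda>G. G Q ys) ?Gs) = P Q (drop k ys) (T Q ys)"
      by simp
  qed
qed

lemma crec_0: "crec n (\<lambda>Q xs. 0)"
  unfolding crec_def using computes.Zero by blast

lemma crec_Suc_nth: "crec 1 (\<lambda>Q xs. Suc (xs ! 0))"
  unfolding crec_def
proof (intro exI[of _ Succ] allI impI)
  fix Q and xs :: "nat list" assume "length xs = 1"
  then obtain x where "xs = [x]" by (auto simp: length_Suc_conv)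
  then show "computes Q Succ xs (Suc (xs ! 0))" by (simp add: computes.Succ)
qed

lemmas crec_Suc = crec_comp1[OF crec_Suc_nth]

lemma crec_const: "crec n (\<lambda>Q xs. c)"
  by (induction c) (auto intro: crec_0 crec_Suc)

lemma crec_ask:
  assumes "crec n F"
  shows "crec n (\<lambda>Q xs. Q (F Q xs))"
proof -
  have "computes Q Ask xs (Q (xs ! 0))" if l: "length xs = 1" for Q xs
  proof -
    obtain x where "xs = [x]" using l by (auto simp: length_Suc_conv)
    then show ?thesis by (simp add: computes.Ask)
  qed
  then have "crec 1 (\<lambda>Q xs. Q (xs ! 0))" unfolding crec_def by blast
  from crec_comp[OF this, of "[F]" n] assms show ?thesis by simp
qed

lemma crec_rec:
  assumes B: "crec n B" and S: "crec (Suc (Suc n)) (\<lambda>Q ys. S Q (tl (tl ys)) (ys ! 0) (ys ! 1))"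
    and M: "crec n M"
  shows "crec n (\<lambda>Q xs. rec_nat (B Q xs) (S Q xs) (M Q xs))"
proof -
  obtain p where p: "\<And>Q xs. length xs = n \<Longrightarrow> computes Q p xs (B Q xs)"
    using B unfolding crec_def by blast
  obtain q where "\<And>Q ys. length ys = Suc (Suc n) \<Longrightarrow> computes Q q ys (S Q (tl (tl ys)) (ys ! 0) (ys ! 1))"
    using S unfolding crec_def by blast
  from this[of "_ # _ # _"] have q: "computes Q q (i # y # xs) (S Q xs i y)" if "length xs = n" for Q i y xs
    using that by simp
  have "computes Q (PrimRec p q) (m # xs) (rec_nat (B Q xs) (S Q xs) m)" if "length xs = n" for Q m xs
  proof (induction m)
    case 0
    show ?case using p that by (simp add: computes.PrimRec_0)
  next
    case (Suc m)
    show ?case using computes.PrimRec_Suc[OF Suc q[OF that]] by simp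
  qed
  then have "crec (Suc n) (\<lambda>Q ys. rec_nat (B Q (tl ys)) (S Q (tl ys)) (hd ys))"
    unfolding crec_def by (intro exI[of _ "PrimRec p q"]) (auto simp: length_Suc_conv)
  from crec_comp[OF this, of "M # map (\<lambda>i Q xs. xs ! i) [0..<n]" n]
  have "crec n (\<lambda>Q xs. rec_nat (B Q (map ((!) xs) [0..<n])) (S Q (map ((!) xs) [0..<n])) (M Q xs))"
    using M by (simp add: comp_def crec_nth)
  then show ?thesis by (rule crec_cong) (metis map_nth)
qed

lemma crec_nth_tl: "Suc i < n \<Longrightarrow> crec n (\<lambda>Q xs. tl xs ! i)"
  using crec_tl[OF crec_nth[of i "n - 1"]] by simp

lemma crec_nth_tl2: "Suc (Suc i) < n \<Longrightarrow> crec n (\<lambda>Q xs. tl (tl xs) ! i)"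
  using crec_tl[OF crec_nth_tl[of i "n - 1"]] by simp

lemmas crec_basic = crec_nth crec_nth_tl crec_nth_tl2 crec_Suc crec_const crec_ask

lemma crec_plus:
  assumes "crec n F" "crec n G"
  shows "crec n (\<lambda>Q xs. F Q xs + G Q xs)"
proof -
  have "rec_nat x (\<lambda>_ z. Suc z) y = x + y" for x y by (induction y) auto
  moreover have "crec 2 (\<lambda>Q xs. rec_nat (xs ! 0) (\<lambda>_ z. Suc z) (xs ! 1))"
    by (intro crec_rec crec_basic) auto
  ultimately have "crec 2 (\<lambda>Q xs. xs ! 0 + xs ! 1)" by simp
  then show ?thesis using assms by (rule crec_comp2)
qed

lemma crec_times:
  assumes "crec n F" "crec n G"
  shows "crec n (\<lambda>Q xs. F Q xs * G Q xs)"
proof -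
  have "rec_nat 0 (\<lambda>_ z. z + x) y = x * y" for x y :: nat by (induction y) auto
  moreover have "crec 2 (\<lambda>Q xs. rec_nat 0 (\<lambda>_ z. z + xs ! 0) (xs ! 1))"
    by (intro crec_rec crec_basic crec_plus) auto
  ultimately have "crec 2 (\<lambda>Q xs. xs ! 0 * xs ! 1)" by simp
  then show ?thesis using assms by (rule crec_comp2)
qed

lemma crec_power:
  assumes "crec n F" "crec n G"
  shows "crec n (\<lambda>Q xs. F Q xs ^ G Q xs)"
proof -
  have "rec_nat 1 (\<lambda>_ z. z * x) y = x ^ y" for x y :: nat by (induction y) auto
  moreover have "crec 2 (\<lambda>Q xs. rec_nat 1 (\<lambda>_ z. z * xs ! 0) (xs ! 1))"
    by (intro crec_rec crec_basic crec_times) auto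
  ultimately have "crec 2 (\<lambda>Q xs. (xs ! 0) ^ (xs ! 1))" by simp
  then show ?thesis using assms by (rule crec_comp2)
qed

lemma crec_minus:
  assumes "crec n F" "crec n G"
  shows "crec n (\<lambda>Q xs. F Q xs - G Q xs)"
proof -
  have "rec_nat 0 (\<lambda>i _. i) x = x - 1" for x by (cases x) auto
  moreover have "crec 1 (\<lambda>Q xs. rec_nat 0 (\<lambda>i _. i) (xs ! 0))"
    by (intro crec_rec crec_basic) auto
  ultimately have pred: "crec 1 (\<lambda>Q xs. xs ! 0 - 1)" by simp
  have "rec_nat x (\<lambda>_ z. z - 1) y = x - y" for x y by (induction y) auto
  moreover have "crec 2 (\<lambda>Q xs. rec_nat (xs ! 0) (\<lambda>_ z. z - 1) (xs ! 1))"
    by (intro crec_rec crec_basic crec_comp1[OF pred]) auto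
  ultimately have "crec 2 (\<lambda>Q xs. xs ! 0 - xs ! 1)" by simp
  then show ?thesis using assms by (rule crec_comp2)
qed

text \<open>The workhorse of this part: bounded quantifiers, counting and decoding are all expressed
  by bounded sums.\<close>

lemma crec_sum:
  assumes "crec n B" "crec (Suc n) (\<lambda>Q ys. P Q (tl ys) (ys ! 0))"
  shows "crec n (\<lambda>Q xs. \<Sum>i<B Q xs. P Q xs i)"
proof -
  have eq: "rec_nat 0 (\<lambda>i y. y + f i) b = (\<Sum>i<b. f i)" for f :: "nat \<Rightarrow> nat" and b
    by (induction b) auto
  have "crec (Suc (Suc n)) (\<lambda>Q ys. P Q (tl (tl ys)) (ys ! 0))"
    using crec_subst[OF assms(2), of 2 "\<lambda>Q ys. ys ! 0"] by (simp add: crec_nth numeral_2_eq_2 drop_Suc)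
  then have "crec n (\<lambda>Q xs. rec_nat 0 (\<lambda>i y. y + P Q xs i) (B Q xs))"
    by (intro crec_rec crec_basic crec_plus assms(1)) auto
  then show ?thesis by (simp add: eq)
qed

lemma crec_of_bool: "cpred n P \<Longrightarrow> crec n (\<lambda>Q xs. of_bool (P Q xs))"
  unfolding cpred_def .

lemma cpred_not:
  assumes "cpred n P"
  shows "cpred n (\<lambda>Q xs. \<not> P Q xs)"
proof -
  have "crec n (\<lambda>Q xs. 1 - of_bool (P Q xs))"
    using assms unfolding cpred_def by (intro crec_minus crec_const)
  then show ?thesis unfolding cpred_def by (rule crec_cong) simp
qed

lemma cpred_conj:
  assumes "cpred n P" "cpred n R"
  shows "cpred n (\<lambda>Q xs. P Q xs \<and> R Q xs)"
proof -
  have "crec n (\<lambda>Q xs. of_bool (P Q xs) * of_bool (R Q xs))"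
    using assms unfolding cpred_def by (rule crec_times)
  then show ?thesis unfolding cpred_def by (rule crec_cong) simp
qed

lemma cpred_le:
  assumes "crec n F" "crec n G"
  shows "cpred n (\<lambda>Q xs. F Q xs \<le> G Q xs)"
proof -
  have "crec n (\<lambda>Q xs. 1 - (F Q xs - G Q xs))"
    using assms by (intro crec_minus crec_const)
  then show ?thesis unfolding cpred_def by (rule crec_cong) simp
qed

lemma cpred_eq:
  assumes "crec n F" "crec n G"
  shows "cpred n (\<lambda>Q xs. F Q xs = G Q xs)"
proof -
  have "cpred n (\<lambda>Q xs. F Q xs \<le> G Q xs \<and> G Q xs \<le> F Q xs)"
    using assms by (intro cpred_conj cpred_le)
  then show ?thesis by (rule cpred_cong) auto
qed

lemma cpred_neq:
  assumes "crec n F" "crec n G"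
  shows "cpred n (\<lambda>Q xs. F Q xs \<noteq> G Q xs)"
  using assms by (intro cpred_not cpred_eq)

lemma cpred_xor:
  assumes "cpred n P" "cpred n R"
  shows "cpred n (\<lambda>Q xs. P Q xs \<noteq> R Q xs)"
proof -
  have "cpred n (\<lambda>Q xs. (of_bool (P Q xs) :: nat) \<noteq> of_bool (R Q xs))"
    using assms unfolding cpred_def[of n P] cpred_def[of n R] by (rule cpred_neq)
  then show ?thesis by (rule cpred_cong) simp
qed

lemma crec_if:
  assumes "cpred n P" "crec n F" "crec n G"
  shows "crec n (\<lambda>Q xs. if P Q xs then F Q xs else G Q xs)"
proof -
  have "crec n (\<lambda>Q xs. of_bool (P Q xs) * F Q xs + (1 - of_bool (P Q xs)) * G Q xs)"
    using assms unfolding cpred_def by (intro crec_plus crec_times crec_minus crec_const)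
  then show ?thesis by (rule crec_cong) simp
qed

lemma cpred_ex:
  assumes "crec n B" "cpred (Suc n) (\<lambda>Q ys. P Q (tl ys) (ys ! 0))"
  shows "cpred n (\<lambda>Q xs. \<exists>i<B Q xs. P Q xs i)"
proof -
  have "cpred n (\<lambda>Q xs. (\<Sum>i<B Q xs. of_bool (P Q xs i)) \<noteq> (0 :: nat))"
    using assms unfolding cpred_def[of "Suc n"] by (intro cpred_neq crec_sum crec_const)
  then show ?thesis by (rule cpred_cong) auto
qed

lemma cpred_all:
  assumes "crec n B" "cpred (Suc n) (\<lambda>Q ys. P Q (tl ys) (ys ! 0))"
  shows "cpred n (\<lambda>Q xs. \<forall>i<B Q xs. P Q xs i)"
proof -
  have "cpred n (\<lambda>Q xs. \<not> (\<exists>i<B Q xs. \<not> P Q xs i))"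
    by (intro cpred_not cpred_ex assms)
  then show ?thesis by (rule cpred_cong) auto
qed

lemmas crec_arith = crec_basic crec_plus crec_times crec_minus crec_power crec_sum crec_of_bool crec_if
  cpred_not cpred_conj cpred_le cpred_eq cpred_neq cpred_xor cpred_ex cpred_all

section \<open>Coded sets, pairs, lists and tuples\<close>

text \<open>States that bit \<open>x\<close> of \<open>n\<close> is set without division, by bounded
  quantifiers over computable arithmetic.\<close>

lemma set_decode_iff: "x \<in> set_decode n \<longleftrightarrow> (\<exists>q<Suc n. \<exists>r<2 ^ x. n = (2 * q + 1) * 2 ^ x + r)"
proof
  assume "x \<in> set_decode n"
  then have "odd (n div 2 ^ x)" by (simp add: set_decode_def)
  then obtain q where q: "n div 2 ^ x = 2 * q + 1" by (auto elim: oddE)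
  have "n = (n div 2 ^ x) * 2 ^ x + n mod 2 ^ x" by (rule div_mult_mod_eq[symmetric])
  then have n: "n = (2 * q + 1) * 2 ^ x + n mod 2 ^ x" unfolding q .
  have "q \<le> n div 2 ^ x" using q by simp
  also have "\<dots> \<le> n" by (rule div_le_dividend)
  finally have "q < Suc n" by simp
  moreover have "n mod 2 ^ x < 2 ^ x" by simp
  ultimately show "\<exists>q<Suc n. \<exists>r<2 ^ x. n = (2 * q + 1) * 2 ^ x + r" using n by blast
next
  assume "\<exists>q<Suc n. \<exists>r<2 ^ x. n = (2 * q + 1) * 2 ^ x + r"
  then obtain q r where r: "r < 2 ^ x" "n = (2 * q + 1) * 2 ^ x + r" by blast
  then have "n div 2 ^ x = 2 * q + 1" by (simp add: div_nat_eqI)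
  then show "x \<in> set_decode n" by (simp add: set_decode_def)
qed

lemma cpred_set_decode:
  assumes "crec n F" "crec n G"
  shows "cpred n (\<lambda>Q xs. F Q xs \<in> set_decode (G Q xs))"
proof -
  have "cpred 2 (\<lambda>Q xs. \<exists>q<Suc (xs ! 1). \<exists>r<2 ^ (xs ! 0). xs ! 1 = (2 * q + 1) * 2 ^ (xs ! 0) + r)"
    by (intro crec_arith) auto
  then have "cpred 2 (\<lambda>Q xs. xs ! 0 \<in> set_decode (xs ! 1))" by (simp add: set_decode_iff)
  then show ?thesis using assms by (rule cpred_comp2)
qed

text \<open>Turns quantifiers over coded sets into bounded quantifiers.\<close>

lemma set_decode_less: "x \<in> set_decode n \<Longrightarrow> x < n"
proof -
  assume "x \<in> set_decode n"
  then have "odd (n div 2 ^ x)" by (simp add: set_decode_def)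
  then have "2 ^ x \<le> n" by (metis div_less even_zero not_le)
  then show ?thesis using less_exp[of x] by linarith
qed

lemma cpred_bex_set_decode:
  assumes "crec n U" "cpred (Suc n) (\<lambda>Q ys. P Q (tl ys) (ys ! 0))"
  shows "cpred n (\<lambda>Q xs. \<exists>v\<in>set_decode (U Q xs). P Q xs v)"
proof -
  have "cpred n (\<lambda>Q xs. \<exists>v<U Q xs. v \<in> set_decode (U Q xs) \<and> P Q xs v)"
    by (intro cpred_ex cpred_conj cpred_set_decode crec_basic crec_tl assms) simp
  then show ?thesis by (rule cpred_cong) (auto dest: set_decode_less)
qed

lemma crec_prod_encode:
  assumes "crec n F" "crec n G"
  shows "crec n (\<lambda>Q xs. prod_encode (F Q xs, G Q xs))"
proof -
  have triangle: "triangle k = (\<Sum>i<Suc k. i)" for k by (induction k) auto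
  have "crec 2 (\<lambda>Q xs. (\<Sum>i<Suc (xs ! 0 + xs ! 1). i) + xs ! 0)"
    by (intro crec_arith) auto
  then have "crec 2 (\<lambda>Q xs. prod_encode (xs ! 0, xs ! 1))"
    by (simp only: prod_encode_def prod.case triangle)
  then show ?thesis using assms by (rule crec_comp2)
qed

text \<open>Components are at most as large as the code and the coding is injective, so the double
  sum runs over the right pair and only this pair contributes.\<close>

lemma prod_decode_sum:
  "fst (prod_decode n) = (\<Sum>x<Suc n. \<Sum>y<Suc n. if prod_encode (x, y) = n then x else 0)"
  "snd (prod_decode n) = (\<Sum>x<Suc n. \<Sum>y<Suc n. if prod_encode (x, y) = n then y else 0)"
proof -
  obtain a b where ab: "prod_decode n = (a, b)" by fastforce
  then have n: "n = prod_encode (a, b)" by (metis prod_decode_inverse)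
  have lt: "a < Suc n" "b < Suc n" using le_prod_encode_1[of a b] le_prod_encode_2[of b a] n by auto
  have "(\<Sum>x<Suc n. \<Sum>y<Suc n. if prod_encode (x, y) = n then g x y else 0) = g a b" for g :: "nat \<Rightarrow> nat \<Rightarrow> nat"
  proof -
    have "(\<Sum>x<Suc n. \<Sum>y<Suc n. if prod_encode (x, y) = n then g x y else 0) =
        (\<Sum>x<Suc n. \<Sum>y<Suc n. if x = a then (if y = b then g a b else 0) else 0)"
      by (intro sum.cong refl) (auto simp: n)
    also have "\<dots> = (\<Sum>x<Suc n. if x = a then (\<Sum>y<Suc n. if y = b then g a b else 0) else 0)"
      by (intro sum.cong refl) auto
    also have "\<dots> = g a b" using lt by (simp add: sum.delta del: sum.lessThan_Suc)
    finally show ?thesis .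
  qed
  note sums = this
  show "fst (prod_decode n) = (\<Sum>x<Suc n. \<Sum>y<Suc n. if prod_encode (x, y) = n then x else 0)"
    "snd (prod_decode n) = (\<Sum>x<Suc n. \<Sum>y<Suc n. if prod_encode (x, y) = n then y else 0)"
    unfolding ab fst_conv snd_conv by (rule sums[symmetric])+
qed

lemma crec_fst_prod_decode:
  assumes "crec n F"
  shows "crec n (\<lambda>Q xs. fst (prod_decode (F Q xs)))"
  by (rule crec_comp1[OF _ assms], unfold prod_decode_sum) (intro crec_arith crec_prod_encode; simp)

lemma crec_snd_prod_decode:
  assumes "crec n F"
  shows "crec n (\<lambda>Q xs. snd (prod_decode (F Q xs)))"
  by (rule crec_comp1[OF _ assms], unfold prod_decode_sum) (intro crec_arith crec_prod_encode; simp)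

lemmas crec_coding = crec_arith cpred_set_decode cpred_bex_set_decode crec_prod_encode
  crec_fst_prod_decode crec_snd_prod_decode

text \<open>The code of a nonempty list is the successor of the coded pair of head and tail. Being
  total, the function reads every number as a sequence, so a search may run through all
  numbers.\<close>

definition lnth :: "nat \<Rightarrow> nat \<Rightarrow> nat" where
  "lnth c i = fst (prod_decode (rec_nat c (\<lambda>_ z. snd (prod_decode (z - 1))) i - 1))"

lemma lnth_list_encode: "i < length xs \<Longrightarrow> lnth (list_encode xs) i = xs ! i"
proof -
  assume i: "i < length xs"
  have "i \<le> length xs \<Longrightarrow> rec_nat (list_encode xs) (\<lambda>_ z. snd (prod_decode (z - 1))) i = list_encode (drop i xs)"
  proof (induction i)
    case (Suc i)
    then have "drop i xs = xs ! i # drop (Suc i) xs" by (simp add: Cons_nth_drop_Suc)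
    with Suc show ?case by simp
  qed simp
  moreover have "drop i xs = xs ! i # drop (Suc i) xs" using i by (simp add: Cons_nth_drop_Suc)
  ultimately show ?thesis using i by (simp add: lnth_def)
qed

lemma crec_lnth:
  assumes "crec n F" "crec n G"
  shows "crec n (\<lambda>Q xs. lnth (F Q xs) (G Q xs))"
proof (rule crec_comp2[OF _ assms])
  show "crec 2 (\<lambda>Q xs. lnth (xs ! 0) (xs ! 1))"
    unfolding lnth_def by (intro crec_rec crec_coding) auto
qed

text \<open>The head is the outermost part of the code, so the recursion builds the list from its
  last entry, prepending entry \<open>M - Suc i\<close> in step \<open>i\<close>.\<close>

lemma crec_list_encode_upt:
  assumes "crec n M" "crec (Suc n) (\<lambda>Q ys. P Q (tl ys) (ys ! 0))"
  shows "crec n (\<lambda>Q xs. list_encode (map (P Q xs) [0..<M Q xs]))"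
proof -
  have "j \<le> m \<Longrightarrow> rec_nat 0 (\<lambda>i y. Suc (prod_encode (f (m - Suc i), y))) j = list_encode (map f [m - j..<m])"
    for f m j
  proof (induction j)
    case (Suc j)
    then have "[m - Suc j..<m] = (m - Suc j) # [m - j..<m]"
      by (simp add: upt_conv_Cons Suc_diff_Suc)
    with Suc show ?case by simp
  qed simp
  from this[of m m for m] have eq: "rec_nat 0 (\<lambda>i y. Suc (prod_encode (f (m - Suc i), y))) m =
      list_encode (map f [0..<m])" for f m by simp
  have "crec (Suc (Suc n)) (\<lambda>Q ys. M Q (tl (tl ys)) - Suc (ys ! 0))"
    by (intro crec_minus crec_basic crec_tl assms(1)) simp
  then have "crec (Suc (Suc n)) (\<lambda>Q ys. P Q (tl (tl ys)) (M Q (tl (tl ys)) - Suc (ys ! 0)))"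
    using crec_subst[OF assms(2), of 2 "\<lambda>Q ys. M Q (tl (tl ys)) - Suc (ys ! 0)"]
    by (simp add: numeral_2_eq_2 drop_Suc)
  then have "crec n (\<lambda>Q xs. rec_nat 0 (\<lambda>i y. Suc (prod_encode (P Q xs (M Q xs - Suc i), y))) (M Q xs))"
    by (intro crec_rec crec_basic crec_prod_encode assms(1)) auto
  then show ?thesis by (simp only: eq)
qed

lemma crec_list_encode_map:
  assumes "\<forall>v\<in>set vs. crec n (\<lambda>Q xs. E Q xs v)"
  shows "crec n (\<lambda>Q xs. list_encode (map (E Q xs) vs))"
  using assms by (induction vs) (auto intro: crec_const crec_Suc crec_prod_encode)

text \<open>One bounded quantifier per component. Later binders are placed in front, so the
  component bound first becomes the last one of the tuple.\<close>

lemma cpred_tuples: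
  assumes U: "crec n U" and P: "cpred (r + n) (\<lambda>Q ys. P Q (drop r ys) (take r ys))"
  shows "cpred n (\<lambda>Q xs. \<exists>a\<in>tuples (set_decode (U Q xs)) r. P Q xs a)"
  using assms
proof (induction r arbitrary: n U P)
  case 0
  have "tuples V 0 = {[]}" for V by (auto simp: tuples_def)
  with 0 show ?case by simp
next
  case (Suc r)
  have "cpred (r + Suc n) (\<lambda>Q ys. P Q (tl (drop r ys)) (take r ys @ [drop r ys ! 0]))"
  proof (rule cpred_cong)
    show "cpred (r + Suc n) (\<lambda>Q ys. P Q (drop (Suc r) ys) (take (Suc r) ys))"
      using Suc.prems(2) by simp
    show "P Q (drop (Suc r) ys) (take (Suc r) ys) = P Q (tl (drop r ys)) (take r ys @ [drop r ys ! 0])"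
      if "length ys = r + Suc n" for Q and ys :: "nat list"
      using that by (simp add: take_Suc_conv_app_nth drop_Suc tl_drop)
  qed
  from Suc.IH[OF crec_tl[OF Suc.prems(1)], of "\<lambda>Q zs a. P Q (tl zs) (a @ [zs ! 0])", OF this]
  have "cpred n (\<lambda>Q xs. \<exists>v\<in>set_decode (U Q xs). \<exists>a\<in>tuples (set_decode (U Q xs)) r. P Q xs (a @ [v]))"
    by (intro cpred_bex_set_decode Suc.prems(1)) simp
  moreover have "(\<exists>v\<in>V. \<exists>a\<in>tuples V r. R (a @ [v])) \<longleftrightarrow> (\<exists>a\<in>tuples V (Suc r). R a)" for V R
  proof
    assume "\<exists>a\<in>tuples V (Suc r). R a"
    then obtain a where a: "length a = Suc r" "set a \<subseteq> V" "R a" by (auto simp: tuples_def)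
    then obtain b v where "a = b @ [v]" by (metis length_0_conv nat.distinct(1) rev_exhaust)
    with a have "v \<in> V" "b \<in> tuples V r" "R (b @ [v])" by (auto simp: tuples_def)
    then show "\<exists>v\<in>V. \<exists>a\<in>tuples V r. R (a @ [v])" by blast
  qed (fastforce simp: tuples_def)
  ultimately show ?case by simp
qed

text \<open>The only use of unbounded search. It halts on inputs that have a witness, hence the
  statement about single inputs in place of \<open>crec\<close>.\<close>

lemma computes_least:
  assumes "cpred (Suc n) P"
  shows "\<exists>p. \<forall>Q xs i. length xs = n \<longrightarrow> P Q (i # xs) \<longrightarrow> computes Q p xs (LEAST i. P Q (i # xs))"
proof -
  have "crec (Suc n) (\<lambda>Q ys. 1 - of_bool (P Q ys))"
    using assms unfolding cpred_def by (intro crec_minus crec_const)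
  then obtain p where p: "\<And>Q ys. length ys = Suc n \<Longrightarrow> computes Q p ys (1 - of_bool (P Q ys))"
    unfolding crec_def by blast
  have "computes Q (Mu p) xs (LEAST i. P Q (i # xs))" if "length xs = n" "P Q (i # xs)" for Q xs i
  proof (rule computes.Mu)
    have "P Q ((LEAST i. P Q (i # xs)) # xs)" using that(2) by (rule LeastI)
    then show "computes Q p ((LEAST i. P Q (i # xs)) # xs) 0" using p[of "(LEAST i. P Q (i # xs)) # xs" Q] that(1) by simp
    show "\<forall>m<LEAST i. P Q (i # xs). \<exists>y. computes Q p (m # xs) (Suc y)"
    proof (intro allI impI)
      fix m assume "m < (LEAST i. P Q (i # xs))"
      then have "\<not> P Q (m # xs)" by (rule not_less_Least)
      then show "\<exists>y. computes Q p (m # xs) (Suc y)"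
        using p[of "m # xs" Q] that(1) by (intro exI[of _ 0]) simp
    qed
  qed
  then show ?thesis by blast
qed

section \<open>Evaluating formulas on codes\<close>

primrec csat :: "nat \<Rightarrow> (nat \<Rightarrow> nat) \<Rightarrow> formula \<Rightarrow> bool" where
  "csat g \<sigma> (Rel i xs) \<longleftrightarrow> list_encode (map \<sigma> xs) \<in> set_decode (lnth (snd (prod_decode g)) i)"
| "csat g \<sigma> (Eq x y) \<longleftrightarrow> \<sigma> x = \<sigma> y"
| "csat g \<sigma> (Neg \<phi>) \<longleftrightarrow> \<not> csat g \<sigma> \<phi>"
| "csat g \<sigma> (Conj \<phi> \<chi>) \<longleftrightarrow> csat g \<sigma> \<phi> \<and> csat g \<sigma> \<chi>"
| "csat g \<sigma> (Ex x \<phi>) \<longleftrightarrow> (\<exists>v\<in>set_decode (fst (prod_decode g)). csat g (\<sigma>(x := v)) \<phi>)"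

lemma csat_struct_code:
  assumes "finite_structure \<tau> G" "well_formed \<tau> \<phi>"
  shows "csat (struct_code G) \<sigma> \<phi> \<longleftrightarrow> sat G \<sigma> \<phi>"
  using assms(2)
proof (induction \<phi> arbitrary: \<sigma>)
  case (Rel i xs)
  have fin: "finite (rels G ! i)"
  proof (rule finite_subset)
    show "rels G ! i \<subseteq> {t. set t \<subseteq> univ G \<and> length t = \<tau> ! i}"
      using assms(1) Rel unfolding finite_structure_def tuples_def by auto
    show "finite {t. set t \<subseteq> univ G \<and> length t = \<tau> ! i}"
      using assms(1) unfolding finite_structure_def by (intro finite_lists_length_eq) auto
  qed
  have "i < length (rels G)" using assms(1) Rel unfolding finite_structure_def by simp
  then have "lnth (snd (prod_decode (struct_code G))) i = set_encode (list_encode ` (rels G ! i))"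
    by (simp add: struct_code_def lnth_list_encode)
  then show ?case using fin by (auto simp: inj_image_mem_iff[OF inj_list_encode])
next
  case (Ex x \<phi>)
  have "set_decode (fst (prod_decode (struct_code G))) = univ G"
    using assms(1) by (simp add: struct_code_def finite_structure_def)
  with Ex show ?case by simp
qed auto

text \<open>The formula is fixed, so its program is assembled by recursion on it. The valuation is
  one computable function per variable, as bound values arrive as additional arguments.\<close>

lemma cpred_csat:
  assumes "crec n G" "\<forall>v. crec n (\<lambda>Q xs. E Q xs v)"
  shows "cpred n (\<lambda>Q xs. csat (G Q xs) (E Q xs) \<phi>)"
  using assms
proof (induction \<phi> arbitrary: n G E)
  case (Rel i vs)
  then show ?case unfolding csat.simps
    by (intro cpred_set_decode crec_list_encode_map crec_lnth crec_snd_prod_decode crec_const) auto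
next
  case (Ex x \<phi>)
  have "cpred (Suc n) (\<lambda>Q ys. csat (G Q (tl ys)) ((E Q (tl ys))(x := ys ! 0)) \<phi>)"
  proof (rule Ex.IH)
    show "crec (Suc n) (\<lambda>Q ys. G Q (tl ys))" using Ex.prems(1) by (rule crec_tl)
    show "\<forall>v. crec (Suc n) (\<lambda>Q ys. ((E Q (tl ys))(x := ys ! 0)) v)"
    proof
      fix v
      show "crec (Suc n) (\<lambda>Q ys. ((E Q (tl ys))(x := ys ! 0)) v)"
        using crec_tl[OF Ex.prems(2)[rule_format, of v]] by (cases "v = x") (simp_all add: crec_nth)
    qed
  qed
  then show ?case unfolding csat.simps
    by (intro cpred_bex_set_decode crec_fst_prod_decode Ex.prems(1))
qed (auto intro: cpred_eq cpred_not cpred_conj)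

section \<open>The marker and the detector\<close>

text \<open>A computable inverse of the polynomial: \<open>j\<close> is counted if \<open>n\<close>
  elements suffice for \<open>j + 1\<close> bits. For positive \<open>c\<close> and \<open>k\<close>
  the range \<open>j < n\<close> cuts off nothing.\<close>

definition mark_size :: "nat \<Rightarrow> nat \<Rightarrow> nat \<Rightarrow> nat" where
  "mark_size c k n = (\<Sum>j<n. of_bool (c * (j + 2) ^ k \<le> n))"

lemma mark_size_card: "mark_size c k n = card {j. j < n \<and> c * (j + 2) ^ k \<le> n}"
proof -
  have "{..<n} \<inter> {j. c * (j + 2) ^ k \<le> n} = {j. j < n \<and> c * (j + 2) ^ k \<le> n}" by auto
  then show ?thesis by (simp add: mark_size_def)
qed

text \<open>If the bound failed for the count \<open>m\<close>, only indices with
  \<open>j + 2 < m + 1\<close> would be counted, fewer than \<open>m\<close>. For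
  \<open>m = 0\<close> it may indeed fail, namely if \<open>n < c\<close>.\<close>

lemma mark_size_upper:
  assumes "0 < mark_size c k n"
  shows "c * (mark_size c k n + 1) ^ k \<le> n"
proof (rule ccontr)
  let ?m = "mark_size c k n"
  let ?J = "{j. j < n \<and> c * (j + 2) ^ k \<le> n}"
  assume contr: "\<not> ?thesis"
  have "j < ?m - 1" if "j \<in> ?J" for j
  proof (rule ccontr)
    assume "\<not> j < ?m - 1"
    then have "(?m + 1) ^ k \<le> (j + 2) ^ k" by (intro power_mono) auto
    then have "c * (?m + 1) ^ k \<le> c * (j + 2) ^ k" by (rule mult_le_mono2)
    moreover have "c * (j + 2) ^ k \<le> n" using that by blast
    ultimately show False using contr by linarith
  qed
  then have "card ?J \<le> card {..<?m - 1}" by (intro card_mono) auto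
  with assms show False by (simp add: mark_size_card)
qed

lemma mark_size_lower:
  assumes "c * t ^ k \<le> n" "1 \<le> c" "1 \<le> k"
  shows "t - 1 \<le> mark_size c k n"
proof -
  have "{..<t - 1} \<subseteq> {j. j < n \<and> c * (j + 2) ^ k \<le> n}"
  proof
    fix j assume "j \<in> {..<t - 1}"
    then have j: "j + 2 \<le> t" by simp
    have "c * (j + 2) ^ k \<le> c * t ^ k" using j by (intro mult_le_mono2 power_mono) auto
    moreover have "t * 1 \<le> t ^ k * c"
      using assms(2,3) j self_le_power[of t k] by (intro mult_le_mono) auto
    then have "t \<le> c * t ^ k" by (simp add: mult.commute)
    ultimately have "c * (j + 2) ^ k \<le> n" "j < n" using assms(1) j by linarith+
    then show "j \<in> {j. j < n \<and> c * (j + 2) ^ k \<le> n}" by blast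
  qed
  then have "card {..<t - 1} \<le> card {j. j < n \<and> c * (j + 2) ^ k \<le> n}" by (intro card_mono) auto
  then show ?thesis by (simp add: mark_size_card)
qed

lemma scalable_mark_size:
  assumes "1 \<le> c" "1 \<le> k"
  shows "scalable (mark_size c k)"
  unfolding scalable_def
proof (intro exI[of _ "1 / real k"] conjI)
  show "1 / real k > 0" using assms by simp
  let ?e = "1 / real k"
  \<comment> \<open>Half of the ideal factor, to absorb the rounding down and the loss of one in
    \<open>t - 1\<close>.\<close>
  let ?a = "1 / (2 * real c powr ?e)"
  \<comment> \<open>From \<open>c * 4 ^ k\<close> on, the root \<open>x\<close> is at least
    \<open>4\<close>, so that \<open>x - 2\<close> is at least \<open>x / 2\<close>.\<close>
  have "?a * norm (real n powr ?e) \<le> norm (real (mark_size c k n))" if n: "c * 4 ^ k \<le> n" for n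
  proof -
    define x where "x = (real n / real c) powr ?e"
    have c: "real c > 0" using assms(1) by simp
    have n0: "real n > 0"
    proof -
      have "0 < c * 4 ^ k" using assms(1) by simp
      then show ?thesis using n by linarith
    qed
    have xk: "x ^ k = real n / real c"
    proof -
      have "x ^ k = x powr real k" using n0 c by (simp add: x_def powr_realpow)
      also have "\<dots> = (real n / real c) powr (?e * real k)" unfolding x_def by (rule powr_powr)
      also have "\<dots> = real n / real c" using assms(2) n0 c by simp
      finally show ?thesis .
    qed
    have x0: "0 \<le> x" by (simp add: x_def)
    have x4: "4 \<le> x"
    proof (rule ccontr)
      assume "\<not> 4 \<le> x"
      then have "x ^ k < 4 ^ k" using x0 assms(2) by (intro power_strict_mono) auto
      moreover have "real c * 4 ^ k \<le> real n" using n of_nat_mono[OF n, where 'a = real] by simp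
      ultimately show False using c xk by (simp add: field_simps)
    qed
    define t where "t = nat \<lfloor>x\<rfloor>"
    have t: "real t \<le> x" "x < real t + 1" using x0 unfolding t_def by linarith+
    have "real t ^ k \<le> real n / real c" using power_mono[OF t(1), of k] xk by simp
    then have "real (c * t ^ k) \<le> real n" using c by (simp add: field_simps)
    then have "t - 1 \<le> mark_size c k n" using assms by (intro mark_size_lower) (auto simp only: of_nat_le_iff)
    then have "x / 2 \<le> real (mark_size c k n)" using t x4 by linarith
    moreover have "x = real n powr ?e / real c powr ?e" using n0 c by (simp add: x_def powr_divide)
    ultimately show ?thesis by simp
  qed
  then have "eventually (\<lambda>n. ?a * norm (real n powr ?e) \<le> norm (real (mark_size c k n))) at_top"
    using eventually_ge_at_top by (rule eventually_mono[rotated])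
  then show "(\<lambda>n. real (mark_size c k n)) \<in> \<Omega>(\<lambda>n. real n powr ?e)"
    using assms(1) by (intro landau_omega.bigI[of ?a]) auto
qed

section \<open>The marker and the detector as functions on codes\<close>

definition univ_code :: "nat \<Rightarrow> nat" where
  "univ_code w = fst (prod_decode (fst (prod_decode w)))"

definition coutput :: "nat \<Rightarrow> formula \<Rightarrow> nat \<Rightarrow> nat list \<Rightarrow> nat \<Rightarrow> bool" where
  "coutput r \<psi> w a b \<longleftrightarrow> b \<in> set_decode (univ_code w) \<and>
     csat (fst (prod_decode w)) (\<lambda>i. if i < r then a ! i else b) \<psi>"

definition cactive :: "nat \<Rightarrow> formula \<Rightarrow> nat \<Rightarrow> nat \<Rightarrow> bool" where
  "cactive r \<psi> w b \<longleftrightarrow> (\<exists>a\<in>tuples (set_decode (univ_code w)) r. coutput r \<psi> w a b)"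

text \<open>Elements of the universe are smaller than its code, which thus bounds the sum that
  counts the active elements.\<close>

definition cmark_size :: "nat \<Rightarrow> nat \<Rightarrow> nat \<Rightarrow> formula \<Rightarrow> nat \<Rightarrow> nat" where
  "cmark_size c k r \<psi> w = mark_size c k (\<Sum>b<univ_code w. of_bool (cactive r \<psi> w b))"

text \<open>The condition that the search tests. The weights in \<open>w\<close> do not enter it.
  The universal quantifier over tuples is a negated existential one, the form for which
  computability is shown; the sum counts the separated pairs.\<close>

definition valid_pairs :: "nat \<Rightarrow> nat \<Rightarrow> nat \<Rightarrow> formula \<Rightarrow> nat \<Rightarrow> nat \<Rightarrow> bool" where
  "valid_pairs c k r \<psi> w p \<longleftrightarrow>
     (\<forall>i<2 * cmark_size c k r \<psi> w. cactive r \<psi> w (lnth p i)) \<and>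
     (\<forall>i<2 * cmark_size c k r \<psi> w. \<forall>j<i. lnth p i \<noteq> lnth p j) \<and>
     \<not> (\<exists>a\<in>tuples (set_decode (univ_code w)) r. \<not> (\<Sum>i<cmark_size c k r \<psi> w.
          of_bool (coutput r \<psi> w a (lnth p (2 * i)) \<noteq> coutput r \<psi> w a (lnth p (Suc (2 * i))))) \<le> r)"

text \<open>The sum has at most one nonzero term if \<open>wc\<close> codes a weight function; an
  element without a weight gets \<open>0\<close>.\<close>

definition weight :: "nat \<Rightarrow> nat \<Rightarrow> nat" where
  "weight wc b = (\<Sum>v<wc. if prod_encode (b, v) \<in> set_decode wc then v else 0)"

text \<open>The first member of a pair with bit \<open>1\<close> is raised and the second is
  lowered. Natural subtraction is exact here, as only active elements are lowered and these have
  positive weights.\<close>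

definition new_weight :: "nat \<Rightarrow> nat \<Rightarrow> nat \<Rightarrow> nat \<Rightarrow> nat \<Rightarrow> nat" where
  "new_weight m wc mu p b = weight wc b + of_bool (\<exists>i<m. lnth mu i = 1 \<and> lnth p (2 * i) = b)
     - of_bool (\<exists>i<m. lnth mu i = 1 \<and> lnth p (Suc (2 * i)) = b)"

text \<open>A coded set is the sum of the powers of two of its elements, so the new graph is written
  down term by term.\<close>

definition new_weights_code :: "nat \<Rightarrow> nat \<Rightarrow> nat \<Rightarrow> nat \<Rightarrow> nat" where
  "new_weights_code m wc mu p = (\<Sum>b<wc. if \<exists>v<wc. prod_encode (b, v) \<in> set_decode wc
     then 2 ^ prod_encode (b, new_weight m wc mu p b) else 0)"

definition marked_code :: "nat \<Rightarrow> nat \<Rightarrow> nat \<Rightarrow> formula \<Rightarrow> nat \<Rightarrow> nat \<Rightarrow> nat \<Rightarrow> nat" where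
  "marked_code c k r \<psi> w mu p = prod_encode (fst (prod_decode w),
     new_weights_code (cmark_size c k r \<psi> w) (snd (prod_decode w)) mu p)"

text \<open>Bit \<open>i\<close> is \<open>1\<close> if some answer lists the first member of pair
  \<open>i\<close> with its original weight plus one. This member is active, so at least one query
  shows its weight.\<close>

definition read_mark :: "nat \<Rightarrow> nat \<Rightarrow> nat \<Rightarrow> formula \<Rightarrow> (nat \<Rightarrow> nat) \<Rightarrow> nat \<Rightarrow> nat \<Rightarrow> nat" where
  "read_mark c k r \<psi> Q w p = list_encode (map (\<lambda>i. of_bool (\<exists>a\<in>tuples (set_decode (univ_code w)) r.
     prod_encode (lnth p (2 * i), Suc (weight (snd (prod_decode w)) (lnth p (2 * i))))
       \<in> set_decode (Q (list_encode a)))) [0..<cmark_size c k r \<psi> w])"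

section \<open>Computability of these functions\<close>

lemma crec_univ_code: "crec n W \<Longrightarrow> crec n (\<lambda>Q xs. univ_code (W Q xs))"
  unfolding univ_code_def by (intro crec_fst_prod_decode)

lemma cpred_coutput:
  assumes "crec n W" "\<forall>j<r. crec n (\<lambda>Q xs. A Q xs ! j)" "crec n B"
  shows "cpred n (\<lambda>Q xs. coutput r \<psi> (W Q xs) (A Q xs) (B Q xs))"
proof -
  have "crec n (\<lambda>Q xs. if v < r then A Q xs ! v else B Q xs)" for v
    using assms by (cases "v < r") auto
  then show ?thesis unfolding coutput_def
    by (intro cpred_conj cpred_set_decode cpred_csat crec_fst_prod_decode crec_univ_code allI assms)
qed

lemma crec_take_nth: "j < r \<Longrightarrow> r \<le> n \<Longrightarrow> crec n (\<lambda>Q xs. take r xs ! j)"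
  by (rule crec_cong[OF crec_nth[of j]]) auto

lemma cpred_cactive:
  assumes "crec n W" "crec n B"
  shows "cpred n (\<lambda>Q xs. cactive r \<psi> (W Q xs) (B Q xs))"
  unfolding cactive_def
  by (intro cpred_tuples crec_univ_code cpred_coutput crec_drop allI impI crec_take_nth assms) auto

lemma crec_cmark_size:
  assumes "crec n W"
  shows "crec n (\<lambda>Q xs. cmark_size c k r \<psi> (W Q xs))"
proof -
  have "crec 1 (\<lambda>Q xs. \<Sum>j<xs ! 0. of_bool (c * (j + 2) ^ k \<le> xs ! 0))"
    by (intro crec_coding) auto
  then have size: "crec 1 (\<lambda>Q xs. mark_size c k (xs ! 0))" by (simp add: mark_size_def)
  show ?thesis unfolding cmark_size_def
    by (intro crec_comp1[OF size] crec_sum crec_of_bool cpred_cactive crec_univ_code crec_tl crec_nth assms) simp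
qed

lemma cpred_valid_pairs:
  assumes W: "crec n W" and P: "crec n P"
  shows "cpred n (\<lambda>Q xs. valid_pairs c k r \<psi> (W Q xs) (P Q xs))"
proof -
  have take: "\<forall>j<r. crec (Suc (r + n)) (\<lambda>Q xs. take r (tl xs) ! j)"
    by (intro allI impI, rule crec_tl[OF crec_take_nth]; simp)
  have out: "cpred (Suc (r + n)) (\<lambda>Q ys. coutput r \<psi> (W Q (drop r (tl ys))) (take r (tl ys)) (L Q ys))"
    if "crec (Suc (r + n)) L" for L
    by (intro cpred_coutput take that crec_tl crec_drop W)
  have nth: "crec (Suc (r + n)) (\<lambda>Q ys. lnth (P Q (drop r (tl ys))) (2 * ys ! 0))"
    "crec (Suc (r + n)) (\<lambda>Q ys. lnth (P Q (drop r (tl ys))) (Suc (2 * ys ! 0)))"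
    by (intro crec_lnth crec_Suc crec_times crec_const crec_nth crec_tl crec_drop P; simp)+
  have "cpred n (\<lambda>Q xs. \<exists>a\<in>tuples (set_decode (univ_code (W Q xs))) r. \<not> (\<Sum>i<cmark_size c k r \<psi> (W Q xs).
          of_bool (coutput r \<psi> (W Q xs) a (lnth (P Q xs) (2 * i)) \<noteq>
            coutput r \<psi> (W Q xs) a (lnth (P Q xs) (Suc (2 * i))))) \<le> r)"
    by (intro cpred_tuples crec_univ_code W cpred_not cpred_le crec_const crec_sum crec_cmark_size
        crec_of_bool cpred_xor out nth crec_drop)
  then show ?thesis unfolding valid_pairs_def
    by (intro cpred_conj cpred_not cpred_all crec_times crec_const crec_cmark_size cpred_cactive
        cpred_neq crec_lnth crec_nth crec_nth_tl crec_tl W P) auto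
qed

lemma crec_weight:
  assumes "crec n W" "crec n B"
  shows "crec n (\<lambda>Q xs. weight (W Q xs) (B Q xs))"
  unfolding weight_def by (intro crec_sum crec_if crec_coding crec_tl assms) auto

lemma crec_new_weight:
  assumes "crec n M" "crec n W" "crec n U" "crec n P" "crec n B"
  shows "crec n (\<lambda>Q xs. new_weight (M Q xs) (W Q xs) (U Q xs) (P Q xs) (B Q xs))"
  unfolding new_weight_def
  by (intro crec_minus crec_plus crec_weight crec_of_bool cpred_ex cpred_conj cpred_eq crec_lnth
      crec_times crec_Suc crec_const crec_nth crec_tl assms) auto

lemma crec_marked_code:
  assumes "crec n W" "crec n U" "crec n P"
  shows "crec n (\<lambda>Q xs. marked_code c k r \<psi> (W Q xs) (U Q xs) (P Q xs))"
  unfolding marked_code_def new_weights_code_def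
  by (intro crec_prod_encode crec_sum crec_if cpred_ex cpred_set_decode crec_power crec_new_weight
      crec_cmark_size crec_fst_prod_decode crec_snd_prod_decode crec_const crec_nth crec_nth_tl crec_tl assms) auto

lemma crec_read_mark:
  assumes W: "crec n W" and P: "crec n P"
  shows "crec n (\<lambda>Q xs. read_mark c k r \<psi> Q (W Q xs) (P Q xs))"
proof -
  have enc: "crec (r + Suc n) (\<lambda>Q ys. list_encode (take r ys))"
  proof (rule crec_cong)
    show "crec (r + Suc n) (\<lambda>Q ys. list_encode (map ((!) ys) [0..<r]))"
      by (intro crec_list_encode_map) (auto intro: crec_nth)
    show "list_encode (map ((!) ys) [0..<r]) = list_encode (take r ys)"
      if "length ys = r + Suc n" for ys :: "nat list"
      using that by (intro arg_cong[where f = list_encode] nth_equalityI) auto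
  qed
  have idx: "crec (r + Suc n) (\<lambda>Q ys. lnth (P Q (tl (drop r ys))) (2 * (drop r ys ! 0)))"
    by (intro crec_drop[where F = "\<lambda>Q zs. lnth (P Q (tl zs)) (2 * zs ! 0)"] crec_lnth crec_tl
        crec_times crec_const crec_nth P) simp
  have wt: "crec (r + Suc n) (\<lambda>Q ys. snd (prod_decode (W Q (tl (drop r ys)))))"
    by (intro crec_drop[where F = "\<lambda>Q zs. snd (prod_decode (W Q (tl zs)))"] crec_tl
        crec_snd_prod_decode W)
  show ?thesis unfolding read_mark_def
    by (intro crec_list_encode_upt crec_cmark_size W crec_of_bool cpred_tuples crec_univ_code crec_tl
        cpred_set_decode crec_prod_encode crec_Suc crec_weight crec_ask enc idx wt)
qed


section \<open>Correctness of these functions on codes of structures\<close>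

lemma mem_weights_code:
  assumes "finite (dom W)"
  shows "prod_encode (b, v) \<in> set_decode (weights_code W) \<longleftrightarrow> W b = Some v"
proof -
  have "{prod_encode (b, w) |b w. W b = Some w} = (\<lambda>b. prod_encode (b, the (W b))) ` dom W"
    by force
  then have "finite {prod_encode (b, w) |b w. W b = Some w}" using assms by simp
  then have "set_decode (weights_code W) = {prod_encode (b, w) |b w. W b = Some w}"
    unfolding weights_code_def by (rule set_encode_inverse)
  then show ?thesis by (auto simp: prod_encode_eq)
qed

lemma weight_less:
  assumes "finite (dom W)" "W b = Some v"
  shows "b < weights_code W" "v < weights_code W"
proof -
  have "prod_encode (b, v) \<in> set_decode (weights_code W)" using mem_weights_code assms by blast
  then have "prod_encode (b, v) < weights_code W" by (rule set_decode_less)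
  then show "b < weights_code W" "v < weights_code W"
    using le_prod_encode_1[of b v] le_prod_encode_2[of v b] by linarith+
qed

lemma weight_weights_code:
  assumes "finite (dom W)" "W b = Some v"
  shows "weight (weights_code W) b = v"
proof -
  have "weight (weights_code W) b = (\<Sum>u<weights_code W. if u = v then v else 0)"
    unfolding weight_def using assms(2) by (intro sum.cong refl) (auto simp: mem_weights_code[OF assms(1)])
  then show ?thesis using weight_less(2)[OF assms] by (simp add: sum.delta)
qed

lemma new_weights_code_eq:
  assumes fin: "finite (dom W)" and dom: "dom W' = dom W"
    and new: "\<And>b. b \<in> dom W \<Longrightarrow> the (W' b) = new_weight m (weights_code W) mu p b"
  shows "new_weights_code m (weights_code W) mu p = weights_code W'"
proof -
  let ?code = "\<lambda>b. prod_encode (b, the (W' b))"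
  have ex: "(\<exists>v<weights_code W. prod_encode (b, v) \<in> set_decode (weights_code W)) \<longleftrightarrow> b \<in> dom W" for b
    using mem_weights_code[OF fin] weight_less(2)[OF fin] by auto
  have "new_weights_code m (weights_code W) mu p =
      (\<Sum>b<weights_code W. if b \<in> dom W then 2 ^ ?code b else 0)"
    unfolding new_weights_code_def ex by (intro sum.cong refl) (simp add: new)
  also have "\<dots> = (\<Sum>b\<in>{..<weights_code W} \<inter> dom W. 2 ^ ?code b)"
    by (simp add: sum.inter_restrict)
  also have "{..<weights_code W} \<inter> dom W = dom W" using weight_less(1)[OF fin] by auto
  also have "(\<Sum>b\<in>dom W. 2 ^ ?code b) = (\<Sum>x\<in>?code ` dom W. 2 ^ x)"
    by (subst sum.reindex) (auto intro: inj_onI simp: prod_encode_eq)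
  also have "?code ` dom W = {prod_encode (b, w) |b w. W' b = Some w}" using dom by force
  finally show ?thesis by (simp add: weights_code_def set_encode_def)
qed

lemma sum_of_bool_image:
  assumes "finite X" "finite I" "inj_on h I"
  shows "(\<Sum>x\<in>X. of_bool (\<exists>i\<in>I. h i = x) :: int) = (\<Sum>i\<in>I. of_bool (h i \<in> X))"
proof -
  have "card (X \<inter> {x. \<exists>i\<in>I. h i = x}) = card (h ` (I \<inter> {i. h i \<in> X}))"
    by (rule arg_cong[where f = card]) auto
  also have "\<dots> = card (I \<inter> {i. h i \<in> X})"
    using assms(3) by (intro card_image) (auto intro: inj_on_subset)
  finally show ?thesis using assms(1,2) by simp
qed

text \<open>A pair contributes one raised and one lowered weight. Both occur in the sum or neither
  does, unless \<open>X\<close> splits the pair, so everything else cancels.\<close>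

lemma pair_distortion:
  assumes "finite X" "inj_on b {..<2 * m}" "I \<subseteq> {..<m}"
  shows "\<bar>\<Sum>x\<in>X. of_bool (\<exists>i\<in>I. b (2 * i) = x) - of_bool (\<exists>i\<in>I. b (Suc (2 * i)) = x) :: int\<bar>
    \<le> int (card (split_pairs m b X))"
proof -
  let ?h = "\<lambda>i. b (2 * i)" and ?h' = "\<lambda>i. b (Suc (2 * i))"
  have fI: "finite I" using assms(3) finite_subset by blast
  have inj: "inj_on ?h I" "inj_on ?h' I"
    using assms(3) by (auto intro!: inj_onI dest!: inj_onD[OF assms(2)])
  have "(\<Sum>x\<in>X. of_bool (\<exists>i\<in>I. ?h i = x) - of_bool (\<exists>i\<in>I. ?h' i = x) :: int) =
      (\<Sum>i\<in>I. of_bool (?h i \<in> X) - of_bool (?h' i \<in> X))"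
    using assms(1) fI inj by (simp add: sum_subtractf sum_of_bool_image del: sum_of_bool_eq)
  also have "\<bar>\<dots>\<bar> \<le> (\<Sum>i\<in>I. \<bar>of_bool (?h i \<in> X) - of_bool (?h' i \<in> X) :: int\<bar>)"
    by (rule sum_abs)
  also have "\<dots> = (\<Sum>i\<in>I. of_bool ((?h i \<in> X) \<noteq> (?h' i \<in> X)))"
    by (intro sum.cong refl) auto
  also have "\<dots> \<le> (\<Sum>i<m. of_bool ((?h i \<in> X) \<noteq> (?h' i \<in> X)))"
    using assms(3) by (intro sum_mono2) auto
  also have "\<dots> = int (card (split_pairs m b X))"
  proof -
    have "{..<m} \<inter> {i. (?h i \<in> X) \<noteq> (?h' i \<in> X)} = split_pairs m b X" by (auto simp: split_pairs_def)
    then show ?thesis by simp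
  qed
  finally show ?thesis .
qed

lemma set_decode_univ_code:
  "finite_structure \<tau> G \<Longrightarrow> set_decode (univ_code (weighted_code G W)) = univ G"
  by (simp add: univ_code_def weighted_code_def struct_code_def finite_structure_def)

lemma coutput_weighted_code:
  assumes "finite_structure \<tau> G" "well_formed \<tau> \<psi>"
  shows "coutput r \<psi> (weighted_code G W) a b \<longleftrightarrow> b \<in> query_output r \<psi> G a"
proof -
  have "fst (prod_decode (weighted_code G W)) = struct_code G" by (simp add: weighted_code_def)
  then show ?thesis
    by (simp add: coutput_def query_output_def set_decode_univ_code[OF assms(1)] csat_struct_code[OF assms])
qed

lemma cactive_weighted_code:
  assumes "finite_structure \<tau> G" "well_formed \<tau> \<psi>"
  shows "cactive r \<psi> (weighted_code G W) b \<longleftrightarrow> b \<in> active r \<psi> G"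
  unfolding cactive_def active_def set_decode_univ_code[OF assms(1)]
  using coutput_weighted_code[OF assms] by blast

lemma cmark_size_weighted_code:
  assumes "finite_structure \<tau> G" "well_formed \<tau> \<psi>"
  shows "cmark_size c k r \<psi> (weighted_code G W) = mark_size c k (card (active r \<psi> G))"
proof -
  have "active r \<psi> G \<subseteq> univ G" unfolding active_def query_output_def by auto
  then have "{..<univ_code (weighted_code G W)} \<inter> {b. b \<in> active r \<psi> G} = active r \<psi> G"
    using set_decode_univ_code[OF assms(1), of W] set_decode_less by auto
  then show ?thesis by (simp add: cmark_size_def cactive_weighted_code[OF assms])
qed

theorem theorem11:
  fixes C :: "nat ugraph set" and \<tau> :: signature and r :: nat and \<psi> :: formula
  assumes "\<forall>H \<in> C. simple_graph H"
    and "minor_closed C"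
    and "locally_bounded_tree_width C"
    and "unary_query \<tau> r \<psi>"
  shows "\<exists>M D f d. watermarking_scheme (structures_over \<tau> C) r \<psi> M D f d \<and> scalable f"
proof -
  have wf: "well_formed \<tau> \<psi>" using assms(4) by (simp add: unary_query_def)
  obtain g where "poly_bounded g" and
    pairs: "\<forall>G\<in>structures_over \<tau> C. \<forall>m. g m \<le> card (active r \<psi> G) \<longrightarrow>
    (\<exists>ps. length ps = 2 * m \<and> distinct ps \<and> set ps \<subseteq> active r \<psi> G \<and>
      (\<forall>a\<in>tuples (univ G) r. card (split_pairs m ((!) ps) (query_output r \<psi> G a)) \<le> r))"
    using query_pairs[OF assms] by blast
  then obtain c0 k0 where ck0: "\<And>m. g m \<le> c0 * (m + 1) ^ k0" unfolding poly_bounded_def by blast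
  \<comment> \<open>Both constants are made positive, as required for the growth of
    \<open>mark_size\<close>.\<close>
  define c k where "c = Suc c0" and "k = Suc k0"
  have ck: "g m \<le> c * (m + 1) ^ k" for m
  proof -
    have "(m + 1) ^ k0 \<le> (m + 1) ^ k" unfolding k_def by (intro power_increasing) auto
    then have "c0 * (m + 1) ^ k0 \<le> c * (m + 1) ^ k" unfolding c_def by (intro mult_le_mono) auto
    with ck0[of m] show ?thesis by linarith
  qed
  let ?valid = "valid_pairs c k r \<psi>"
  \<comment> \<open>Needed for two numbers of arguments: the marker also receives the mark. The
    result depends only on the code of the original structure, so both find the same least
    number.\<close>
  have search: "\<exists>S. \<forall>Q xs p. length xs = n \<longrightarrow> ?valid (xs ! 0) p \<longrightarrow> computes Q S xs (LEAST p. ?valid (xs ! 0) p)"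
    if "1 \<le> n" for n
  proof -
    have "cpred (Suc n) (\<lambda>Q ys. ?valid (ys ! 1) (ys ! 0))"
      using that by (intro cpred_valid_pairs crec_nth) auto
    from computes_least[OF this] show ?thesis by simp
  qed
  obtain S2 where S2: "\<forall>Q xs p. length xs = 2 \<longrightarrow> ?valid (xs ! 0) p \<longrightarrow> computes Q S2 xs (LEAST p. ?valid (xs ! 0) p)"
    using search[of 2] by auto
  obtain S1 where S1: "\<forall>Q xs p. length xs = 1 \<longrightarrow> ?valid (xs ! 0) p \<longrightarrow> computes Q S1 xs (LEAST p. ?valid (xs ! 0) p)"
    using search[of 1] by auto
  have "crec 3 (\<lambda>Q xs. marked_code c k r \<psi> (xs ! 0) (xs ! 1) (xs ! 2))"
    by (intro crec_marked_code crec_nth) auto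
  then obtain M0 where M0: "\<And>Q xs. length xs = 3 \<Longrightarrow>
      computes Q M0 xs (marked_code c k r \<psi> (xs ! 0) (xs ! 1) (xs ! 2))" unfolding crec_def by blast
  have "crec 2 (\<lambda>Q xs. read_mark c k r \<psi> Q (xs ! 0) (xs ! 1))"
    by (intro crec_read_mark crec_nth) auto
  then obtain D0 where D0: "\<And>Q xs. length xs = 2 \<Longrightarrow>
      computes Q D0 xs (read_mark c k r \<psi> Q (xs ! 0) (xs ! 1))" unfolding crec_def by blast
  define M where "M = Comp M0 [Proj 0, Proj 1, S2]"
  define D where "D = Comp D0 [Proj 0, S1]"
  have M: "computes Q M [w, mu] (marked_code c k r \<psi> w mu (LEAST p. ?valid w p))" if "?valid w p" for Q w mu p
    unfolding M_def
  proof (rule computes.Comp)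
    show "list_all2 (\<lambda>q y. computes Q q [w, mu] y) [Proj 0, Proj 1, S2] [w, mu, LEAST p. ?valid w p]"
      using computes.Proj[of 0 "[w, mu]" Q] computes.Proj[of 1 "[w, mu]" Q] S2[rule_format, of "[w, mu]" p Q] that by simp
    show "computes Q M0 [w, mu, LEAST p. ?valid w p] (marked_code c k r \<psi> w mu (LEAST p. ?valid w p))"
      using M0[of "[w, mu, LEAST p. ?valid w p]" Q] by simp
  qed
  have D: "computes Q D [w] (read_mark c k r \<psi> Q w (LEAST p. ?valid w p))" if "?valid w p" for Q w p
    unfolding D_def
  proof (rule computes.Comp)
    show "list_all2 (\<lambda>q y. computes Q q [w] y) [Proj 0, S1] [w, LEAST p. ?valid w p]"
      using computes.Proj[of 0 "[w]" Q] S1[rule_format, of "[w]" p Q] that by simp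
    show "computes Q D0 [w, LEAST p. ?valid w p] (read_mark c k r \<psi> Q w (LEAST p. ?valid w p))"
      using D0[of "[w, LEAST p. ?valid w p]" Q] by simp
  qed
  have "watermarking_scheme (structures_over \<tau> C) r \<psi> M D (mark_size c k) r"
    unfolding watermarking_scheme_def
  proof (clarify)
    fix G W and \<mu> :: "bool list"
    assume GW: "(G, W) \<in> weighted_over (structures_over \<tau> C) r \<psi>"
      and nz: "\<forall>b\<in>active r \<psi> G. W b \<noteq> Some 0"
      and len: "length \<mu> = mark_size c k (card (active r \<psi> G))"
    have GK: "G \<in> structures_over \<tau> C" and domW: "dom W \<subseteq> univ G" and actW: "active r \<psi> G \<subseteq> dom W"
      using GW unfolding weighted_over_def by auto
    have finG: "finite_structure \<tau> G" using GK unfolding structures_over_def by blast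
    have finW: "finite (dom W)" using domW finG unfolding finite_structure_def by (meson finite_subset)
    define w where "w = weighted_code G W"
    define m where "m = length \<mu>"
    have size: "cmark_size c k r \<psi> w = m"
      unfolding w_def m_def len by (rule cmark_size_weighted_code[OF finG wf])
    have snd_w: "snd (prod_decode w) = weights_code W" and fst_w: "fst (prod_decode w) = struct_code G"
      by (simp_all add: w_def weighted_code_def)
    note code = set_decode_univ_code[OF finG, of W, folded w_def]
      coutput_weighted_code[OF finG wf, of r W, folded w_def]
      cactive_weighted_code[OF finG wf, of r W, folded w_def]
    have count: "(\<Sum>i<m. of_bool (coutput r \<psi> w a (lnth p (2 * i)) \<noteq> coutput r \<psi> w a (lnth p (Suc (2 * i))))) =
        card (split_pairs m (lnth p) (query_output r \<psi> G a))"
      for a p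
    proof -
      have "{..<m} \<inter> {i. (lnth p (2 * i) \<in> X) \<noteq> (lnth p (Suc (2 * i)) \<in> X)} = split_pairs m (lnth p) X" for X
        by (auto simp: split_pairs_def)
      then show ?thesis by (simp add: code)
    qed
    have valid_iff: "?valid w p \<longleftrightarrow> (\<forall>i<2 * m. lnth p i \<in> active r \<psi> G) \<and>
        (\<forall>i<2 * m. \<forall>j<i. lnth p i \<noteq> lnth p j) \<and>
        (\<forall>a\<in>tuples (univ G) r. card (split_pairs m (lnth p) (query_output r \<psi> G a)) \<le> r)" for p
      unfolding valid_pairs_def size count unfolding code by simp
    \<comment> \<open>Without bits every number is valid; otherwise the length of the mark ensures
      that there are \<open>g m\<close> active elements.\<close>
    have "\<exists>p. ?valid w p"
    proof (cases "m = 0")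
      case True
      then show ?thesis unfolding valid_iff by (simp add: split_pairs_def)
    next
      case False
      then have "c * (m + 1) ^ k \<le> card (active r \<psi> G)"
        using mark_size_upper[of c k "card (active r \<psi> G)"] len unfolding m_def by simp
      then have "g m \<le> card (active r \<psi> G)" using ck[of m] by linarith
      then obtain ps where ps: "length ps = 2 * m" "distinct ps" "set ps \<subseteq> active r \<psi> G"
        "\<forall>a\<in>tuples (univ G) r. card (split_pairs m ((!) ps) (query_output r \<psi> G a)) \<le> r"
        using pairs GK by blast
      have nth: "lnth (list_encode ps) i = ps ! i" if "i < 2 * m" for i
        using that ps(1) by (intro lnth_list_encode) simp
      then have "split_pairs m (lnth (list_encode ps)) X = split_pairs m ((!) ps) X" for X
        by (auto simp: split_pairs_def)
      moreover have "lnth (list_encode ps) i \<noteq> lnth (list_encode ps) j" if "i < 2 * m" "j < i" for i j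
        using that nth[of i] nth[of j] ps(1,2) by (simp add: nth_eq_iff_index_eq)
      moreover have "lnth (list_encode ps) i \<in> active r \<psi> G" if "i < 2 * m" for i
        using that nth[of i] ps(1,3) nth_mem[of i ps] by auto
      ultimately have "?valid w (list_encode ps)" unfolding valid_iff using ps(4) by simp
      then show ?thesis ..
    qed
    then obtain p0 where p0: "?valid w p0" ..
    define p where "p = (LEAST p. ?valid w p)"
    have "?valid w p" unfolding p_def using p0 by (rule LeastI)
    then have p_active: "\<And>i. i < 2 * m \<Longrightarrow> lnth p i \<in> active r \<psi> G"
      and p_less: "\<And>i j. i < 2 * m \<Longrightarrow> j < i \<Longrightarrow> lnth p i \<noteq> lnth p j"
      and p_count: "\<And>a. a \<in> tuples (univ G) r \<Longrightarrow> card (split_pairs m (lnth p) (query_output r \<psi> G a)) \<le> r"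
      unfolding valid_iff by auto
    have p_inj: "i = j" if "lnth p i = lnth p j" "i < 2 * m" "j < 2 * m" for i j
      using that p_less[of i j] p_less[of j i] by (metis linorder_neqE_nat)
    let ?h = "\<lambda>i. lnth p (2 * i)" and ?h' = "\<lambda>i. lnth p (Suc (2 * i))"
    define I where "I = {i. i < m \<and> \<mu> ! i}"
    have bit: "lnth (mark_code \<mu>) i = 1 \<longleftrightarrow> \<mu> ! i" if "i < m" for i
      using that by (simp add: mark_code_def lnth_list_encode m_def)
    have new: "new_weight m (weights_code W) (mark_code \<mu>) p b =
        weight (weights_code W) b + of_bool (\<exists>i\<in>I. ?h i = b) - of_bool (\<exists>i\<in>I. ?h' i = b)" for b
    proof -
      have "(\<exists>i<m. lnth (mark_code \<mu>) i = 1 \<and> ?h i = b) \<longleftrightarrow> (\<exists>i\<in>I. ?h i = b)"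
        "(\<exists>i<m. lnth (mark_code \<mu>) i = 1 \<and> ?h' i = b) \<longleftrightarrow> (\<exists>i\<in>I. ?h' i = b)"
        using bit by (auto simp: I_def)
      then show ?thesis unfolding new_weight_def by simp
    qed
    define W' where "W' = (\<lambda>b. if b \<in> dom W then Some (new_weight m (weights_code W) (mark_code \<mu>) p b) else None)"
    have domW': "dom W' = dom W" by (auto simp: W'_def split: if_splits)
    have W'_diff: "int (the (W' b)) - int (the (W b)) = of_bool (\<exists>i\<in>I. ?h i = b) - of_bool (\<exists>i\<in>I. ?h' i = b)"
      if b: "b \<in> dom W" for b
    proof -
      obtain v where v: "W b = Some v" using b by blast
      \<comment> \<open>The assumption on weights excludes \<open>0\<close> for active elements, so
        lowering by one is not truncated.\<close>
      have "1 \<le> v" if "\<exists>i\<in>I. ?h' i = b"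
      proof -
        have "b \<in> active r \<psi> G" using that p_active by (auto simp: I_def)
        then have "v \<noteq> 0" using nz v by auto
        then show ?thesis by simp
      qed
      then show ?thesis using b v weight_weights_code[OF finW v] by (auto simp: W'_def new)
    qed
    have local: "local_distortion 1 W W'"
      unfolding local_distortion_def using domW' W'_diff by auto
    have out_active: "query_output r \<psi> G a \<subseteq> active r \<psi> G" if "a \<in> tuples (univ G) r" for a
      using that unfolding active_def by blast
    have global: "global_distortion r r \<psi> G W W'"
      unfolding global_distortion_def
    proof
      fix a assume a: "a \<in> tuples (univ G) r"
      let ?O = "query_output r \<psi> G a"
      have O: "?O \<subseteq> dom W" using out_active[OF a] actW by blast
      have "int (output_weight r \<psi> G W' a) - int (output_weight r \<psi> G W a) =
          (\<Sum>b\<in>?O. int (the (W' b)) - int (the (W b)))"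
        by (simp add: output_weight_def sum_subtractf)
      also have "\<dots> = (\<Sum>b\<in>?O. of_bool (\<exists>i\<in>I. ?h i = b) - of_bool (\<exists>i\<in>I. ?h' i = b))"
        using O W'_diff by (intro sum.cong refl) blast
      finally have diff: "int (output_weight r \<psi> G W' a) - int (output_weight r \<psi> G W a) = \<dots>" .
      have "\<bar>int (output_weight r \<psi> G W' a) - int (output_weight r \<psi> G W a)\<bar>
          \<le> int (card (split_pairs m (lnth p) ?O))"
        unfolding diff
      proof (rule pair_distortion)
        show "finite ?O" using O finW by (rule finite_subset)
        show "inj_on (lnth p) {..<2 * m}" by (rule inj_onI) (use p_inj in auto)
      qed (auto simp: I_def)
      also have "\<dots> \<le> int r" by (rule of_nat_mono[OF p_count[OF a]])
      finally show "\<bar>int (output_weight r \<psi> G W' a) - int (output_weight r \<psi> G W a)\<bar> \<le> int r" .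
    qed
    have "new_weights_code m (weights_code W) (mark_code \<mu>) p = weights_code W'"
      by (rule new_weights_code_eq[OF finW domW']) (simp add: W'_def)
    then have "marked_code c k r \<psi> w (mark_code \<mu>) p = weighted_code G W'"
      unfolding marked_code_def size snd_w fst_w weighted_code_def by simp
    then have marker: "computes (\<lambda>_. 0) M [weighted_code G W, mark_code \<mu>] (weighted_code G W')"
      using M[OF p0, of "\<lambda>_. 0" "mark_code \<mu>", folded p_def] by (simp add: w_def[symmetric])
    have "read_mark c k r \<psi> (answer_code r \<psi> G W') w p = mark_code \<mu>"
    proof -
      have "(\<exists>a\<in>tuples (univ G) r. prod_encode (?h i, Suc (weight (weights_code W) (?h i)))
          \<in> set_decode (answer_code r \<psi> G W' (list_encode a))) \<longleftrightarrow> \<mu> ! i" if i: "i < m" for i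
      proof -
        have act: "?h i \<in> active r \<psi> G" using p_active i by simp
        then obtain v where v: "W (?h i) = Some v" using actW by blast
        have wt: "weight (weights_code W) (?h i) = v" by (rule weight_weights_code[OF finW v])
        have h: "(\<exists>j\<in>I. ?h j = ?h i) \<longleftrightarrow> \<mu> ! i"
          using i p_inj[of "2 * _" "2 * i"] by (auto simp: I_def)
        \<comment> \<open>First members have even and second members odd positions, so no first
          member is ever lowered and its weight reveals the bit.\<close>
        have h': "\<not> (\<exists>j\<in>I. ?h' j = ?h i)"
        proof
          assume "\<exists>j\<in>I. ?h' j = ?h i"
          then obtain j where "j < m" "?h' j = ?h i" by (auto simp: I_def)
          then have "Suc (2 * j) = 2 * i" using p_inj[of "Suc (2 * j)" "2 * i"] i by simp
          then show False by presburger
        qed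
        have W'h: "W' (?h i) = Some (v + of_bool (\<mu> ! i))"
          using v by (auto simp: W'_def new wt h h')
        have "prod_encode (?h i, Suc v) \<in> set_decode (answer_code r \<psi> G W' (list_encode a)) \<longleftrightarrow>
            ?h i \<in> query_output r \<psi> G a \<and> \<mu> ! i" if a: "a \<in> tuples (univ G) r" for a
        proof -
          have "finite (dom (W' |` query_output r \<psi> G a))" using finW domW' by simp
          from mem_weights_code[OF this, of "?h i" "Suc v"] show ?thesis
            using a W'h by (auto simp: answer_code_def restrict_map_def)
        qed
        then show ?thesis using act unfolding wt active_def by blast
      qed
      then have "map (\<lambda>i. of_bool (\<exists>a\<in>tuples (univ G) r. prod_encode (?h i, Suc (weight (weights_code W) (?h i)))
          \<in> set_decode (answer_code r \<psi> G W' (list_encode a)))) [0..<m] = (map of_bool \<mu> :: nat list)"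
        by (intro nth_equalityI) (auto simp: m_def)
      then show ?thesis unfolding read_mark_def size snd_w code mark_code_def by simp
    qed
    then have detector: "computes (answer_code r \<psi> G W') D [weighted_code G W] (mark_code \<mu>)"
      using D[OF p0, of "answer_code r \<psi> G W'", folded p_def] by (simp add: w_def[symmetric])
    have "(G, W') \<in> weighted_over (structures_over \<tau> C) r \<psi>"
      using GW domW' unfolding weighted_over_def by simp
    with local global marker detector
    show "\<exists>W'. (G, W') \<in> weighted_over (structures_over \<tau> C) r \<psi> \<and>
      computes (\<lambda>_. 0) M [weighted_code G W, mark_code \<mu>] (weighted_code G W') \<and>
      local_distortion 1 W W' \<and> global_distortion r r \<psi> G W W' \<and>
      computes (answer_code r \<psi> G W') D [weighted_code G W] (mark_code \<mu>)" by blast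
  qed
  moreover have "scalable (mark_size c k)" by (rule scalable_mark_size) (auto simp: c_def k_def)
  ultimately show ?thesis by blast
qed

end
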